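(* Let $G=(V,E,s)$ be a reducible flow graph with $n$ vertices and initially $m$ edges. The dominator tree of $G$ can be maintained through any sequence of edge deletions in $O(mn)$ total time.
   Context: A flow graph $G=(V,E,s)$ is a directed graph with a distinguished start vertex $s$. A vertex $w$ dominates $v$ if every path from $s$ to $v$ contains $w$; the dominator tree is the tree rooted at $s$ on the vertices reachable from $s$ in which the parent of each $v\neq s$ is its immediate dominator (the dominator of $v$ other than $v$ that is dominated by all other dominators of $v$ other than $v$). A flow graph is reducible if every strongly connected subgraph $S$ has a single entry vertex $v$ such that every path from $s$ to a vertex of $S$ contains $v$. *)

theory Defs
  imports "Graph_Theory.Graph_Theory"
begin

section \<open>Flow graphs and dominators\<close>

locale flow_graph = pair_fin_digraph G for G :: "'a pair_pre_digraph" +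
  fixes s :: 'a
  assumes start_in_verts: "s \<in> pverts G"

definition dominates :: "'a pair_pre_digraph \<Rightarrow> 'a \<Rightarrow> 'a \<Rightarrow> 'a \<Rightarrow> bool" where
  "dominates G s w v \<longleftrightarrow>
     (\<forall>p. pre_digraph.awalk (with_proj G) s p v \<longrightarrow>
          w \<in> set (pre_digraph.awalk_verts (with_proj G) s p))"

definition immediate_dominator :: "'a pair_pre_digraph \<Rightarrow> 'a \<Rightarrow> 'a \<Rightarrow> 'a \<Rightarrow> bool" where
  "immediate_dominator G s d v \<longleftrightarrow>
     dominates G s d v \<and> d \<noteq> v \<and>
     (\<forall>w. dominates G s w v \<and> w \<noteq> v \<and> w \<noteq> d \<longrightarrow> dominates G s w d)"

text \<open>Arcs of the dominator tree point from the parent to the child.\<close>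

definition dominator_tree :: "'a pair_pre_digraph \<Rightarrow> 'a \<Rightarrow> 'a pair_pre_digraph" where
  "dominator_tree G s =
     \<lparr> pverts = {v. s \<rightarrow>\<^sup>*\<^bsub>with_proj G\<^esub> v},
       parcs = {(d, v). s \<rightarrow>\<^sup>*\<^bsub>with_proj G\<^esub> v \<and> v \<noteq> s \<and> immediate_dominator G s d v} \<rparr>"

text \<open>The entry vertex has to belong to \<open>S\<close>; otherwise \<open>s\<close> would always qualify.\<close>

definition reducible :: "'a pair_pre_digraph \<Rightarrow> 'a \<Rightarrow> bool" where
  "reducible G s \<longleftrightarrow>
     (\<forall>S. subgraph S (with_proj G) \<and> strongly_connected S \<longrightarrow>
       (\<exists>v \<in> verts S. \<forall>u \<in> verts S. \<forall>p. pre_digraph.awalk (with_proj G) s p u \<longrightarrow>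
          v \<in> set (pre_digraph.awalk_verts (with_proj G) s p)))"

definition delete_edge :: "'a pair_pre_digraph \<Rightarrow> 'a \<times> 'a \<Rightarrow> 'a pair_pre_digraph" where
  "delete_edge G e = G\<lparr> parcs := parcs G - {e} \<rparr>"


section \<open>Random access machine\<close>

text \<open>
  A structured presentation of the word RAM. The memory consists of named, unbounded arrays of
  natural numbers, of which a program mentions only finitely many; a scalar variable is
  cell \<open>0\<close> of an array. Subtraction is truncated at \<open>0\<close>, and \<open>x div 0 = 0\<close>, \<open>x mod 0 = x\<close>.
\<close>

type_synonym vname = string
type_synonym state = "vname \<Rightarrow> nat \<Rightarrow> nat"

datatype binop = Plus | Minus | Times | Quot | Rem

datatype expr = Const nat | Cell vname expr | Bin binop expr expr

datatype cond = Less expr expr | Equal expr expr | Neg cond | Conj cond cond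

datatype com =
    Skip
  | Assign vname expr expr  \<comment> \<open>array, index, new value\<close>
  | Seq com com
  | If cond com com
  | While cond com

fun binop_val :: "binop \<Rightarrow> nat \<Rightarrow> nat \<Rightarrow> nat" where
  "binop_val Plus a b = a + b"
| "binop_val Minus a b = a - b"
| "binop_val Times a b = a * b"
| "binop_val Quot a b = a div b"
| "binop_val Rem a b = a mod b"

fun expr_val :: "expr \<Rightarrow> state \<Rightarrow> nat" where
  "expr_val (Const k) \<sigma> = k"
| "expr_val (Cell x e) \<sigma> = \<sigma> x (expr_val e \<sigma>)"
| "expr_val (Bin f a b) \<sigma> = binop_val f (expr_val a \<sigma>) (expr_val b \<sigma>)"

fun cond_val :: "cond \<Rightarrow> state \<Rightarrow> bool" where
  "cond_val (Less a b) \<sigma> \<longleftrightarrow> expr_val a \<sigma> < expr_val b \<sigma>"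
| "cond_val (Equal a b) \<sigma> \<longleftrightarrow> expr_val a \<sigma> = expr_val b \<sigma>"
| "cond_val (Neg b) \<sigma> \<longleftrightarrow> \<not> cond_val b \<sigma>"
| "cond_val (Conj b c) \<sigma> \<longleftrightarrow> cond_val b \<sigma> \<and> cond_val c \<sigma>"

text \<open>
  Every value that occurs during an evaluation, addresses included, has to fit into a machine
  word, that is, has to be smaller than \<open>W\<close>. An overflowing computation is stuck.
\<close>

fun expr_fits :: "nat \<Rightarrow> expr \<Rightarrow> state \<Rightarrow> bool" where
  "expr_fits W (Const k) \<sigma> \<longleftrightarrow> k < W"
| "expr_fits W (Cell x e) \<sigma> \<longleftrightarrow> expr_fits W e \<sigma> \<and> \<sigma> x (expr_val e \<sigma>) < W"
| "expr_fits W (Bin f a b) \<sigma> \<longleftrightarrow>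
     expr_fits W a \<sigma> \<and> expr_fits W b \<sigma> \<and> expr_val (Bin f a b) \<sigma> < W"

fun cond_fits :: "nat \<Rightarrow> cond \<Rightarrow> state \<Rightarrow> bool" where
  "cond_fits W (Less a b) \<sigma> \<longleftrightarrow> expr_fits W a \<sigma> \<and> expr_fits W b \<sigma>"
| "cond_fits W (Equal a b) \<sigma> \<longleftrightarrow> expr_fits W a \<sigma> \<and> expr_fits W b \<sigma>"
| "cond_fits W (Neg b) \<sigma> \<longleftrightarrow> cond_fits W b \<sigma>"
| "cond_fits W (Conj b c) \<sigma> \<longleftrightarrow> cond_fits W b \<sigma> \<and> cond_fits W c \<sigma>"

fun expr_cost :: "expr \<Rightarrow> nat" where
  "expr_cost (Const k) = 1"
| "expr_cost (Cell x e) = 1 + expr_cost e"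
| "expr_cost (Bin f a b) = 1 + expr_cost a + expr_cost b"

fun cond_cost :: "cond \<Rightarrow> nat" where
  "cond_cost (Less a b) = 1 + expr_cost a + expr_cost b"
| "cond_cost (Equal a b) = 1 + expr_cost a + expr_cost b"
| "cond_cost (Neg b) = 1 + cond_cost b"
| "cond_cost (Conj b c) = 1 + cond_cost b + cond_cost c"

definition store :: "state \<Rightarrow> vname \<Rightarrow> nat \<Rightarrow> nat \<Rightarrow> state" where
  "store \<sigma> x i k = \<sigma>(x := (\<sigma> x)(i := k))"

text \<open>\<open>exec W c \<sigma> t \<sigma>'\<close>: with word bound \<open>W\<close>, started in \<open>\<sigma>\<close>, \<open>c\<close> halts after \<open>t\<close> steps in \<open>\<sigma>'\<close>.\<close>

inductive exec :: "nat \<Rightarrow> com \<Rightarrow> state \<Rightarrow> nat \<Rightarrow> state \<Rightarrow> bool" for W :: nat where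
  Skip: "exec W Skip \<sigma> 1 \<sigma>"
| Assign: "\<lbrakk> expr_fits W i \<sigma>; expr_fits W e \<sigma> \<rbrakk> \<Longrightarrow>
    exec W (Assign x i e) \<sigma> (1 + expr_cost i + expr_cost e)
      (store \<sigma> x (expr_val i \<sigma>) (expr_val e \<sigma>))"
| Seq: "\<lbrakk> exec W c1 \<sigma> t1 \<sigma>1; exec W c2 \<sigma>1 t2 \<sigma>2 \<rbrakk> \<Longrightarrow> exec W (Seq c1 c2) \<sigma> (t1 + t2) \<sigma>2"
| IfTrue: "\<lbrakk> cond_fits W b \<sigma>; cond_val b \<sigma>; exec W c1 \<sigma> t \<sigma>' \<rbrakk> \<Longrightarrow>
    exec W (If b c1 c2) \<sigma> (1 + cond_cost b + t) \<sigma>'"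
| IfFalse: "\<lbrakk> cond_fits W b \<sigma>; \<not> cond_val b \<sigma>; exec W c2 \<sigma> t \<sigma>' \<rbrakk> \<Longrightarrow>
    exec W (If b c1 c2) \<sigma> (1 + cond_cost b + t) \<sigma>'"
| WhileFalse: "\<lbrakk> cond_fits W b \<sigma>; \<not> cond_val b \<sigma> \<rbrakk> \<Longrightarrow>
    exec W (While b c) \<sigma> (1 + cond_cost b) \<sigma>"
| WhileTrue: "\<lbrakk> cond_fits W b \<sigma>; cond_val b \<sigma>; exec W c \<sigma> t1 \<sigma>1; exec W (While b c) \<sigma>1 t2 \<sigma>2 \<rbrakk> \<Longrightarrow>
    exec W (While b c) \<sigma> (1 + cond_cost b + t1 + t2) \<sigma>2"

inductive_cases exec_elims:
  "exec W Skip \<sigma> t \<sigma>'"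
  "exec W (Assign x i e) \<sigma> t \<sigma>'"
  "exec W (Seq c1 c2) \<sigma> t \<sigma>'"
  "exec W (If b c1 c2) \<sigma> t \<sigma>'"

inductive_cases exec_WhileE: "exec W (While b c) \<sigma> t \<sigma>'"

lemma exec_deterministic:
  assumes "exec W c \<sigma> t \<sigma>'" and "exec W c \<sigma> u \<tau>"
  shows "u = t \<and> \<tau> = \<sigma>'"
  using assms
proof (induction arbitrary: u \<tau> rule: exec.induct)
  case (Seq c1 \<sigma> t1 \<sigma>1 c2 t2 \<sigma>2)
  then show ?case by (blast elim: exec_elims)
next
  case (WhileFalse b \<sigma> c)
  from WhileFalse.prems show ?case
    by (rule exec_WhileE) (use WhileFalse.hyps in auto)
next
  case (WhileTrue b \<sigma> c t1 \<sigma>1 t2 \<sigma>2)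
  from WhileTrue.prems obtain v1 \<tau>1 v2 where *: "u = 1 + cond_cost b + v1 + v2"
    "exec W c \<sigma> v1 \<tau>1" "exec W (While b c) \<tau>1 v2 \<tau>"
    by (rule exec_WhileE) (use WhileTrue.hyps in auto)
  with WhileTrue.IH(1) have "v1 = t1" "\<tau>1 = \<sigma>1" by blast+
  with * WhileTrue.IH(2) show ?case by blast
next
  case (IfTrue b \<sigma> c1 t \<sigma>' c2)
  from IfTrue.prems show ?case
    by (rule exec_elims(4)) (use IfTrue.hyps IfTrue.IH in \<open>metis plus_1_eq_Suc add_Suc\<close>)+
next
  case (IfFalse b \<sigma> c2 t \<sigma>' c1)
  from IfFalse.prems show ?case
    by (rule exec_elims(4)) (use IfFalse.hyps IfFalse.IH in \<open>metis plus_1_eq_Suc add_Suc\<close>)+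
next
  case (Skip \<sigma>)
  then show ?case by (rule exec_elims(1)) simp
next
  case (Assign i \<sigma> e x)
  from Assign.prems show ?case by (rule exec_elims(2)) simp
qed


section \<open>Maintaining a dominator tree under edge deletions\<close>

text \<open>
  The input graph is given on the vertices \<open>0, \<dots>, n - 1\<close> as a list of its edges. All cells that
  do not hold input are initially \<open>0\<close>.
\<close>

definition input_state :: "nat \<Rightarrow> nat \<Rightarrow> (nat \<times> nat) list \<Rightarrow> state" where
  "input_state n s as = (\<lambda>_ _. 0)
     (''n'' := (\<lambda>_. 0)(0 := n),
      ''m'' := (\<lambda>_. 0)(0 := length as),
      ''s'' := (\<lambda>_. 0)(0 := s),
      ''tail'' := (\<lambda>i. if i < length as then fst (as ! i) else 0),
      ''head'' := (\<lambda>i. if i < length as then snd (as ! i) else 0))"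

definition request :: "nat \<times> nat \<Rightarrow> state \<Rightarrow> state" where
  "request e \<sigma> = store (store \<sigma> ''del_tail'' 0 (fst e)) ''del_head'' 0 (snd e)"

definition stored_tree :: "nat \<Rightarrow> nat \<Rightarrow> state \<Rightarrow> nat pair_pre_digraph" where
  "stored_tree n s \<sigma> =
     \<lparr> pverts = {v. v < n \<and> \<sigma> ''in_tree'' v \<noteq> 0},
       parcs = {(\<sigma> ''parent'' v, v) |v. v < n \<and> \<sigma> ''in_tree'' v \<noteq> 0 \<and> v \<noteq> s} \<rparr>"

text \<open>
  \<open>maintains W upd n G s \<sigma> es t\<close>: in state \<open>\<sigma>\<close> the dominator tree of \<open>G\<close> is stored, and serving the
  deletions \<open>es\<close> one by one with \<open>upd\<close> takes \<open>t\<close> steps in total, the dominator tree of the current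
  graph being stored after each of them. The program sees a deletion only when its turn comes.
\<close>

fun maintains ::
  "nat \<Rightarrow> com \<Rightarrow> nat \<Rightarrow> nat pair_pre_digraph \<Rightarrow> nat \<Rightarrow> state \<Rightarrow> (nat \<times> nat) list \<Rightarrow> nat \<Rightarrow> bool"
where
  "maintains W upd n G s \<sigma> [] t \<longleftrightarrow> stored_tree n s \<sigma> = dominator_tree G s \<and> t = 0"
| "maintains W upd n G s \<sigma> (e # es) t \<longleftrightarrow>
     stored_tree n s \<sigma> = dominator_tree G s \<and>
     (\<exists>t1 \<sigma>' t2. exec W upd (request e \<sigma>) t1 \<sigma>' \<and>
        maintains W upd n (delete_edge G e) s \<sigma>' es t2 \<and> t = t1 + t2)"

end

theory Submission
  imports Defs "HOL-Library.Sublist"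
begin

text \<open>
  A vertex \<open>w\<close> dominates \<open>v\<close> iff \<open>v\<close> cannot be reached from \<open>s\<close> once \<open>w\<close> is removed, so it suffices to
  maintain, for each of the \<open>n\<close> vertices \<open>w\<close>, the set of vertices reachable in \<open>G - w\<close>, each within
  \<open>O(m)\<close> total time.

  Call an edge \<open>(u, v)\<close> forward if \<open>v\<close> does not dominate \<open>u\<close> in the initial graph. The other edges never
  matter for reachability in any \<open>G - w\<close>, now or after deletions, because a simple path from \<open>s\<close> cannot
  use them; and in a reducible graph the forward edges are acyclic. On an acyclic graph decremental
  reachability is easy: a vertex stays reachable as long as the number of its reachable predecessors,
  kept in a counter, is positive, and a vertex whose counter drops to \<open>0\<close> decrements the counters of its
  successors. Every vertex dies at most once per \<open>w\<close>, which pays for scanning its outgoing edges.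

  Deletions only enlarge the sets of dominators. The new parent of \<open>v\<close> is the deepest among the old parent
  and the vertices \<open>w\<close> in whose copy \<open>v\<close> has just died; depths are compared by asking whether the
  current candidate dominates \<open>w\<close>.
\<close>


section \<open>Weakest preconditions for the machine\<close>

fun writes :: "com \<Rightarrow> vname set" where
  "writes Skip = {}"
| "writes (Assign x i e) = {x}"
| "writes (Seq c d) = writes c \<union> writes d"
| "writes (If b c d) = writes c \<union> writes d"
| "writes (While b c) = writes c"

fun reads :: "expr \<Rightarrow> vname set" where
  "reads (Const k) = {}"
| "reads (Cell x e) = insert x (reads e)"
| "reads (Bin f a b) = reads a \<union> reads b"

definition bounded_state :: "nat \<Rightarrow> state \<Rightarrow> bool" where
  "bounded_state W \<sigma> \<longleftrightarrow> (\<forall>x i. \<sigma> x i < W)"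

definition frame :: "nat \<Rightarrow> vname set \<Rightarrow> state \<Rightarrow> state \<Rightarrow> bool" where
  "frame W X \<sigma> \<tau> \<longleftrightarrow> bounded_state W \<tau> \<and> (\<forall>x. x \<notin> X \<longrightarrow> \<tau> x = \<sigma> x)"

definition wp :: "nat \<Rightarrow> com \<Rightarrow> (nat \<Rightarrow> state \<Rightarrow> bool) \<Rightarrow> state \<Rightarrow> bool" where
  "wp W c Q \<sigma> \<longleftrightarrow> (\<exists>t \<tau>. exec W c \<sigma> t \<tau> \<and> Q t \<tau>)"

lemma store_apply: "store \<sigma> x i k y = (if y = x then (\<sigma> x)(i := k) else \<sigma> y)"
  by (simp add: store_def)

lemma bounded_stateD: "bounded_state W \<sigma> \<Longrightarrow> \<sigma> x i < W"
  by (simp add: bounded_state_def)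

lemma bounded_state_store: "bounded_state W \<sigma> \<Longrightarrow> k < W \<Longrightarrow> bounded_state W (store \<sigma> x i k)"
  by (simp add: bounded_state_def store_apply)

lemma expr_val_less: "expr_fits W e \<sigma> \<Longrightarrow> expr_val e \<sigma> < W"
  by (cases e) auto

lemma expr_cong:
  assumes "\<forall>x\<in>reads e. \<tau> x = \<sigma> x"
  shows "expr_val e \<tau> = expr_val e \<sigma>" and "expr_fits W e \<tau> \<longleftrightarrow> expr_fits W e \<sigma>"
  using assms by (induction e) auto

lemma frameD: "frame W X \<sigma> \<tau> \<Longrightarrow> x \<notin> X \<Longrightarrow> \<tau> x = \<sigma> x"
  by (simp add: frame_def)

lemma frame_bounded: "frame W X \<sigma> \<tau> \<Longrightarrow> bounded_state W \<tau>"
  by (simp add: frame_def)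

lemma frame_refl: "bounded_state W \<sigma> \<Longrightarrow> frame W X \<sigma> \<sigma>"
  by (simp add: frame_def)

lemma frame_mono: "frame W X \<sigma> \<tau> \<Longrightarrow> X \<subseteq> Y \<Longrightarrow> frame W Y \<sigma> \<tau>"
  by (auto simp: frame_def)

lemma frame_trans: "frame W X \<rho> \<sigma> \<Longrightarrow> frame W Y \<sigma> \<tau> \<Longrightarrow> X \<union> Y \<subseteq> Z \<Longrightarrow> frame W Z \<rho> \<tau>"
  unfolding frame_def by (metis Un_subset_iff subsetD)

lemma frame_store: "bounded_state W \<sigma> \<Longrightarrow> k < W \<Longrightarrow> frame W {x} \<sigma> (store \<sigma> x i k)"
  by (simp add: frame_def bounded_state_store store_apply)

lemma exec_frame:
  assumes "exec W c \<sigma> t \<tau>" "bounded_state W \<sigma>"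
  shows "frame W (writes c) \<sigma> \<tau>"
  using assms
proof (induction rule: exec.induct)
  case Seq
  then show ?case by (auto intro: frame_trans dest: frame_bounded)
next
  case WhileTrue
  then show ?case by (auto intro: frame_trans dest: frame_bounded)
qed (auto intro: frame_refl frame_store expr_val_less frame_mono)

lemma wp_Skip [simp]: "wp W Skip Q \<sigma> \<longleftrightarrow> Q 1 \<sigma>"
  unfolding wp_def using exec.Skip[of W \<sigma>] by (auto elim: exec_elims(1))

lemma wp_Assign [simp]:
  "wp W (Assign x i e) Q \<sigma> \<longleftrightarrow> expr_fits W i \<sigma> \<and> expr_fits W e \<sigma> \<and>
     Q (1 + expr_cost i + expr_cost e) (store \<sigma> x (expr_val i \<sigma>) (expr_val e \<sigma>))"
  unfolding wp_def using exec.Assign[of W i \<sigma> e x] by (auto elim: exec_elims(2))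

lemma wp_Seq [simp]: "wp W (Seq c d) Q \<sigma> \<longleftrightarrow> wp W c (\<lambda>t. wp W d (\<lambda>u. Q (t + u))) \<sigma>"
  unfolding wp_def by (auto intro: exec.Seq elim!: exec_elims(3))

lemma wp_If [simp]:
  "wp W (If b c d) Q \<sigma> \<longleftrightarrow> cond_fits W b \<sigma> \<and>
     wp W (if cond_val b \<sigma> then c else d) (\<lambda>t. Q (1 + cond_cost b + t)) \<sigma>"
  unfolding wp_def by (cases "cond_val b \<sigma>")
    (auto elim!: exec_elims(4) intro: exec.IfTrue[simplified] exec.IfFalse[simplified])

lemma wpE:
  assumes "wp W c Q \<sigma>" "bounded_state W \<sigma>"
  obtains t \<tau> where "exec W c \<sigma> t \<tau>" "Q t \<tau>" "frame W (writes c) \<sigma> \<tau>"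
  using assms exec_frame unfolding wp_def by blast

lemma wp_mono: "wp W c Q \<sigma> \<Longrightarrow> (\<And>t \<tau>. Q t \<tau> \<Longrightarrow> R t \<tau>) \<Longrightarrow> wp W c R \<sigma>"
  unfolding wp_def by blast

lemma wp_mono_frame:
  assumes "wp W c Q \<sigma>" "bounded_state W \<sigma>"
    and "\<And>t \<tau>. Q t \<tau> \<Longrightarrow> frame W (writes c) \<sigma> \<tau> \<Longrightarrow> R t \<tau>"
  shows "wp W c R \<sigma>"
  using assms(1,2) by (rule wpE) (auto simp: wp_def intro: assms(3))

lemma wp_While:
  fixes \<Phi> :: "state \<Rightarrow> nat"
  assumes "bounded_state W \<sigma>0" "I \<sigma>0"
    and fits: "\<And>\<sigma>. I \<sigma> \<Longrightarrow> frame W (writes c) \<sigma>0 \<sigma> \<Longrightarrow> cond_fits W b \<sigma>"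
    and step: "\<And>\<sigma>. I \<sigma> \<Longrightarrow> frame W (writes c) \<sigma>0 \<sigma> \<Longrightarrow> cond_val b \<sigma> \<Longrightarrow>
      wp W c (\<lambda>t \<tau>. 1 + cond_cost b + t + \<Phi> \<tau> \<le> \<Phi> \<sigma> \<and> I \<tau>) \<sigma>"
  shows "wp W (While b c)
    (\<lambda>t \<tau>. t + \<Phi> \<tau> \<le> 1 + cond_cost b + \<Phi> \<sigma>0 \<and> I \<tau> \<and> \<not> cond_val b \<tau>) \<sigma>0"
proof -
  have "wp W (While b c) (\<lambda>t \<tau>. t + \<Phi> \<tau> \<le> 1 + cond_cost b + \<Phi> \<sigma> \<and> I \<tau> \<and> \<not> cond_val b \<tau>) \<sigma>"
    if "I \<sigma>" "frame W (writes c) \<sigma>0 \<sigma>" for \<sigma>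
    using that
  proof (induction "\<Phi> \<sigma>" arbitrary: \<sigma> rule: less_induct)
    case less
    note fits = fits[OF less.prems]
    show ?case
    proof (cases "cond_val b \<sigma>")
      case True
      obtain t \<sigma>' where body: "exec W c \<sigma> t \<sigma>'" "1 + cond_cost b + t + \<Phi> \<sigma>' \<le> \<Phi> \<sigma>" "I \<sigma>'"
        "frame W (writes c) \<sigma> \<sigma>'"
        using step[OF less.prems True] frame_bounded[OF less.prems(2)] by (auto elim: wpE)
      from less.prems(2) body(4) have "frame W (writes c) \<sigma>0 \<sigma>'" by (rule frame_trans) simp
      with less.hyps[of \<sigma>'] body(2,3) obtain u \<tau> where rest: "exec W (While b c) \<sigma>' u \<tau>"
        "u + \<Phi> \<tau> \<le> 1 + cond_cost b + \<Phi> \<sigma>'" "I \<tau>" "\<not> cond_val b \<tau>"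
        by (auto simp: wp_def)
      from exec.WhileTrue[OF fits True body(1) rest(1)] body(2) rest(2-4) show ?thesis
        unfolding wp_def by (intro exI[of _ "1 + cond_cost b + t + u"] exI[of _ \<tau>]) simp
    next
      case False
      from exec.WhileFalse[OF fits False] less.prems(1) False show ?thesis
        unfolding wp_def by blast
    qed
  qed
  from this[OF assms(2) frame_refl[OF assms(1)]] show ?thesis .
qed

abbreviation Var :: "vname \<Rightarrow> expr" where
  "Var x \<equiv> Cell x (Const 0)"

abbreviation Put :: "vname \<Rightarrow> expr \<Rightarrow> com" where
  "Put x e \<equiv> Assign x (Const 0) e"

abbreviation Inc :: "vname \<Rightarrow> com" where
  "Inc x \<equiv> Put x (Bin Plus (Var x) (Const 1))"

definition For :: "vname \<Rightarrow> expr \<Rightarrow> com \<Rightarrow> com" where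
  "For i e c = Seq (Put i (Const 0)) (While (Less (Var i) e) (Seq c (Inc i)))"

lemma writes_For [simp]: "writes (For i e c) = insert i (writes c)"
  by (simp add: For_def)

text \<open>The constants pay for testing and incrementing the counter.\<close>

lemma wp_counting_While:
  fixes B :: "nat \<Rightarrow> nat"
  assumes bounded: "bounded_state W \<sigma>0" "1 < W"
    and limit: "expr_fits W e \<sigma>0" "expr_val e \<sigma>0 = N" "reads e \<inter> insert i (writes c) = {}"
    and i: "i \<notin> writes c" "\<sigma>0 i 0 = 0"
    and init: "I 0 \<sigma>0"
    and indep: "\<And>k \<sigma> \<tau>. I k \<sigma> \<Longrightarrow> frame W {i} \<sigma> \<tau> \<Longrightarrow> I k \<tau>"
    and step: "\<And>k \<sigma>. k < N \<Longrightarrow> I k \<sigma> \<Longrightarrow> \<sigma> i 0 = k \<Longrightarrow> frame W (insert i (writes c)) \<sigma>0 \<sigma> \<Longrightarrow>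
      wp W c (\<lambda>t \<tau>. t \<le> B k \<and> I (Suc k) \<tau>) \<sigma>"
  shows "wp W (While (Less (Var i) e) (Seq c (Inc i)))
    (\<lambda>t \<tau>. t \<le> (\<Sum>k<N. B k + (expr_cost e + 10)) + (expr_cost e + 4) \<and> I N \<tau>) \<sigma>0"
proof -
  define b where "b = Less (Var i) e"
  define \<Phi> where "\<Phi> \<sigma> = (\<Sum>k\<in>{\<sigma> i 0..<N}. B k + (expr_cost e + 10))" for \<sigma> :: state
  define J where "J \<sigma> \<longleftrightarrow> \<sigma> i 0 \<le> N \<and> I (\<sigma> i 0) \<sigma>" for \<sigma>
  have "N < W" using limit(1,2) expr_val_less by blast
  have b_fits: "cond_fits W b \<sigma>" and b_val: "cond_val b \<sigma> \<longleftrightarrow> \<sigma> i 0 < N"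
    if "frame W (insert i (writes c)) \<sigma>0 \<sigma>" for \<sigma>
    using that limit bounded(2) bounded_stateD[OF frame_bounded[OF that]] expr_cong[of e \<sigma> \<sigma>0]
    by (auto simp: b_def frame_def disjoint_iff)
  have "wp W (While b (Seq c (Inc i)))
    (\<lambda>t \<tau>. t + \<Phi> \<tau> \<le> 1 + cond_cost b + \<Phi> \<sigma>0 \<and> J \<tau> \<and> \<not> cond_val b \<tau>) \<sigma>0"
  proof (rule wp_While[OF bounded(1)])
    show "J \<sigma>0" using init i(2) by (simp add: J_def)
  next
    fix \<sigma> assume J: "J \<sigma>" and "frame W (writes (Seq c (Inc i))) \<sigma>0 \<sigma>"
    then have frame: "frame W (insert i (writes c)) \<sigma>0 \<sigma>" by simp
    then show "cond_fits W b \<sigma>" by (rule b_fits)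
    assume "cond_val b \<sigma>"
    then have less: "\<sigma> i 0 < N" by (simp add: b_val[OF frame])
    then have first: "{\<sigma> i 0..<N} = insert (\<sigma> i 0) {Suc (\<sigma> i 0)..<N}" by auto
    from step[OF less _ refl frame] J
    have "wp W c (\<lambda>t \<tau>. t \<le> B (\<sigma> i 0) \<and> I (Suc (\<sigma> i 0)) \<tau>) \<sigma>" by (simp add: J_def)
    from wp_mono_frame[OF this frame_bounded[OF frame]]
    show "wp W (Seq c (Inc i)) (\<lambda>t \<tau>. 1 + cond_cost b + t + \<Phi> \<tau> \<le> \<Phi> \<sigma> \<and> J \<tau>) \<sigma>"
      using less \<open>N < W\<close> bounded(2) indep[OF _ frame_store, of "Suc (\<sigma> i 0)"] frameD[OF _ i(1)]
      by (simp add: \<Phi>_def J_def b_def store_apply first frame_bounded)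
  qed
  then show ?thesis
    unfolding b_def[symmetric]
  proof (rule wp_mono_frame[OF _ bounded(1)])
    fix t \<tau>
    assume "t + \<Phi> \<tau> \<le> 1 + cond_cost b + \<Phi> \<sigma>0 \<and> J \<tau> \<and> \<not> cond_val b \<tau>"
      and "frame W (writes (While b (Seq c (Inc i)))) \<sigma>0 \<tau>"
    then show "t \<le> (\<Sum>k<N. B k + (expr_cost e + 10)) + (expr_cost e + 4) \<and> I N \<tau>"
      using b_val[of \<tau>] i(2) by (auto simp: J_def \<Phi>_def b_def atLeast0LessThan)
  qed
qed

lemma wp_For:
  fixes B :: "nat \<Rightarrow> nat"
  assumes bounded: "bounded_state W \<sigma>0" "1 < W"
    and limit: "expr_fits W e \<sigma>0" "expr_val e \<sigma>0 = N" "reads e \<inter> insert i (writes c) = {}"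
    and i: "i \<notin> writes c"
    and init: "I 0 \<sigma>0"
    and indep: "\<And>k \<sigma> \<tau>. I k \<sigma> \<Longrightarrow> frame W {i} \<sigma> \<tau> \<Longrightarrow> I k \<tau>"
    and step: "\<And>k \<sigma>. k < N \<Longrightarrow> I k \<sigma> \<Longrightarrow> \<sigma> i 0 = k \<Longrightarrow> frame W (insert i (writes c)) \<sigma>0 \<sigma> \<Longrightarrow>
      wp W c (\<lambda>t \<tau>. t \<le> B k \<and> I (Suc k) \<tau>) \<sigma>"
  shows "wp W (For i e c)
    (\<lambda>t \<tau>. t \<le> (\<Sum>k<N. B k + (expr_cost e + 10)) + (expr_cost e + 10) \<and> I N \<tau>) \<sigma>0"
proof -
  define \<sigma>1 where "\<sigma>1 = store \<sigma>0 i 0 0"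
  have frame: "frame W {i} \<sigma>0 \<sigma>1" using bounded by (simp add: \<sigma>1_def frame_store)
  have "wp W (While (Less (Var i) e) (Seq c (Inc i)))
    (\<lambda>t \<tau>. t \<le> (\<Sum>k<N. B k + (expr_cost e + 10)) + (expr_cost e + 4) \<and> I N \<tau>) \<sigma>1"
  proof (rule wp_counting_While[where I = I])
    have "\<forall>x\<in>reads e. \<sigma>1 x = \<sigma>0 x" using limit(3) by (auto simp: \<sigma>1_def store_apply)
    from expr_cong[OF this] limit show "expr_fits W e \<sigma>1" "expr_val e \<sigma>1 = N" by simp_all
    show "bounded_state W \<sigma>1" using frame by (rule frame_bounded)
    show "\<sigma>1 i 0 = 0" by (simp add: \<sigma>1_def store_apply)
    show "I 0 \<sigma>1" using init frame by (rule indep)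
  next
    fix k \<sigma>
    assume I: "k < N" "I k \<sigma>" "\<sigma> i 0 = k" and "frame W (insert i (writes c)) \<sigma>1 \<sigma>"
    with frame have "frame W (insert i (writes c)) \<sigma>0 \<sigma>" by (auto intro: frame_trans)
    with I show "wp W c (\<lambda>t \<tau>. t \<le> B k \<and> I (Suc k) \<tau>) \<sigma>" by (rule step)
  qed (use bounded limit i indep in auto)
  from wp_mono_frame[OF this frame_bounded[OF frame]] show ?thesis
    using bounded(2) by (simp add: For_def \<sigma>1_def)
qed

corollary wp_For_uniform:
  assumes "bounded_state W \<sigma>0" "1 < W"
    and "expr_fits W e \<sigma>0" "expr_val e \<sigma>0 = N" "reads e \<inter> insert i (writes c) = {}"
    and "i \<notin> writes c" "I 0 \<sigma>0" "\<And>k \<sigma> \<tau>. I k \<sigma> \<Longrightarrow> frame W {i} \<sigma> \<tau> \<Longrightarrow> I k \<tau>"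
    and "\<And>k \<sigma>. k < N \<Longrightarrow> I k \<sigma> \<Longrightarrow> \<sigma> i 0 = k \<Longrightarrow> frame W (insert i (writes c)) \<sigma>0 \<sigma> \<Longrightarrow>
      wp W c (\<lambda>t \<tau>. t \<le> B \<and> I (Suc k) \<tau>) \<sigma>"
  shows "wp W (For i e c) (\<lambda>t \<tau>. t \<le> (B + expr_cost e + 10) * (N + 1) \<and> I N \<tau>) \<sigma>0"
proof (rule wp_mono_frame[OF wp_For[where I = I and B = "\<lambda>_. B", OF assms] assms(1)])
  fix t \<tau>
  assume "t \<le> (\<Sum>k<N. B + (expr_cost e + 10)) + (expr_cost e + 10) \<and> I N \<tau>"
  then show "t \<le> (B + expr_cost e + 10) * (N + 1) \<and> I N \<tau>" by (simp add: algebra_simps)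
qed


section \<open>Reachability avoiding a vertex\<close>

text \<open>False for all \<open>v\<close> if \<open>w = s\<close>.\<close>

inductive avoids :: "'a \<Rightarrow> 'a rel \<Rightarrow> 'a \<Rightarrow> 'a \<Rightarrow> bool" for s E w where
  avoids_start: "w \<noteq> s \<Longrightarrow> avoids s E w s"
| avoids_step: "avoids s E w x \<Longrightarrow> (x, y) \<in> E \<Longrightarrow> y \<noteq> w \<Longrightarrow> avoids s E w y"

lemma not_avoids_self [simp]: "\<not> avoids s E w w"
  by (auto elim: avoids.cases)

lemma not_avoids_start [simp]: "\<not> avoids s E s v"
proof
  show False if "avoids s E s v" using that by (induction rule: avoids.induct) auto
qed

lemma avoids_iff: "avoids s E w y \<longleftrightarrow> y \<noteq> w \<and> (y = s \<or> (\<exists>x. avoids s E w x \<and> (x, y) \<in> E))"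
  by (auto intro: avoids.intros elim: avoids.cases)

lemma avoids_mono: "avoids s E w v \<Longrightarrow> E \<subseteq> E' \<Longrightarrow> avoids s E' w v"
  by (induction rule: avoids.induct) (auto intro: avoids.intros)

lemma avoids_trans: "avoids s E a c \<Longrightarrow> avoids s E a b \<or> avoids s E b c"
  by (induction rule: avoids.induct) (auto intro: avoids.intros)

lemma avoids_imp_rtrancl: "avoids s E w v \<Longrightarrow> (s, v) \<in> E\<^sup>*"
  by (induction rule: avoids.induct) (auto intro: rtrancl_into_rtrancl)

lemma avoids_fresh_iff:
  assumes "w \<noteq> s" "w \<notin> Range E"
  shows "avoids s E w v \<longleftrightarrow> (s, v) \<in> E\<^sup>*"
proof
  assume "(s, v) \<in> E\<^sup>*"
  then show "avoids s E w v"
    by (induction rule: rtrancl_induct) (use assms in \<open>auto intro: avoids.intros\<close>)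
qed (rule avoids_imp_rtrancl)

lemma not_avoids_imp_rtrancl:
  assumes "(s, v) \<in> E\<^sup>*" "\<not> avoids s E w v"
  shows "(s, w) \<in> E\<^sup>*"
  using assms
proof (induction rule: rtrancl_induct)
  case (step x y)
  then show ?case by (metis avoids_step rtrancl_into_rtrancl)
qed (auto intro: avoids_start)

lemma rtrancl_Image_subset: "{v. (s, v) \<in> E\<^sup>*} \<subseteq> insert s (snd ` E)"
proof
  fix v assume "v \<in> {v. (s, v) \<in> E\<^sup>*}"
  then have "(s, v) \<in> E\<^sup>*" by simp
  then show "v \<in> insert s (snd ` E)" by cases force+
qed

lemma finite_rtrancl_Image: "finite E \<Longrightarrow> finite {v. (s, v) \<in> E\<^sup>*}"
  using rtrancl_Image_subset by (rule finite_subset) simp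

lemma card_rtrancl_Image_le:
  assumes "finite E"
  shows "card {v. (s, v) \<in> E\<^sup>*} \<le> card E + 1"
proof -
  have "card {v. (s, v) \<in> E\<^sup>*} \<le> card (insert s (snd ` E))"
    using assms by (intro card_mono rtrancl_Image_subset) simp
  also have "\<dots> \<le> card (snd ` E) + 1" using assms by (simp add: card_insert_if)
  also have "card (snd ` E) \<le> card E" using assms by (rule card_image_le)
  finally show ?thesis by simp
qed

text \<open>Acyclicity excludes solutions of the equation that support themselves along a cycle.\<close>

lemma avoids_unique:
  assumes "wf E" and A: "\<And>y. A y \<longleftrightarrow> y \<noteq> w \<and> (y = s \<or> (\<exists>x. A x \<and> (x, y) \<in> E))"
  shows "A y \<longleftrightarrow> avoids s E w y"
  using assms(1)
proof (induction y rule: wf_induct_rule)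
  case (less y)
  then show ?case using A[of y] avoids_iff[of s E w y] by blast
qed

lemma rtrancl_avoids_cases:
  assumes "(s, v) \<in> E\<^sup>*" "a \<noteq> b"
    and "\<And>x. avoids s E a x \<Longrightarrow> (x, a) \<in> E \<Longrightarrow> avoids s E b a"
    and "\<And>x. avoids s E b x \<Longrightarrow> (x, b) \<in> E \<Longrightarrow> avoids s E a b"
  shows "avoids s E a v \<or> avoids s E b v"
  using assms(1)
proof (induction rule: rtrancl_induct)
  case base
  show ?case using assms(2) by (auto intro: avoids_start)
next
  case (step x y)
  then show ?case using assms(3,4) by (metis avoids_step)
qed

lemma not_avoids_antisym:
  assumes "(s, b) \<in> E\<^sup>*" "\<not> avoids s E a b" "\<not> avoids s E b a"
  shows "a = b"
proof (rule ccontr)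
  assume "a \<noteq> b"
  then have "avoids s E a b \<or> avoids s E b b"
    using assms(1)
  proof (intro rtrancl_avoids_cases)
    show "avoids s E b a" if "avoids s E a x" "(x, a) \<in> E" for x
      using that assms(2) \<open>a \<noteq> b\<close> by (metis avoids_trans avoids_step)
    show "avoids s E a b" if "avoids s E b x" "(x, b) \<in> E" for x
      using that assms(3) \<open>a \<noteq> b\<close> by (metis avoids_trans avoids_step)
  qed
  with assms(2) show False by simp
qed

lemma not_avoids_linear:
  assumes "(s, v) \<in> E\<^sup>*" "\<not> avoids s E a v" "\<not> avoids s E b v"
  shows "\<not> avoids s E a b \<or> \<not> avoids s E b a"
  using assms rtrancl_avoids_cases[of s v E a b] by (cases "a = b") auto


section \<open>Immediate dominators\<close>

definition idom_among :: "'a \<Rightarrow> 'a rel \<Rightarrow> 'a set \<Rightarrow> 'a \<Rightarrow> 'a \<Rightarrow> bool" where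
  "idom_among s E S p v \<longleftrightarrow> p \<noteq> v \<and> \<not> avoids s E p v \<and>
     (\<forall>w\<in>S. w \<noteq> v \<and> \<not> avoids s E w v \<longrightarrow> \<not> avoids s E w p)"

lemma idom_among_start: "v \<noteq> s \<Longrightarrow> idom_among s E {} s v"
  by (simp add: idom_among_def)

lemma idom_among_insert:
  assumes p: "idom_among s E S p v" and v: "(s, v) \<in> E\<^sup>*" and w: "w \<noteq> v" "\<not> avoids s E w v"
  shows "idom_among s E (insert w S) (if avoids s E p w then p else w) v"
proof (cases "avoids s E p w")
  case True
  then have "\<not> avoids s E w p"
    using not_avoids_linear[OF v w(2), of p] p by (auto simp: idom_among_def)
  with p True show ?thesis by (auto simp: idom_among_def)
next
  case False
  then have "\<not> avoids s E u w" if "u \<in> S" "u \<noteq> v" "\<not> avoids s E u v" for u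
    using that p avoids_trans[of s E u w p] by (auto simp: idom_among_def)
  with False w show ?thesis by (auto simp: idom_among_def)
qed

lemma idom_among_insert_irrelevant:
  "idom_among s E S p v \<Longrightarrow> w = v \<or> avoids s E w v \<Longrightarrow> idom_among s E (insert w S) p v"
  by (auto simp: idom_among_def)

lemma idom_among_delete_edges:
  "idom_among s E S p v \<Longrightarrow> E' \<subseteq> E \<Longrightarrow> idom_among s E' {w \<in> S. \<not> avoids s E w v} p v"
  unfolding idom_among_def using avoids_mono[of s E' _ _ E] by auto

lemma idom_among_UNIV_unique:
  assumes "idom_among s E UNIV p v" "idom_among s E UNIV d v" "(s, v) \<in> E\<^sup>*"
  shows "d = p"
proof (rule not_avoids_antisym)
  show "(s, p) \<in> E\<^sup>*"
    using assms(1) by (intro not_avoids_imp_rtrancl[OF assms(3)]) (simp add: idom_among_def)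
qed (use assms(1,2) in \<open>auto simp: idom_among_def\<close>)


section \<open>Forward edges\<close>

definition forward_edges :: "'a \<Rightarrow> 'a rel \<Rightarrow> 'a rel" where
  "forward_edges s E = {(u, v) \<in> E. avoids s E v u}"

lemma forward_edges_subset: "forward_edges s E \<subseteq> E"
  by (auto simp: forward_edges_def)

lemma forward_edges_no_start: "(u, s) \<notin> forward_edges s E"
  by (simp add: forward_edges_def)

lemma avoids_Int_forward_edges:
  assumes "E \<subseteq> E0"
  shows "avoids s (E \<inter> forward_edges s E0) w v \<longleftrightarrow> avoids s E w v"
proof
  assume "avoids s E w v"
  then show "avoids s (E \<inter> forward_edges s E0) w v"
  proof (induction rule: avoids.induct)
    case (avoids_step x y)
    show ?case
    proof (cases "avoids s E0 y x")
      case True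
      with avoids_step assms show ?thesis
        by (auto simp: forward_edges_def intro: avoids.avoids_step)
    next
      case False
      then have "\<not> avoids s (E \<inter> forward_edges s E0) y x"
        using assms avoids_mono[of s "E \<inter> forward_edges s E0" y x E0] by blast
      with avoids_trans[OF avoids_step.IH, of y] show ?thesis by simp
    qed
  qed (rule avoids_start)
qed (blast intro: avoids_mono)


section \<open>Flow graphs\<close>

lemma (in pair_wf_digraph) cycle_imp_strongly_connected_subgraph:
  assumes cycle: "(x, x) \<in> (parcs G)\<^sup>+"
  shows "\<exists>S. subgraph S (with_proj G) \<and> strongly_connected S \<and>
    (\<forall>v\<in>verts S. \<exists>u\<in>verts S. (u, v) \<in> parcs G)"
proof (intro exI conjI ballI)
  define S where "S = with_proj G \<restriction> scc_of x"
  have "x \<in> pverts G" using reachable1_in_verts[of x x] cycle by simp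
  then have "S \<in> sccs" using scc_of_in_sccs_verts in_verts_sccsD_sccs by (simp add: S_def)
  then show "subgraph S (with_proj G)" "strongly_connected S" by auto
  fix v assume "v \<in> verts S"
  then have v: "x \<rightarrow>\<^sup>*\<^bsub>with_proj G\<^esub> v" "v \<rightarrow>\<^sup>*\<^bsub>with_proj G\<^esub> x" by (auto simp: S_def scc_of_def)
  with cycle have "(v, v) \<in> (parcs G)\<^sup>+"
    by (metis reachable_rtranclI rtrancl_trancl_trancl trancl_rtrancl_trancl with_proj_simps(3))
  then obtain u where u: "(v, u) \<in> (parcs G)\<^sup>*" "(u, v) \<in> parcs G" by (meson tranclD2)
  then have "v \<rightarrow>\<^sup>*\<^bsub>with_proj G\<^esub> u" "u \<rightarrow>\<^sup>*\<^bsub>with_proj G\<^esub> v"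
    using in_arcsD1 in_arcsD2 by (auto simp: reachable_conv)
  with v have "u \<in> verts S" by (auto simp: S_def scc_of_def intro: reachable_trans)
  with u(2) show "\<exists>u\<in>verts S. (u, v) \<in> parcs G" by blast
qed

context flow_graph
begin

lemma reachable_start_iff: "s \<rightarrow>\<^sup>*\<^bsub>with_proj G\<^esub> v \<longleftrightarrow> (s, v) \<in> (parcs G)\<^sup>*"
proof
  assume "(s, v) \<in> (parcs G)\<^sup>*"
  then show "s \<rightarrow>\<^sup>*\<^bsub>with_proj G\<^esub> v"
  proof (induction rule: rtrancl_induct)
    case base
    show ?case using start_in_verts by simp
  next
    case (step y z)
    then show ?case using reachable_adj_trans[of s y z] by simp
  qed
qed (metis reachable_rtranclI with_proj_simps(3))

lemma awalk_imp_avoids: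
  "awalk s p v \<Longrightarrow> w \<notin> set (awalk_verts s p) \<Longrightarrow> avoids s (parcs G) w v"
proof (induction p arbitrary: v rule: rev_induct)
  case Nil
  then show ?case by (auto simp: awalk_Nil_iff intro: avoids_start)
next
  case (snoc e p)
  then obtain x where x: "awalk s p x" "e = (x, v)" "e \<in> parcs G"
    by (cases e) (auto simp: awalk_append_iff awalk_Cons_iff awalk_Nil_iff)
  then have "w \<notin> set (awalk_verts s p)" "v \<noteq> w"
    using snoc.prems by (auto simp: awalk_verts_append awalk_Cons_iff)
  with snoc.IH[OF x(1)] x show ?case by (auto intro: avoids_step)
qed

lemma avoids_imp_awalk:
  "avoids s (parcs G) w v \<Longrightarrow> \<exists>p. awalk s p v \<and> w \<notin> set (awalk_verts s p)"
proof (induction rule: avoids.induct)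
  case avoids_start
  then show ?case using start_in_verts by (intro exI[of _ "[]"]) (auto simp: awalk_Nil_iff)
next
  case (avoids_step x y)
  then obtain p where p: "awalk s p x" "w \<notin> set (awalk_verts s p)" by blast
  have last: "awalk x [(x, y)] y"
    using avoids_step.hyps by (simp add: awalk_Cons_iff awalk_Nil_iff in_arcsD2)
  have "awalk s (p @ [(x, y)]) y" using awalk_appendI[OF p(1) last] .
  moreover have "w \<notin> set (awalk_verts s (p @ [(x, y)]))"
    using p avoids_step.hyps awalk_verts_append[OF calculation] last by auto
  ultimately show ?case by blast
qed

lemma dominates_iff_not_avoids: "dominates G s w v \<longleftrightarrow> \<not> avoids s (parcs G) w v"
  using awalk_imp_avoids avoids_imp_awalk unfolding dominates_def awalk_verts_with_proj_eq by blast

lemma immediate_dominator_iff_idom_among: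
  "immediate_dominator G s d v \<longleftrightarrow> idom_among s (parcs G) UNIV d v"
proof -
  have "(w \<noteq> d \<longrightarrow> \<not> avoids s (parcs G) w d) \<longleftrightarrow> \<not> avoids s (parcs G) w d" for w
    by (cases "w = d") simp_all
  then have "(\<forall>w. \<not> avoids s (parcs G) w v \<and> w \<noteq> v \<and> w \<noteq> d \<longrightarrow> \<not> avoids s (parcs G) w d) \<longleftrightarrow>
    (\<forall>w. w \<noteq> v \<and> \<not> avoids s (parcs G) w v \<longrightarrow> \<not> avoids s (parcs G) w d)" by metis
  then show ?thesis
    by (simp add: immediate_dominator_def idom_among_def dominates_iff_not_avoids conj_left_commute)
qed

lemma idom_among_verts_imp_UNIV:
  assumes "idom_among s (parcs G) (pverts G) p v" "(s, v) \<in> (parcs G)\<^sup>*"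
  shows "idom_among s (parcs G) UNIV p v"
proof -
  have "w \<in> pverts G" if "\<not> avoids s (parcs G) w v" for w
    using that assms(2) avoids_fresh_iff[of w s "parcs G" v] start_in_verts in_arcsD2 by blast
  with assms(1) show ?thesis by (auto simp: idom_among_def)
qed

lemma dominator_tree_eqI:
  assumes "\<And>v. (s, v) \<in> (parcs G)\<^sup>* \<Longrightarrow> v \<noteq> s \<Longrightarrow> idom_among s (parcs G) (pverts G) (p v) v"
  shows "dominator_tree G s =
    \<lparr>pverts = {v. (s, v) \<in> (parcs G)\<^sup>*}, parcs = {(p v, v) |v. (s, v) \<in> (parcs G)\<^sup>* \<and> v \<noteq> s}\<rparr>"
proof -
  have "immediate_dominator G s d v \<longleftrightarrow> d = p v" if "(s, v) \<in> (parcs G)\<^sup>*" "v \<noteq> s" for d v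
    using idom_among_verts_imp_UNIV[OF assms[OF that] that(1)] that(1)
    by (auto simp: immediate_dominator_iff_idom_among intro: idom_among_UNIV_unique)
  then show ?thesis by (auto simp: dominator_tree_def reachable_start_iff)
qed

lemma acyclic_forward_edges:
  assumes "reducible G s"
  shows "acyclic (forward_edges s (parcs G))"
proof (rule acyclicI, intro allI notI)
  define F where "F = \<lparr>pverts = pverts G, parcs = forward_edges s (parcs G)\<rparr>"
  fix x assume "(x, x) \<in> (forward_edges s (parcs G))\<^sup>+"
  then have cycle: "(x, x) \<in> (parcs F)\<^sup>+" by (simp add: F_def)
  interpret F: pair_wf_digraph F
    using forward_edges_subset in_arcsD1 in_arcsD2 by unfold_locales (fastforce simp: F_def)+
  have F: "subgraph (with_proj F) (with_proj G)"
  proof (rule subgraphI)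
    show "wf_digraph (with_proj F)" "wf_digraph (with_proj G)" by unfold_locales
  qed (auto simp: F_def forward_edges_def compatible_def)
  obtain S where S: "subgraph S (with_proj F)" "strongly_connected S"
    "\<forall>v\<in>verts S. \<exists>u\<in>verts S. (u, v) \<in> parcs F"
    using F.cycle_imp_strongly_connected_subgraph[OF cycle] by blast
  have "subgraph S (with_proj G)" using S(1) F by (rule subgraph_trans)
  then obtain v where v: "v \<in> verts S" "\<forall>u\<in>verts S. dominates G s v u"
    using assms S(2) unfolding reducible_def dominates_def by blast
  with S(3) obtain u where "u \<in> verts S" "(u, v) \<in> forward_edges s (parcs G)"
    by (auto simp: F_def)
  with v(2) show False by (auto simp: dominates_iff_not_avoids forward_edges_def)
qed

end


section \<open>Matrices and queues in memory\<close>

lemma row_major_eq_iff: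
  fixes u v u' v' n :: nat
  assumes "v < n" "v' < n"
  shows "u * n + v = u' * n + v' \<longleftrightarrow> u = u' \<and> v = v'"
proof
  assume eq: "u * n + v = u' * n + v'"
  have "(u * n + v) div n = u" "(u' * n + v') div n = u'" using assms by auto
  with eq show "u = u' \<and> v = v'" by auto
qed simp

definition stores_matrix :: "nat \<Rightarrow> (nat \<Rightarrow> nat) \<Rightarrow> (nat \<times> nat \<Rightarrow> nat) \<Rightarrow> bool" where
  "stores_matrix n a f \<longleftrightarrow> (\<forall>u\<le>n. \<forall>v<n. a (u * n + v) = f (u, v))"

lemma stores_matrixD: "stores_matrix n a f \<Longrightarrow> u \<le> n \<Longrightarrow> v < n \<Longrightarrow> a (u * n + v) = f (u, v)"
  by (simp add: stores_matrix_def)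

lemma stores_matrix_upd:
  "stores_matrix n a f \<Longrightarrow> v < n \<Longrightarrow> stores_matrix n (a(u * n + v := k)) (f((u, v) := k))"
  by (auto simp: stores_matrix_def row_major_eq_iff)

lemma stores_matrix_cong:
  "(\<And>u v. u \<le> n \<Longrightarrow> v < n \<Longrightarrow> f (u, v) = g (u, v)) \<Longrightarrow> stores_matrix n a f \<longleftrightarrow> stores_matrix n a g"
  by (simp add: stores_matrix_def)

definition stores_set :: "nat \<Rightarrow> (nat \<Rightarrow> nat) \<Rightarrow> (nat \<times> nat) set \<Rightarrow> bool" where
  "stores_set n a S \<longleftrightarrow> stores_matrix n a (\<lambda>p. of_bool (p \<in> S))"

lemma stores_setD: "stores_set n a S \<Longrightarrow> u \<le> n \<Longrightarrow> v < n \<Longrightarrow> a (u * n + v) = of_bool ((u, v) \<in> S)"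
  by (simp add: stores_set_def stores_matrixD)

lemma stores_set_empty: "stores_set n (\<lambda>_. 0) {}"
  by (simp add: stores_set_def stores_matrix_def)

lemma stores_set_insert:
  assumes "stores_set n a S" "v < n"
  shows "stores_set n (a(u * n + v := 1)) (insert (u, v) S)"
proof -
  have "(\<lambda>p. of_bool (p \<in> S))((u, v) := 1) = (\<lambda>p. of_bool (p \<in> insert (u, v) S) :: nat)" by auto
  then show ?thesis
    using stores_matrix_upd[of n a "\<lambda>p. of_bool (p \<in> S)" v u 1] assms by (simp add: stores_set_def)
qed

lemma stores_set_remove:
  assumes "stores_set n a S" "v < n"
  shows "stores_set n (a(u * n + v := 0)) (S - {(u, v)})"
proof -
  have "(\<lambda>p. of_bool (p \<in> S))((u, v) := 0) = (\<lambda>p. of_bool (p \<in> S - {(u, v)}) :: nat)" by auto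
  then show ?thesis
    using stores_matrix_upd[of n a "\<lambda>p. of_bool (p \<in> S)" v u 0] assms by (simp add: stores_set_def)
qed

abbreviation index :: "expr \<Rightarrow> expr \<Rightarrow> expr" where
  "index a b \<equiv> Bin Plus (Bin Times a (Var ''n'')) b"

abbreviation queue_vars :: "vname set" where
  "queue_vars \<equiv> {''queue_copy'', ''queue_vertex'', ''queue_end''}"

definition queue :: "state \<Rightarrow> (nat \<times> nat) list" where
  "queue \<sigma> = map (\<lambda>i. (\<sigma> ''queue_copy'' i, \<sigma> ''queue_vertex'' i)) [0..<\<sigma> ''queue_end'' 0]"

definition push :: com where
  "push =
     Seq (Assign ''queue_copy'' (Var ''queue_end'') (Var ''w''))
    (Seq (Assign ''queue_vertex'' (Var ''queue_end'') (Var ''y''))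
         (Inc ''queue_end''))"

definition pushed :: "state \<Rightarrow> state" where
  "pushed \<sigma> =
     store (store (store \<sigma> ''queue_copy'' (\<sigma> ''queue_end'' 0) (\<sigma> ''w'' 0))
       ''queue_vertex'' (\<sigma> ''queue_end'' 0) (\<sigma> ''y'' 0)) ''queue_end'' 0 (\<sigma> ''queue_end'' 0 + 1)"

definition dequeue :: com where
  "dequeue =
     Seq (Put ''w'' (Cell ''queue_copy'' (Var ''queue_next'')))
    (Seq (Put ''x'' (Cell ''queue_vertex'' (Var ''queue_next'')))
         (Inc ''queue_next''))"

lemma length_queue [simp]: "length (queue \<sigma>) = \<sigma> ''queue_end'' 0"
  by (simp add: queue_def)

lemma nth_queue: "i < \<sigma> ''queue_end'' 0 \<Longrightarrow> queue \<sigma> ! i = (\<sigma> ''queue_copy'' i, \<sigma> ''queue_vertex'' i)"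
  by (simp add: queue_def)

lemma queue_frame:
  "frame W X \<sigma> \<tau> \<Longrightarrow> X \<inter> queue_vars = {} \<Longrightarrow> queue \<tau> = queue \<sigma>"
  by (auto simp: frame_def queue_def)

lemma queue_store [simp]:
  "x \<notin> queue_vars \<Longrightarrow> queue (store \<sigma> x i k) = queue \<sigma>"
  by (auto simp: queue_def store_apply)

lemma writes_push [simp]: "writes push = queue_vars"
  by (auto simp: push_def)

lemma pushed_apply [simp]: "x \<notin> queue_vars \<Longrightarrow> pushed \<sigma> x = \<sigma> x"
  by (simp add: pushed_def store_apply)

lemma queue_pushed [simp]: "queue (pushed \<sigma>) = queue \<sigma> @ [(\<sigma> ''w'' 0, \<sigma> ''y'' 0)]"
  by (simp add: queue_def pushed_def store_apply)

lemma wp_push: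
  assumes "\<And>x. \<sigma> x 0 < W" "\<sigma> ''queue_end'' 0 + 1 < W"
  shows "wp W push Q \<sigma> \<longleftrightarrow> Q 16 (pushed \<sigma>)"
  using assms by (simp add: push_def pushed_def store_apply eval_nat_numeral)

lemma wp_dequeue:
  assumes "bounded_state W \<sigma>" "\<sigma> ''queue_next'' 0 < \<sigma> ''queue_end'' 0"
  shows "wp W dequeue (\<lambda>t \<tau>. t \<le> 20 \<and> \<tau> ''queue_next'' 0 = Suc (\<sigma> ''queue_next'' 0) \<and>
    queue \<sigma> ! \<sigma> ''queue_next'' 0 = (\<tau> ''w'' 0, \<tau> ''x'' 0)) \<sigma>"
proof -
  have "Suc (\<sigma> ''queue_next'' 0) < W"
    using assms(2) bounded_stateD[OF assms(1), of "''queue_end''" 0] by simp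
  then show ?thesis
    using assms by (simp add: dequeue_def store_apply nth_queue bounded_stateD)
qed

lemma writes_dequeue [simp]: "writes dequeue = {''w'', ''x'', ''queue_next''}"
  by (auto simp: dequeue_def)


section \<open>Encoded graphs\<close>

abbreviation layout_vars :: "vname set" where
  "layout_vars \<equiv> {''n'', ''m'', ''s'', ''tail'', ''head'', ''deg'', ''adj''}"

locale encoded_graph =
  fixes n s W :: nat and as :: "(nat \<times> nat) list"
  assumes start_less: "s < n" and edges_less: "set as \<subseteq> {..<n} \<times> {..<n}"
    and distinct_edges: "distinct as"
    and word_size: "(n + 2) * (n + length as + 2) < W"
begin

abbreviation m :: nat where
  "m \<equiv> length as"

lemma length_fits [simp]: "m < W" and Suc_n_fits [simp]: "Suc n < W"
  using word_size by (simp_all add: algebra_simps)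

lemma fits [simp]:
  "0 < W" "1 < W" "Suc 0 < W" "n < W"
  "u \<le> n \<Longrightarrow> u < W" "u \<le> n \<Longrightarrow> u * n < W" "u \<le> n \<Longrightarrow> u * m < W"
  "u \<le> n \<Longrightarrow> v \<le> n \<Longrightarrow> u * n + v < W"
  "u \<le> n \<Longrightarrow> j \<le> m \<Longrightarrow> u * m + j < W"
proof -
  have W: "n * n + n * m + 4 * n + 2 * m + 4 < W" using word_size by (simp add: algebra_simps)
  then show "0 < W" "1 < W" "Suc 0 < W" "n < W" by simp_all
  show "u < W" if "u \<le> n" using W that by linarith
  have mono: "u * n \<le> n * n" "u * m \<le> n * m" if "u \<le> n" using that by simp_all
  show "u * n < W" "u * m < W" if "u \<le> n" using W mono[OF that] by linarith+
  show "u * n + v < W" if "u \<le> n" "v \<le> n" using W mono(1)[OF that(1)] that(2) by linarith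
  show "u * m + j < W" if "u \<le> n" "j \<le> m" using W mono(2)[OF that(1)] that(2) by linarith
qed

definition adj_list :: "nat \<Rightarrow> nat list" where
  "adj_list u = map snd (filter (\<lambda>e. fst e = u) as)"

lemma set_adj_list: "set (adj_list u) = {v. (u, v) \<in> set as}"
  by (force simp: adj_list_def)

lemma distinct_adj_list: "distinct (adj_list u)"
  using distinct_edges by (auto simp: adj_list_def distinct_map inj_on_def)

lemma length_adj_list_le: "length (adj_list u) \<le> m"
  by (simp add: adj_list_def)

definition inputs :: "state \<Rightarrow> bool" where
  "inputs \<sigma> \<longleftrightarrow> \<sigma> ''n'' 0 = n \<and> \<sigma> ''m'' 0 = m \<and> \<sigma> ''s'' 0 = s \<and>
     (\<forall>i<m. \<sigma> ''tail'' i = fst (as ! i) \<and> \<sigma> ''head'' i = snd (as ! i))"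

definition layout :: "state \<Rightarrow> bool" where
  "layout \<sigma> \<longleftrightarrow> inputs \<sigma> \<and>
     (\<forall>u<n. \<sigma> ''deg'' u = length (adj_list u) \<and>
       (\<forall>j<length (adj_list u). \<sigma> ''adj'' (u * m + j) = adj_list u ! j))"

lemma inputsD: "inputs \<sigma> \<Longrightarrow> \<sigma> ''n'' 0 = n" "inputs \<sigma> \<Longrightarrow> \<sigma> ''m'' 0 = m" "inputs \<sigma> \<Longrightarrow> \<sigma> ''s'' 0 = s"
  by (simp_all add: inputs_def)

lemma layoutD: "layout \<sigma> \<Longrightarrow> inputs \<sigma>"
  by (simp add: layout_def)

lemma inputs_frame:
  "inputs \<sigma> \<Longrightarrow> frame W X \<sigma> \<tau> \<Longrightarrow> X \<inter> {''n'', ''m'', ''s'', ''tail'', ''head''} = {} \<Longrightarrow> inputs \<tau>"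
  by (auto simp: frame_def inputs_def)

lemma layout_frame: "layout \<sigma> \<Longrightarrow> frame W X \<sigma> \<tau> \<Longrightarrow> X \<inter> layout_vars = {} \<Longrightarrow> layout \<tau>"
  by (auto simp: frame_def layout_def inputs_def)

abbreviation cells :: "(nat \<times> nat) set" where
  "cells \<equiv> {..n} \<times> {..<n}"

lemma queue_end_fits:
  assumes "distinct (queue \<sigma>)" "set (queue \<sigma>) \<subseteq> cells"
  shows "\<sigma> ''queue_end'' 0 + 1 < W"
proof -
  have "\<sigma> ''queue_end'' 0 = card (set (queue \<sigma>))" using distinct_card[OF assms(1)] by simp
  also have "\<dots> \<le> card cells" using assms(2) by (intro card_mono) auto
  finally have "\<sigma> ''queue_end'' 0 \<le> card cells" .
  moreover have "card cells + 1 < W"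
    using word_size by (simp add: card_cartesian_product algebra_simps)
  ultimately show ?thesis by linarith
qed

definition work :: "(nat \<times> nat) set \<Rightarrow> nat" where
  "work A = (\<Sum>p\<in>A. 1 + length (adj_list (snd p)))"

lemma work_split: "finite A \<Longrightarrow> B \<subseteq> A \<Longrightarrow> work A = work (A - B) + work B"
  unfolding work_def by (rule sum.subset_diff)

lemma work_Diff_insert:
  assumes "finite A" "(w, x) \<in> A" "(w, x) \<notin> B"
  shows "work (A - B) = work (A - insert (w, x) B) + 1 + length (adj_list x)"
proof -
  have "A - B - {(w, x)} = A - insert (w, x) B" by auto
  then show ?thesis
    using assms sum.remove[of "A - B" "(w, x)" "\<lambda>p. 1 + length (adj_list (snd p))"]
    by (simp add: work_def)
qed

lemma card_le_work: "card A \<le> work A"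
  using sum_mono[of A "\<lambda>_. 1" "\<lambda>p. 1 + length (adj_list (snd p))"] by (simp add: work_def)

end


definition for_each_copy :: "com \<Rightarrow> com" where
  "for_each_copy c = For ''w'' (Bin Plus (Var ''n'') (Const 1)) c"

definition for_each_edge :: "com \<Rightarrow> com" where
  "for_each_edge c = For ''i'' (Var ''m'') c"

lemma writes_for_each [simp]:
  "writes (for_each_copy c) = insert ''w'' (writes c)"
  "writes (for_each_edge c) = insert ''i'' (writes c)"
  by (simp_all add: for_each_copy_def for_each_edge_def)

context encoded_graph
begin

lemma wp_for_each_copy:
  assumes "bounded_state W \<sigma>0" "inputs \<sigma>0" "writes c \<inter> {''w'', ''n''} = {}" "I 0 \<sigma>0"
    and "\<And>k \<sigma> \<tau>. I k \<sigma> \<Longrightarrow> frame W {''w''} \<sigma> \<tau> \<Longrightarrow> I k \<tau>"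
    and "\<And>k \<sigma>. k \<le> n \<Longrightarrow> I k \<sigma> \<Longrightarrow> \<sigma> ''w'' 0 = k \<Longrightarrow> frame W (insert ''w'' (writes c)) \<sigma>0 \<sigma> \<Longrightarrow>
      wp W c (\<lambda>t \<tau>. t \<le> B \<and> I (Suc k) \<tau>) \<sigma>"
  shows "wp W (for_each_copy c) (\<lambda>t \<tau>. t \<le> 2 * (B + 14) * (n + 1) \<and> I (Suc n) \<tau>) \<sigma>0"
proof -
  have "wp W (for_each_copy c)
    (\<lambda>t \<tau>. t \<le> (B + expr_cost (Bin Plus (Var ''n'') (Const 1)) + 10) * (Suc n + 1) \<and> I (Suc n) \<tau>) \<sigma>0"
    unfolding for_each_copy_def
    by (rule wp_For_uniform[where I = I]) (use assms in \<open>auto simp: inputs_def\<close>)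
  then show ?thesis
    by (rule wp_mono_frame[OF _ assms(1)]) (auto simp: algebra_simps)
qed

lemma wp_for_each_edge:
  assumes "bounded_state W \<sigma>0" "inputs \<sigma>0" "writes c \<inter> {''i'', ''m''} = {}" "I 0 \<sigma>0"
    and "\<And>k \<sigma> \<tau>. I k \<sigma> \<Longrightarrow> frame W {''i''} \<sigma> \<tau> \<Longrightarrow> I k \<tau>"
    and "\<And>k \<sigma>. k < m \<Longrightarrow> I k \<sigma> \<Longrightarrow> \<sigma> ''i'' 0 = k \<Longrightarrow> frame W (insert ''i'' (writes c)) \<sigma>0 \<sigma> \<Longrightarrow>
      wp W c (\<lambda>t \<tau>. t \<le> B \<and> I (Suc k) \<tau>) \<sigma>"
  shows "wp W (for_each_edge c) (\<lambda>t \<tau>. t \<le> (B + 12) * (m + 1) \<and> I m \<tau>) \<sigma>0"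
proof -
  have "wp W (for_each_edge c) (\<lambda>t \<tau>. t \<le> (B + expr_cost (Var ''m'') + 10) * (m + 1) \<and> I m \<tau>) \<sigma>0"
    unfolding for_each_edge_def
    by (rule wp_For_uniform[where I = I]) (use assms in \<open>auto simp: inputs_def\<close>)
  then show ?thesis by (simp add: algebra_simps)
qed

end


section \<open>A work list over pairs of vertices\<close>

text \<open>
  An entry \<open>(w, x)\<close> of the queue says that the status of \<open>x\<close> in the copy \<open>G - w\<close> has changed. A token
  \<open>(w, x, y)\<close> stands for the edge \<open>(x, y)\<close> in that copy.
\<close>

definition tokens :: "'a rel \<Rightarrow> ('b \<times> 'a) set \<Rightarrow> ('b \<times> 'a \<times> 'a) set" where
  "tokens F A = {(w, x, y). (w, x) \<in> A \<and> (x, y) \<in> F}"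

lemma tokens_empty [simp]: "tokens F {} = {}"
  by (simp add: tokens_def)

definition fetch_neighbour :: com where
  "fetch_neighbour = Put ''y'' (Cell ''adj'' (Bin Plus (Bin Times (Var ''x'') (Var ''m'')) (Var ''j'')))"

definition scan :: "com \<Rightarrow> com" where
  "scan body = For ''j'' (Cell ''deg'' (Var ''x'')) (Seq fetch_neighbour body)"

definition worklist :: "com \<Rightarrow> com" where
  "worklist body =
     Seq (Put ''queue_next'' (Const 0))
       (While (Less (Var ''queue_next'') (Var ''queue_end'')) (Seq dequeue (scan body)))"

abbreviation worklist_vars :: "vname set" where
  "worklist_vars \<equiv> {''queue_next'', ''w'', ''x'', ''j'', ''y''}"

lemma writes_worklist [simp]:
  "writes fetch_neighbour = {''y''}"
  "writes (scan body) = {''j'', ''y''} \<union> writes body"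
  "writes (worklist body) = worklist_vars \<union> writes body"
  by (auto simp: fetch_neighbour_def scan_def worklist_def)

context encoded_graph
begin

lemma wp_fetch_neighbour_Seq:
  assumes \<sigma>: "bounded_state W \<sigma>" "layout \<sigma>" "\<sigma> ''x'' 0 = x" "x < n" "\<sigma> ''j'' 0 = k"
    "k < length (adj_list x)"
    and body:
      "\<And>\<tau>. \<tau> ''y'' 0 = adj_list x ! k \<Longrightarrow> frame W {''y''} \<sigma> \<tau> \<Longrightarrow> wp W body (\<lambda>t \<tau>. t \<le> B \<and> R \<tau>) \<tau>"
  shows "wp W (Seq fetch_neighbour body) (\<lambda>t \<tau>. t \<le> B + 11 \<and> R \<tau>) \<sigma>"
proof -
  define \<tau> where "\<tau> = store \<sigma> ''y'' 0 (adj_list x ! k)"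
  have k: "k \<le> m" using \<sigma>(6) length_adj_list_le[of x] by linarith
  have cell: "\<sigma> ''adj'' (x * m + k) = adj_list x ! k" using \<sigma> by (simp add: layout_def)
  then have "adj_list x ! k < W" using bounded_stateD[OF \<sigma>(1)] by metis
  then have frame: "frame W {''y''} \<sigma> \<tau>" using \<sigma>(1) by (simp add: \<tau>_def frame_store)
  have "wp W body (\<lambda>t \<tau>. t \<le> B \<and> R \<tau>) \<tau>"
    using frame by (intro body) (simp_all add: \<tau>_def store_apply)
  then have "wp W body (\<lambda>t \<tau>. 11 + t \<le> B + 11 \<and> R \<tau>) \<tau>" by (rule wp_mono) simp
  moreover have "x < W" "k < W" using \<sigma>(1,3,5) bounded_stateD by metis+
  ultimately show ?thesis
    using \<sigma> k cell \<open>adj_list x ! k < W\<close>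
    by (simp add: fetch_neighbour_def inputsD[OF layoutD] \<tau>_def[symmetric])
qed

lemma wp_scan:
  fixes I :: "nat set \<Rightarrow> state \<Rightarrow> bool"
  assumes \<sigma>0: "bounded_state W \<sigma>0" "layout \<sigma>0" "\<sigma>0 ''x'' 0 = x" "x < n"
    and writes: "writes body \<inter> ({''j'', ''x''} \<union> layout_vars) = {}"
    and init: "I {} \<sigma>0"
    and indep: "\<And>Y \<sigma> \<tau>. I Y \<sigma> \<Longrightarrow> frame W {''j'', ''y''} \<sigma> \<tau> \<Longrightarrow> I Y \<tau>"
    and body: "\<And>Y \<sigma> y. I Y \<sigma> \<Longrightarrow> (x, y) \<in> set as \<Longrightarrow> y \<notin> Y \<Longrightarrow> \<sigma> ''y'' 0 = y \<Longrightarrow>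
      frame W ({''j'', ''y''} \<union> writes body) \<sigma>0 \<sigma> \<Longrightarrow> wp W body (\<lambda>t \<tau>. t \<le> B \<and> I (insert y Y) \<tau>) \<sigma>"
  shows "wp W (scan body) (\<lambda>t \<tau>. t \<le> (B + 24) * (1 + length (adj_list x)) \<and> I (set (adj_list x)) \<tau>) \<sigma>0"
proof -
  define Y where "Y k = set (take k (adj_list x))" for k
  have "wp W (scan body)
    (\<lambda>t \<tau>. t \<le> (B + 11 + expr_cost (Cell ''deg'' (Var ''x'')) + 10) * (length (adj_list x) + 1) \<and>
      I (Y (length (adj_list x))) \<tau>) \<sigma>0"
    unfolding scan_def
  proof (rule wp_For_uniform[where I = "\<lambda>k. I (Y k)"])
    show "expr_fits W (Cell ''deg'' (Var ''x'')) \<sigma>0" using \<sigma>0 by (simp add: bounded_stateD)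
    show "expr_val (Cell ''deg'' (Var ''x'')) \<sigma>0 = length (adj_list x)"
      using \<sigma>0 by (simp add: layout_def)
    show "I (Y 0) \<sigma>0" using init by (simp add: Y_def)
    show "I (Y k) \<tau>" if "I (Y k) \<sigma>" "frame W {''j''} \<sigma> \<tau>" for k \<sigma> \<tau>
      using that(1) frame_mono[OF that(2)] by (auto intro: indep)
  next
    fix k \<sigma>
    assume k: "k < length (adj_list x)" and I: "I (Y k) \<sigma>" and j: "\<sigma> ''j'' 0 = k"
      and "frame W (insert ''j'' (writes (Seq fetch_neighbour body))) \<sigma>0 \<sigma>"
    then have frame: "frame W ({''j'', ''y''} \<union> writes body) \<sigma>0 \<sigma>" by (simp add: insert_commute)
    have y: "(x, adj_list x ! k) \<in> set as" "adj_list x ! k \<notin> Y k"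
      using k nth_mem[of k "adj_list x"] distinct_adj_list[of x]
      by (auto simp: Y_def set_adj_list in_set_conv_nth nth_eq_iff_index_eq)
    have insert: "insert (adj_list x ! k) (Y k) = Y (Suc k)"
      using k by (simp add: Y_def take_Suc_conv_app_nth)
    have "layout \<sigma>" using \<sigma>0(2) frame by (rule layout_frame) (use writes in auto)
    moreover have "\<sigma> ''x'' 0 = x" using frameD[OF frame, of "''x''"] writes \<sigma>0(3) by auto
    ultimately show "wp W (Seq fetch_neighbour body) (\<lambda>t \<tau>. t \<le> B + 11 \<and> I (Y (Suc k)) \<tau>) \<sigma>"
    proof (intro wp_fetch_neighbour_Seq[OF frame_bounded[OF frame] _ _ \<sigma>0(4) j k])
      fix \<tau> assume \<tau>: "\<tau> ''y'' 0 = adj_list x ! k" "frame W {''y''} \<sigma> \<tau>"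
      have "I (Y k) \<tau>" using I frame_mono[OF \<tau>(2)] by (auto intro: indep)
      moreover have "frame W ({''j'', ''y''} \<union> writes body) \<sigma>0 \<tau>"
        using frame \<tau>(2) by (rule frame_trans) auto
      ultimately show "wp W body (\<lambda>t \<tau>. t \<le> B \<and> I (Y (Suc k)) \<tau>) \<tau>"
        unfolding insert[symmetric] using y \<tau>(1) by (intro body)
    qed
  qed (use \<sigma>0 writes in auto)
  then show ?thesis by (simp add: Y_def algebra_simps)
qed

end

locale worklist_invariant = encoded_graph +
  fixes body :: com and B :: nat and I :: "(nat \<times> nat \<times> nat) set \<Rightarrow> state \<Rightarrow> bool" and \<sigma>0 :: state
  assumes writes_body: "writes body \<inter> (worklist_vars \<union> layout_vars) = {}"
    and initial: "bounded_state W \<sigma>0" "layout \<sigma>0" "I {} \<sigma>0"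
    and queue_cells: "I D \<sigma> \<Longrightarrow> distinct (queue \<sigma>) \<and> set (queue \<sigma>) \<subseteq> cells"
    and frame_I: "I D \<sigma> \<Longrightarrow> frame W worklist_vars \<sigma> \<tau> \<Longrightarrow> I D \<tau>"
    and wp_body: "I D \<sigma> \<Longrightarrow> frame W (writes (worklist body)) \<sigma>0 \<sigma> \<Longrightarrow> layout \<sigma> \<Longrightarrow>
      (w, x) \<in> set (queue \<sigma>) \<Longrightarrow> (x, y) \<in> set as \<Longrightarrow> (w, x, y) \<notin> D \<Longrightarrow>
      \<sigma> ''w'' 0 = w \<Longrightarrow> \<sigma> ''x'' 0 = x \<Longrightarrow> \<sigma> ''y'' 0 = y \<Longrightarrow>
      wp W body (\<lambda>t \<tau>. t \<le> B \<and> prefix (queue \<sigma>) (queue \<tau>) \<and> I (insert (w, x, y) D) \<tau>) \<sigma>"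
begin

definition finished :: "state \<Rightarrow> (nat \<times> nat) set" where
  "finished \<sigma> = set (take (\<sigma> ''queue_next'' 0) (queue \<sigma>))"

definition loop_invariant :: "state \<Rightarrow> bool" where
  "loop_invariant \<sigma> \<longleftrightarrow> \<sigma> ''queue_next'' 0 \<le> \<sigma> ''queue_end'' 0 \<and> I (tokens (set as) (finished \<sigma>)) \<sigma>"

lemma layout_of_frame: "frame W (writes (worklist body)) \<sigma>0 \<sigma> \<Longrightarrow> layout \<sigma>"
  using initial(2) writes_body by (auto elim!: layout_frame)

lemma finished_Suc:
  assumes "prefix (queue \<sigma>) (queue \<tau>)" "\<tau> ''queue_next'' 0 = Suc (\<sigma> ''queue_next'' 0)"
    and "\<sigma> ''queue_next'' 0 < \<sigma> ''queue_end'' 0"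
  shows "finished \<tau> = insert (queue \<sigma> ! \<sigma> ''queue_next'' 0) (finished \<sigma>)"
    and "\<tau> ''queue_next'' 0 \<le> \<tau> ''queue_end'' 0"
proof -
  obtain r where r: "queue \<tau> = queue \<sigma> @ r" using assms(1) by (auto simp: prefix_def)
  then show "finished \<tau> = insert (queue \<sigma> ! \<sigma> ''queue_next'' 0) (finished \<sigma>)"
    using assms(2,3) by (simp add: finished_def take_Suc_conv_app_nth)
  show "\<tau> ''queue_next'' 0 \<le> \<tau> ''queue_end'' 0" using arg_cong[OF r, of length] assms(2,3) by simp
qed

lemma wp_scan_entry:
  assumes inv: "I (tokens (set as) A) \<sigma>" and frame: "frame W (writes (worklist body)) \<sigma>0 \<sigma>"
    and entry: "(w, x) \<in> set (queue \<sigma>)" "(w, x) \<notin> A" "\<sigma> ''w'' 0 = w" "\<sigma> ''x'' 0 = x"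
  shows "wp W (scan body) (\<lambda>t \<tau>. t \<le> (B + 24) * (1 + length (adj_list x)) \<and>
    prefix (queue \<sigma>) (queue \<tau>) \<and> I (tokens (set as) (insert (w, x) A)) \<tau>) \<sigma>"
proof -
  define D where "D Y = tokens (set as) A \<union> {w} \<times> {x} \<times> Y" for Y
  define J where "J Y \<tau> \<longleftrightarrow> prefix (queue \<sigma>) (queue \<tau>) \<and> I (D Y) \<tau>" for Y \<tau>
  have "wp W (scan body) (\<lambda>t \<tau>. t \<le> (B + 24) * (1 + length (adj_list x)) \<and> J (set (adj_list x)) \<tau>) \<sigma>"
  proof (rule wp_scan)
    show "bounded_state W \<sigma>" using frame by (rule frame_bounded)
    show "layout \<sigma>" using frame by (rule layout_of_frame)
    show "x < n" using queue_cells[OF inv] entry(1) by auto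
    show "J {} \<sigma>" using inv by (simp add: J_def D_def)
    show "J Y \<tau>'" if "J Y \<tau>" "frame W {''j'', ''y''} \<tau> \<tau>'" for Y \<tau> \<tau>'
      using that(1) queue_frame[OF that(2)] frame_I[OF _ frame_mono[OF that(2)]]
      by (auto simp: J_def)
    fix Y \<tau> y
    assume J: "J Y \<tau>" and y: "(x, y) \<in> set as" "y \<notin> Y" "\<tau> ''y'' 0 = y"
      and frame': "frame W ({''j'', ''y''} \<union> writes body) \<sigma> \<tau>"
    have frame_\<tau>: "frame W (writes (worklist body)) \<sigma>0 \<tau>"
      using frame frame' by (rule frame_trans) auto
    have \<tau>: "\<tau> ''w'' 0 = w" "\<tau> ''x'' 0 = x" using entry(3,4) frameD[OF frame'] writes_body by auto
    have "(w, x) \<in> set (queue \<tau>)" using J entry(1) by (auto simp: J_def dest: set_mono_prefix)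
    moreover have "(w, x, y) \<notin> D Y" using entry(2) y(2) by (auto simp: D_def tokens_def)
    ultimately have
      "wp W body (\<lambda>t \<tau>'. t \<le> B \<and> prefix (queue \<tau>) (queue \<tau>') \<and> I (insert (w, x, y) (D Y)) \<tau>') \<tau>"
      using J y \<tau> frame_\<tau> layout_of_frame[OF frame_\<tau>] by (intro wp_body) (auto simp: J_def)
    moreover have "insert (w, x, y) (D Y) = D (insert y Y)" by (auto simp: D_def)
    ultimately show "wp W body (\<lambda>t \<tau>. t \<le> B \<and> J (insert y Y) \<tau>) \<tau>"
      using J by (elim wp_mono) (auto simp: J_def intro: prefix_order.trans)
  qed (use entry writes_body in auto)
  moreover have "D (set (adj_list x)) = tokens (set as) (insert (w, x) A)"
    by (auto simp: D_def tokens_def set_adj_list)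
  ultimately show ?thesis by (simp add: J_def)
qed

lemma next_entry:
  assumes inv: "loop_invariant \<sigma>" and "\<sigma> ''queue_next'' 0 < \<sigma> ''queue_end'' 0"
    and entry: "queue \<sigma> ! \<sigma> ''queue_next'' 0 = (w, x)"
  shows "(w, x) \<in> set (queue \<sigma>)" and "(w, x) \<in> cells" and "(w, x) \<notin> finished \<sigma>"
proof -
  define k where "k = \<sigma> ''queue_next'' 0"
  have k: "k < length (queue \<sigma>)" "queue \<sigma> ! k = (w, x)"
    using assms(2) entry by (simp_all add: k_def)
  have queue: "distinct (queue \<sigma>)" "set (queue \<sigma>) \<subseteq> cells"
    using inv queue_cells by (auto simp: loop_invariant_def)
  show "(w, x) \<in> set (queue \<sigma>)" using k nth_mem by metis
  with queue(2) show "(w, x) \<in> cells" by blast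
  show "(w, x) \<notin> finished \<sigma>"
    using queue(1) nth_eq_iff_index_eq[of "queue \<sigma>" _ k] k
    by (fastforce simp: finished_def k_def in_set_conv_nth)
qed

lemma wp_iteration:
  assumes inv: "loop_invariant \<sigma>" and frame: "frame W (writes (worklist body)) \<sigma>0 \<sigma>"
    and nonempty: "\<sigma> ''queue_next'' 0 < \<sigma> ''queue_end'' 0"
  shows "wp W (Seq dequeue (scan body)) (\<lambda>t \<tau>. loop_invariant \<tau> \<and>
    t + 10 + (B + 60) * work (cells - finished \<tau>) \<le> (B + 60) * work (cells - finished \<sigma>)) \<sigma>"
    (is "wp W _ ?Q \<sigma>")
proof -
  obtain w x where entry: "queue \<sigma> ! \<sigma> ''queue_next'' 0 = (w, x)" by fastforce
  note wx = next_entry[OF inv nonempty entry]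
  have "wp W dequeue (\<lambda>t. wp W (scan body) (\<lambda>u. ?Q (t + u))) \<sigma>"
    using wp_dequeue[OF frame_bounded[OF frame] nonempty] frame_bounded[OF frame]
  proof (rule wp_mono_frame)
    fix t :: nat and \<sigma>' assume t: "t \<le> 20 \<and> \<sigma>' ''queue_next'' 0 = Suc (\<sigma> ''queue_next'' 0) \<and>
        queue \<sigma> ! \<sigma> ''queue_next'' 0 = (\<sigma>' ''w'' 0, \<sigma>' ''x'' 0)"
      and "frame W (writes dequeue) \<sigma> \<sigma>'"
    then have frame': "frame W {''w'', ''x'', ''queue_next''} \<sigma> \<sigma>'" by simp
    have \<sigma>': "frame W (writes (worklist body)) \<sigma>0 \<sigma>'" using frame frame' by (rule frame_trans) auto
    have queue': "queue \<sigma>' = queue \<sigma>" using frame' by (rule queue_frame) simp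
    have wx': "\<sigma>' ''w'' 0 = w" "\<sigma>' ''x'' 0 = x" using t entry by auto
    have "I (tokens (set as) (finished \<sigma>)) \<sigma>'"
      using inv frame_mono[OF frame'] by (auto simp: loop_invariant_def intro: frame_I)
    from wp_scan_entry[OF this \<sigma>' _ wx(3) wx'] wx(1) queue'
    have "wp W (scan body) (\<lambda>u \<tau>. u \<le> (B + 24) * (1 + length (adj_list x)) \<and>
      prefix (queue \<sigma>) (queue \<tau>) \<and> I (tokens (set as) (insert (w, x) (finished \<sigma>))) \<tau>) \<sigma>'" by simp
    then show "wp W (scan body) (\<lambda>u. ?Q (t + u)) \<sigma>'"
    proof (rule wp_mono_frame[OF _ frame_bounded[OF frame']])
      fix u \<tau> assume u: "u \<le> (B + 24) * (1 + length (adj_list x)) \<and> prefix (queue \<sigma>) (queue \<tau>) \<and>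
          I (tokens (set as) (insert (w, x) (finished \<sigma>))) \<tau>"
        and "frame W (writes (scan body)) \<sigma>' \<tau>"
      then have "\<tau> ''queue_next'' 0 = Suc (\<sigma> ''queue_next'' 0)"
        using t writes_body frameD[of W _ \<sigma>' \<tau>] by auto
      with u nonempty entry have "finished \<tau> = insert (w, x) (finished \<sigma>)"
        "\<tau> ''queue_next'' 0 \<le> \<tau> ''queue_end'' 0"
        using finished_Suc[of \<sigma> \<tau>] by simp_all
      with t u show "?Q (t + u) \<tau>"
        using work_Diff_insert[OF _ wx(2,3)] by (simp add: loop_invariant_def algebra_simps)
    qed
  qed
  then show ?thesis by simp
qed

theorem wp_worklist:
  "wp W (worklist body) (\<lambda>t \<tau>. t \<le> (B + 60) * work (set (queue \<tau>)) + 10 \<and>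
     I (tokens (set as) (set (queue \<tau>))) \<tau>) \<sigma>0"
proof -
  define b where "b = Less (Var ''queue_next'') (Var ''queue_end'')"
  define \<sigma>1 where "\<sigma>1 = store \<sigma>0 ''queue_next'' 0 0"
  have frame1: "frame W {''queue_next''} \<sigma>0 \<sigma>1" using initial(1) by (simp add: \<sigma>1_def frame_store)
  have frame: "frame W (writes (worklist body)) \<sigma>0 \<sigma>"
    if "frame W (writes (Seq dequeue (scan body))) \<sigma>1 \<sigma>" for \<sigma>
    using frame1 that by (rule frame_trans) auto
  have "wp W (While b (Seq dequeue (scan body)))
    (\<lambda>t \<tau>. t + (B + 60) * work (cells - finished \<tau>) \<le>
        1 + cond_cost b + (B + 60) * work (cells - finished \<sigma>1) \<and>
      loop_invariant \<tau> \<and> \<not> cond_val b \<tau>) \<sigma>1"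
  proof (rule wp_While)
    show "bounded_state W \<sigma>1" using frame1 by (rule frame_bounded)
    have "I {} \<sigma>1" using initial(3) frame_mono[OF frame1] by (auto intro: frame_I)
    then show "loop_invariant \<sigma>1" by (simp add: loop_invariant_def finished_def \<sigma>1_def store_apply)
    fix \<sigma> assume inv: "loop_invariant \<sigma>" and "frame W (writes (Seq dequeue (scan body))) \<sigma>1 \<sigma>"
    then have \<sigma>: "frame W (writes (worklist body)) \<sigma>0 \<sigma>" by (intro frame)
    show "cond_fits W b \<sigma>" using frame_bounded[OF \<sigma>] by (simp add: b_def bounded_stateD)
    assume "cond_val b \<sigma>"
    then have "\<sigma> ''queue_next'' 0 < \<sigma> ''queue_end'' 0" by (simp add: b_def)
    from wp_iteration[OF inv \<sigma> this] frame_bounded[OF \<sigma>]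
    show "wp W (Seq dequeue (scan body)) (\<lambda>t \<tau>. 1 + cond_cost b + t + (B + 60) * work (cells - finished \<tau>) \<le>
      (B + 60) * work (cells - finished \<sigma>) \<and> loop_invariant \<tau>) \<sigma>"
      by (rule wp_mono_frame) (simp add: b_def)
  qed
  then have
    "wp W (While b (Seq dequeue (scan body))) (\<lambda>t \<tau>. 3 + t \<le> (B + 60) * work (set (queue \<tau>)) + 10 \<and>
     I (tokens (set as) (set (queue \<tau>))) \<tau>) \<sigma>1"
  proof (rule wp_mono_frame[OF _ frame_bounded[OF frame1]])
    fix t \<tau> assume t: "t + (B + 60) * work (cells - finished \<tau>) \<le>
      1 + cond_cost b + (B + 60) * work (cells - finished \<sigma>1) \<and> loop_invariant \<tau> \<and> \<not> cond_val b \<tau>"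
    then have fin: "finished \<tau> = set (queue \<tau>)" by (simp add: finished_def loop_invariant_def b_def)
    with t have I: "I (tokens (set as) (set (queue \<tau>))) \<tau>" by (simp add: loop_invariant_def)
    have "work cells = work (cells - set (queue \<tau>)) + work (set (queue \<tau>))"
      using queue_cells[OF I] by (intro work_split) simp_all
    moreover have "finished \<sigma>1 = {}" by (simp add: finished_def \<sigma>1_def store_apply)
    ultimately show
      "3 + t \<le> (B + 60) * work (set (queue \<tau>)) + 10 \<and> I (tokens (set as) (set (queue \<tau>))) \<tau>"
      using t I by (simp add: fin b_def algebra_simps)
  qed
  then show ?thesis by (simp add: worklist_def b_def \<sigma>1_def)
qed

end


section \<open>Counting the live predecessors\<close>

context encoded_graph
begin

abbreviation forward :: "nat rel" where
  "forward \<equiv> forward_edges s (set as)"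

lemma forward_bounds: "(x, y) \<in> forward \<Longrightarrow> x < n \<and> y < n \<and> y \<noteq> s"
  using edges_less forward_edges_no_start[of x s "set as"] forward_edges_subset[of s "set as"]
  by auto

text \<open>
  The copies are numbered \<open>0, \<dots>, n\<close>; since \<open>n\<close> is not a vertex, copy \<open>n\<close> is \<open>G\<close> itself. The counter of
  \<open>s\<close> is the constant \<open>1\<close>, so that in every copy the positive counters mark the reachable vertices.
\<close>

definition token_count :: "(nat \<times> nat \<times> nat) set \<Rightarrow> nat \<times> nat \<Rightarrow> nat" where
  "token_count P = (\<lambda>(w, y). if y = w then 0 else if y = s then 1 else card {x. (w, x, y) \<in> P})"

definition stores_counts :: "(nat \<Rightarrow> nat) \<Rightarrow> (nat \<times> nat \<times> nat) set \<Rightarrow> bool" where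
  "stores_counts a P \<longleftrightarrow> stores_matrix n a (token_count P)"

definition supported :: "(nat \<times> nat \<times> nat) set \<Rightarrow> (nat \<times> nat) set" where
  "supported P = {(w, y) \<in> cells. y \<noteq> w \<and> (y = s \<or> (\<exists>x. (w, x, y) \<in> P))}"

definition alive :: "nat rel \<Rightarrow> (nat \<times> nat) set" where
  "alive E = {(w, x) \<in> cells. avoids s E w x}"

definition live_tokens :: "nat rel \<Rightarrow> (nat \<times> nat \<times> nat) set" where
  "live_tokens F = tokens F (alive F)"

lemma supported_subset_cells: "supported P \<subseteq> cells"
  by (auto simp: supported_def)

lemma alive_subset_cells: "alive E \<subseteq> cells"
  by (auto simp: alive_def)

lemma finite_alive: "finite (alive E)"
  using alive_subset_cells by (rule finite_subset) simp

lemma alive_mono: "E \<subseteq> E' \<Longrightarrow> alive E \<subseteq> alive E'"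
  using avoids_mono[of s E _ _ E'] by (auto simp: alive_def)

lemma finite_tokens: "P \<subseteq> tokens forward cells \<Longrightarrow> finite P"
proof (rule finite_subset[of _ "{..n} \<times> {..<n} \<times> {..<n}"])
  show "P \<subseteq> {..n} \<times> {..<n} \<times> {..<n}" if "P \<subseteq> tokens forward cells"
    using that forward_bounds by (fastforce simp: tokens_def)
qed simp

lemma finite_token_tails: "finite P \<Longrightarrow> finite {x. (w, x, y) \<in> P}"
  by (rule finite_subset[of _ "(\<lambda>(w, x, y). x) ` P"]) force+

lemma supported_eq_token_count:
  assumes "finite P"
  shows "supported P = {p \<in> cells. token_count P p \<noteq> 0}"
  using finite_token_tails[OF assms]
  by (auto simp: token_count_def supported_def card_gt_0_iff split: if_splits)

lemma token_count_Diff: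
  assumes "finite P" "(w, x, y) \<in> P" "y \<noteq> s"
  shows "token_count (P - {(w, x, y)}) = (token_count P)((w, y) := token_count P (w, y) - 1)"
proof
  fix p
  have "{x'. (w, x', y) \<in> P - {(w, x, y)}} = {x'. (w, x', y) \<in> P} - {x}" by auto
  moreover have "{x'. (w', x', y') \<in> P - {(w, x, y)}} = {x'. (w', x', y') \<in> P}"
    if "(w', y') \<noteq> (w, y)" for w' y'
    using that by auto
  ultimately show
    "token_count (P - {(w, x, y)}) p = ((token_count P)((w, y) := token_count P (w, y) - 1)) p"
    using assms finite_token_tails[OF assms(1), of w y] by (cases p) (auto simp: token_count_def)
qed

lemma supported_Diff:
  assumes "finite P" "(w, x, y) \<in> P" "y \<noteq> s" "(w, y) \<in> cells"
  shows "supported (P - {(w, x, y)}) = supported P - (if token_count P (w, y) = 1 then {(w, y)} else {})"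
  using assms by (auto simp: supported_eq_token_count token_count_Diff)

lemma stores_countsD: "stores_counts a P \<Longrightarrow> u \<le> n \<Longrightarrow> v < n \<Longrightarrow> a (u * n + v) = token_count P (u, v)"
  by (simp add: stores_counts_def stores_matrixD)

lemma stores_counts_neq_0_iff:
  "stores_counts a P \<Longrightarrow> finite P \<Longrightarrow> (w, y) \<in> cells \<Longrightarrow> a (w * n + y) \<noteq> 0 \<longleftrightarrow> (w, y) \<in> supported P"
  by (auto simp: stores_countsD supported_eq_token_count)

lemma supported_live_tokens:
  assumes "F \<subseteq> forward"
  shows "supported (live_tokens F) = alive F"
proof -
  have "(w, y) \<in> supported (live_tokens F) \<longleftrightarrow> (w, y) \<in> alive F" for w y
    using assms forward_bounds avoids_iff[of s F w y]
    by (auto simp: supported_def live_tokens_def tokens_def alive_def)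
  then show ?thesis by auto
qed

lemma alive_unique:
  assumes "acyclic forward" "F \<subseteq> forward" and A: "supported (tokens F A) = A"
  shows "A = alive F"
proof -
  have "finite forward" using forward_edges_subset by (rule finite_subset) simp
  then have "wf F" using assms(1,2) by (blast intro: finite_acyclic_wf wf_subset)
  have "(w, y) \<in> A \<longleftrightarrow> avoids s F w y" if "w \<le> n" for w y
  proof (rule avoids_unique[OF \<open>wf F\<close>, of "\<lambda>y. (w, y) \<in> A"])
    fix y
    have "(w, y) \<in> A \<longleftrightarrow> (w, y) \<in> supported (tokens F A)" by (simp add: A)
    then show "(w, y) \<in> A \<longleftrightarrow> y \<noteq> w \<and> (y = s \<or> (\<exists>x. (w, x) \<in> A \<and> (x, y) \<in> F))"
      using that assms(2) forward_bounds start_less by (auto simp: supported_def tokens_def)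
  qed
  moreover have "A \<subseteq> cells" using A supported_subset_cells by blast
  ultimately show ?thesis by (auto simp: alive_def)
qed

lemma alive_Int_forward: "E \<subseteq> set as \<Longrightarrow> alive (E \<inter> forward) = alive E"
  by (simp add: alive_def avoids_Int_forward_edges)

end


section \<open>Propagating a deletion\<close>

definition decrement :: com where
  "decrement =
     If (Neg (Equal (Cell ''count'' (index (Var ''w'') (Var ''y''))) (Const 0)))
       (Seq (Assign ''count'' (index (Var ''w'') (Var ''y''))
              (Bin Minus (Cell ''count'' (index (Var ''w'') (Var ''y''))) (Const 1)))
         (If (Equal (Cell ''count'' (index (Var ''w'') (Var ''y''))) (Const 0)) push Skip))
       Skip"

definition delete_in_copy :: com where
  "delete_in_copy =
     If (Neg (Equal (Cell ''count'' (index (Var ''w'') (Var ''del_tail''))) (Const 0))) decrement Skip"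

definition cascade_step :: com where
  "cascade_step = If (Equal (Cell ''forward'' (index (Var ''x'') (Var ''y''))) (Const 1)) decrement Skip"

lemma writes_deletion [simp]:
  "writes decrement = {''count''} \<union> queue_vars"
  "writes delete_in_copy = {''count''} \<union> queue_vars"
  "writes cascade_step = {''count''} \<union> queue_vars"
  by (auto simp: decrement_def delete_in_copy_def cascade_step_def)

context encoded_graph
begin

text \<open>\<open>A\<close> is the set of pairs that were alive before the deletion; the queue lists those that have died.\<close>

definition deletion_invariant :: "(nat \<times> nat) set \<Rightarrow> (nat \<times> nat \<times> nat) set \<Rightarrow> state \<Rightarrow> bool" where
  "deletion_invariant A P \<sigma> \<longleftrightarrow> P \<subseteq> tokens forward cells \<and> supported P \<subseteq> A \<and> A \<subseteq> cells \<and>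
     stores_counts (\<sigma> ''count'') P \<and> distinct (queue \<sigma>) \<and> set (queue \<sigma>) = A - supported P"

lemma deletion_invariant_frame:
  "deletion_invariant A P \<sigma> \<Longrightarrow> frame W X \<sigma> \<tau> \<Longrightarrow>
   X \<inter> ({''count''} \<union> queue_vars) = {} \<Longrightarrow> deletion_invariant A P \<tau>"
  using queue_frame[of W X \<sigma> \<tau>] frameD[of W X \<sigma> \<tau> "''count''"]
  by (auto simp: deletion_invariant_def)

lemma deletion_invariant_count_iff:
  assumes "deletion_invariant A P \<sigma>" "(w, y) \<in> cells"
  shows "\<sigma> ''count'' (w * n + y) \<noteq> 0 \<longleftrightarrow> (w, y) \<in> supported P"
  using assms finite_tokens[of P] stores_counts_neq_0_iff by (auto simp: deletion_invariant_def)

lemma wp_decrement_state: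
  assumes bounded: "bounded_state W \<sigma>" and n: "\<sigma> ''n'' 0 = n"
    and wy: "\<sigma> ''w'' 0 = w" "w \<le> n" "\<sigma> ''y'' 0 = y" "y < n"
    and queue_end: "\<sigma> ''queue_end'' 0 + 1 < W"
  defines "k \<equiv> \<sigma> ''count'' (w * n + y)"
  defines "\<sigma>1 \<equiv> store \<sigma> ''count'' (w * n + y) (k - 1)"
  shows "wp W decrement (\<lambda>t \<tau>. t \<le> 70 \<and> \<tau> = (if k = 1 then pushed \<sigma>1 else \<sigma>1)) \<sigma>"
proof -
  have k: "k < W" using bounded by (simp add: k_def bounded_stateD)
  show ?thesis
  proof (cases "k = 0")
    case True
    then have "\<sigma>1 = \<sigma>" by (simp add: \<sigma>1_def k_def store_def fun_upd_idem)
    with True show ?thesis using n wy bounded by (simp add: decrement_def k_def bounded_stateD)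
  next
    case False
    have "bounded_state W \<sigma>1" using bounded k by (simp add: \<sigma>1_def bounded_state_store)
    with False k n wy bounded queue_end show ?thesis
      by (simp add: decrement_def k_def[symmetric] \<sigma>1_def[symmetric] wp_push bounded_stateD)
        (simp add: \<sigma>1_def store_apply wp_push bounded_stateD less_imp_diff_less)
  qed
qed

lemma wp_decrement:
  assumes inv: "deletion_invariant A P \<sigma>" and bounded: "bounded_state W \<sigma>" and n: "\<sigma> ''n'' 0 = n"
    and wy: "\<sigma> ''w'' 0 = w" "\<sigma> ''y'' 0 = y" and token: "(w, x, y) \<in> P"
  shows "wp W decrement (\<lambda>t \<tau>. t \<le> 70 \<and> prefix (queue \<sigma>) (queue \<tau>) \<and>
    deletion_invariant A (P - {(w, x, y)}) \<tau>) \<sigma>"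
proof -
  define k where "k = \<sigma> ''count'' (w * n + y)"
  define \<sigma>1 where "\<sigma>1 = store \<sigma> ''count'' (w * n + y) (k - 1)"
  have P: "P \<subseteq> tokens forward cells" using inv by (simp add: deletion_invariant_def)
  note finite = finite_tokens[OF P]
  have cell: "w \<le> n" "y < n" "y \<noteq> s" using P token forward_bounds[of x y] by (auto simp: tokens_def)
  have k: "k = token_count P (w, y)"
    using inv cell by (simp add: k_def deletion_invariant_def stores_countsD)
  define \<tau> where "\<tau> = (if k = 1 then pushed \<sigma>1 else \<sigma>1)"
  have count: "\<tau> ''count'' = (\<sigma> ''count'')(w * n + y := token_count P (w, y) - 1)"
    by (auto simp: \<tau>_def \<sigma>1_def store_apply k)
  have queue: "queue \<tau> = queue \<sigma> @ (if k = 1 then [(w, y)] else [])"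
    using wy by (simp add: \<tau>_def \<sigma>1_def store_apply)
  have supported: "supported (P - {(w, x, y)}) = supported P - (if k = 1 then {(w, y)} else {})"
    using supported_Diff[OF finite token] cell by (simp add: k)
  have new: "(w, y) \<in> supported P" if "k = 1"
    using that cell by (simp add: k supported_eq_token_count[OF finite])
  have "stores_counts (\<tau> ''count'') (P - {(w, x, y)})"
    using inv stores_matrix_upd[OF _ cell(2)] token_count_Diff[OF finite token cell(3)]
    by (simp add: count deletion_invariant_def stores_counts_def)
  then have "deletion_invariant A (P - {(w, x, y)}) \<tau>"
    using inv new by (cases "k = 1") (auto simp: deletion_invariant_def queue supported)
  moreover have "\<sigma> ''queue_end'' 0 + 1 < W"
    using inv by (intro queue_end_fits) (auto simp: deletion_invariant_def)
  then have "wp W decrement (\<lambda>t \<tau>'. t \<le> 70 \<and> \<tau>' = \<tau>) \<sigma>"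
    unfolding \<tau>_def k_def \<sigma>1_def using bounded n wy cell by (intro wp_decrement_state) auto
  ultimately show ?thesis using bounded queue by (auto elim!: wp_mono_frame)
qed

lemma wp_delete_in_copy:
  assumes inv: "deletion_invariant A P \<sigma>" and bounded: "bounded_state W \<sigma>" and n: "\<sigma> ''n'' 0 = n"
    and wuv: "\<sigma> ''w'' 0 = w" "w \<le> n" "\<sigma> ''del_tail'' 0 = u" "u < n" "\<sigma> ''y'' 0 = v"
    and token: "(w, u) \<in> supported P \<longleftrightarrow> (w, u, v) \<in> P"
  shows "wp W delete_in_copy (\<lambda>t \<tau>. t \<le> 86 \<and> deletion_invariant A (P - {(w, u, v)}) \<tau>) \<sigma>"
proof (cases "(w, u, v) \<in> P")
  case True
  from wp_mono_frame[OF wp_decrement[OF inv bounded n wuv(1,5) True] bounded] show ?thesis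
    using True token deletion_invariant_count_iff[OF inv, of w u] wuv n bounded
    by (simp add: delete_in_copy_def bounded_stateD)
next
  case False
  then have "\<sigma> ''count'' (w * n + u) = 0"
    using token deletion_invariant_count_iff[OF inv, of w u] wuv by auto
  with False show ?thesis using inv wuv n by (simp add: delete_in_copy_def)
qed

lemma wp_delete_in_copies:
  assumes \<sigma>0: "bounded_state W \<sigma>0" "inputs \<sigma>0" "\<sigma>0 ''queue_end'' 0 = 0"
    and count: "stores_counts (\<sigma>0 ''count'') (live_tokens F)"
    and edge: "\<sigma>0 ''del_tail'' 0 = u" "\<sigma>0 ''y'' 0 = v" "(u, v) \<in> F" and F: "F \<subseteq> forward"
  shows "wp W (for_each_copy delete_in_copy) (\<lambda>t \<tau>. t \<le> 200 * (n + 1) \<and>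
    deletion_invariant (alive F) (tokens (F - {(u, v)}) (alive F)) \<tau>) \<sigma>0"
proof -
  define P where "P k = live_tokens F - {..<k} \<times> {(u, v)}" for k
  have u: "u < n" using F forward_bounds edge(3) by blast
  have "wp W (for_each_copy delete_in_copy)
    (\<lambda>t \<tau>. t \<le> 2 * (86 + 14) * (n + 1) \<and> deletion_invariant (alive F) (P (Suc n)) \<tau>) \<sigma>0"
  proof (rule wp_for_each_copy[where I = "\<lambda>k. deletion_invariant (alive F) (P k)"])
    have "live_tokens F \<subseteq> tokens forward cells"
      using F alive_subset_cells by (auto simp: live_tokens_def tokens_def)
    then show "deletion_invariant (alive F) (P 0) \<sigma>0"
      using count \<sigma>0(3) alive_subset_cells
      by (auto simp: P_def deletion_invariant_def supported_live_tokens[OF F] queue_def)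
  next
    fix k \<sigma>
    assume k: "k \<le> n" "\<sigma> ''w'' 0 = k" and inv: "deletion_invariant (alive F) (P k) \<sigma>"
      and frame: "frame W (insert ''w'' (writes delete_in_copy)) \<sigma>0 \<sigma>"
    have \<sigma>: "\<sigma> ''n'' 0 = n" "\<sigma> ''del_tail'' 0 = u" "\<sigma> ''y'' 0 = v"
      using frameD[OF frame] \<sigma>0(2) edge by (simp_all add: inputs_def)
    have "(k, u) \<in> supported (P k) \<longleftrightarrow> (k, u) \<in> supported (live_tokens F)"
      by (auto simp: supported_def P_def)
    also have "\<dots> \<longleftrightarrow> (k, u, v) \<in> P k"
      using edge(3)
      by (simp add: supported_live_tokens[OF F]) (simp add: P_def live_tokens_def tokens_def)
    finally have token: "(k, u) \<in> supported (P k) \<longleftrightarrow> (k, u, v) \<in> P k" .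
    have "P (Suc k) = P k - {(k, u, v)}" by (auto simp: P_def less_Suc_eq)
    with wp_delete_in_copy[OF inv frame_bounded[OF frame] \<sigma>(1) k(2,1) \<sigma>(2) u \<sigma>(3) token]
    show "wp W delete_in_copy (\<lambda>t \<tau>. t \<le> 86 \<and> deletion_invariant (alive F) (P (Suc k)) \<tau>) \<sigma>" by simp
  qed (use \<sigma>0 in \<open>auto elim: deletion_invariant_frame\<close>)
  moreover have "P (Suc n) = tokens (F - {(u, v)}) (alive F)"
    by (auto simp: P_def live_tokens_def tokens_def alive_def)
  ultimately show ?thesis by simp
qed

lemma wp_cascade_step:
  assumes inv: "deletion_invariant A (tokens F A - D) \<sigma>" and bounded: "bounded_state W \<sigma>"
    and n: "\<sigma> ''n'' 0 = n" and forward: "stores_set n (\<sigma> ''forward'') F"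
    and wxy: "\<sigma> ''w'' 0 = w" "\<sigma> ''x'' 0 = x" "\<sigma> ''y'' 0 = y"
    and entry: "(w, x) \<in> set (queue \<sigma>)" "(x, y) \<in> set as" "(w, x, y) \<notin> D"
  shows "wp W cascade_step (\<lambda>t \<tau>. t \<le> 90 \<and> prefix (queue \<sigma>) (queue \<tau>) \<and>
    deletion_invariant A (tokens F A - insert (w, x, y) D) \<tau>) \<sigma>"
proof -
  have A: "(w, x) \<in> A" "(w, x) \<in> cells" using inv entry(1) by (auto simp: deletion_invariant_def)
  have y: "y < n" using entry(2) edges_less by auto
  have test: "\<sigma> ''forward'' (x * n + y) = of_bool ((x, y) \<in> F)"
    using stores_setD[OF forward] A(2) y by simp
  show ?thesis
  proof (cases "(x, y) \<in> F")
    case True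
    then have "(w, x, y) \<in> tokens F A - D" using A(1) entry(3) by (simp add: tokens_def)
    from wp_decrement[OF inv bounded n wxy(1,3) this]
    have "wp W decrement (\<lambda>t \<tau>. t \<le> 70 \<and> prefix (queue \<sigma>) (queue \<tau>) \<and>
      deletion_invariant A (tokens F A - insert (w, x, y) D) \<tau>) \<sigma>" by (simp flip: Diff_insert)
    from wp_mono_frame[OF this bounded] show ?thesis
      using True test n wxy A(2) y by (simp add: cascade_step_def)
  next
    case False
    then have "tokens F A - insert (w, x, y) D = tokens F A - D" by (auto simp: tokens_def)
    then show ?thesis using False inv test n wxy A(2) y by (simp add: cascade_step_def)
  qed
qed

lemma wp_cascade:
  assumes acyclic: "acyclic forward" and F: "F \<subseteq> forward"
    and \<sigma>0: "bounded_state W \<sigma>0" "layout \<sigma>0" "stores_set n (\<sigma>0 ''forward'') F"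
    and init: "deletion_invariant A (tokens F A) \<sigma>0"
  shows "wp W (worklist cascade_step) (\<lambda>t \<tau>. t \<le> 150 * work (set (queue \<tau>)) + 10 \<and>
    stores_counts (\<tau> ''count'') (live_tokens F) \<and>
    distinct (queue \<tau>) \<and> set (queue \<tau>) = A - alive F) \<sigma>0"
proof -
  interpret worklist_invariant n s W as cascade_step 90
    "\<lambda>D. deletion_invariant A (tokens F A - D)" \<sigma>0
  proof unfold_locales
    show "distinct (queue \<sigma>) \<and> set (queue \<sigma>) \<subseteq> cells"
      if "deletion_invariant A (tokens F A - D) \<sigma>" for D \<sigma>
      using that by (auto simp: deletion_invariant_def)
    show "deletion_invariant A (tokens F A - D) \<tau>"
      if "deletion_invariant A (tokens F A - D) \<sigma>"
        "frame W worklist_vars \<sigma> \<tau>" for D \<sigma> \<tau>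
      using that by (rule deletion_invariant_frame) simp
  next
    fix D \<sigma> w x y
    assume inv: "deletion_invariant A (tokens F A - D) \<sigma>" and "layout \<sigma>"
      and frame: "frame W (writes (worklist cascade_step)) \<sigma>0 \<sigma>"
      and entry: "(w, x) \<in> set (queue \<sigma>)" "(x, y) \<in> set as" "(w, x, y) \<notin> D"
        "\<sigma> ''w'' 0 = w" "\<sigma> ''x'' 0 = x" "\<sigma> ''y'' 0 = y"
    then have "\<sigma> ''n'' 0 = n" "stores_set n (\<sigma> ''forward'') F"
      using frameD[OF frame, of "''forward''"] \<sigma>0(3) by (simp_all add: inputsD[OF layoutD])
    with inv entry show "wp W cascade_step (\<lambda>t \<tau>. t \<le> 90 \<and> prefix (queue \<sigma>) (queue \<tau>) \<and>
      deletion_invariant A (tokens F A - insert (w, x, y) D) \<tau>) \<sigma>"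
      by (intro wp_cascade_step frame_bounded[OF frame])
  qed (use \<sigma>0 init in auto)
  show ?thesis
    using wp_worklist \<sigma>0(1)
  proof (rule wp_mono_frame)
    fix t \<tau> assume post: "t \<le> (90 + 60) * work (set (queue \<tau>)) + 10 \<and>
      deletion_invariant A (tokens F A - tokens (set as) (set (queue \<tau>))) \<tau>"
    define A' where "A' = supported (tokens F A - tokens (set as) (set (queue \<tau>)))"
    have queue: "set (queue \<tau>) = A - A'" "A' \<subseteq> A"
      using post by (auto simp: deletion_invariant_def A'_def)
    have tokens: "tokens F A - tokens (set as) (set (queue \<tau>)) = tokens F A'"
      using queue F forward_edges_subset[of s "set as"] by (auto simp: tokens_def)
    then have "A' = alive F" using A'_def by (intro alive_unique[OF acyclic F]) simp
    with post queue tokens supported_live_tokens[OF F] show "t \<le> 150 * work (set (queue \<tau>)) + 10 \<and>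
      stores_counts (\<tau> ''count'') (live_tokens F) \<and>
      distinct (queue \<tau>) \<and> set (queue \<tau>) = A - alive F"
      by (simp add: deletion_invariant_def live_tokens_def)
  qed
qed

end


section \<open>Updating the tree\<close>

definition settle_step :: com where
  "settle_step =
     Seq (Put ''w'' (Cell ''queue_copy'' (Var ''i'')))
    (Seq (Put ''x'' (Cell ''queue_vertex'' (Var ''i'')))
         (If (Equal (Var ''w'') (Var ''n''))
           (Assign ''in_tree'' (Var ''x'') (Const 0))
           (If (Equal (Cell ''count'' (index (Cell ''parent'' (Var ''x'')) (Var ''w''))) (Const 0))
             (Assign ''parent'' (Var ''x'') (Var ''w''))
             Skip)))"

definition settle :: com where
  "settle = For ''i'' (Var ''queue_end'') settle_step"

lemma writes_settle [simp]:
  "writes settle_step = {''w'', ''x'', ''in_tree'', ''parent''}"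
  "writes settle = {''i'', ''w'', ''x'', ''in_tree'', ''parent''}"
  by (auto simp: settle_step_def settle_def)

context encoded_graph
begin

definition stores_tree :: "nat rel \<Rightarrow> state \<Rightarrow> bool" where
  "stores_tree E \<sigma> \<longleftrightarrow> (\<forall>v<n. (\<sigma> ''in_tree'' v \<noteq> 0 \<longleftrightarrow> (s, v) \<in> E\<^sup>*) \<and> \<sigma> ''parent'' v < n \<and>
     (v \<noteq> s \<and> (s, v) \<in> E\<^sup>* \<longrightarrow> idom_among s E {..<n} (\<sigma> ''parent'' v) v))"

text \<open>The tree on the way from \<open>E\<close> to \<open>E'\<close>, when the deaths in \<open>Q\<close> have been taken into account.\<close>

definition stores_tree_between :: "nat rel \<Rightarrow> nat rel \<Rightarrow> (nat \<times> nat) set \<Rightarrow> state \<Rightarrow> bool" where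
  "stores_tree_between E E' Q \<sigma> \<longleftrightarrow> (\<forall>v<n.
     (\<sigma> ''in_tree'' v \<noteq> 0 \<longleftrightarrow> (s, v) \<in> E\<^sup>* \<and> (n, v) \<notin> Q) \<and> \<sigma> ''parent'' v < n \<and>
     (v \<noteq> s \<and> (s, v) \<in> E'\<^sup>* \<longrightarrow>
       idom_among s E' {w \<in> {..<n}. \<not> avoids s E w v \<or> (w, v) \<in> Q} (\<sigma> ''parent'' v) v))"

lemma avoids_n_iff: "E \<subseteq> set as \<Longrightarrow> avoids s E n v \<longleftrightarrow> (s, v) \<in> E\<^sup>*"
  using start_less edges_less by (intro avoids_fresh_iff) auto

lemma stores_tree_frame:
  "stores_tree E \<sigma> \<Longrightarrow> frame W X \<sigma> \<tau> \<Longrightarrow> X \<inter> {''in_tree'', ''parent''} = {} \<Longrightarrow> stores_tree E \<tau>"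
  by (simp add: stores_tree_def frame_def)

lemma stores_tree_between_frame:
  "stores_tree_between E E' Q \<sigma> \<Longrightarrow> frame W X \<sigma> \<tau> \<Longrightarrow> X \<inter> {''in_tree'', ''parent''} = {} \<Longrightarrow>
   stores_tree_between E E' Q \<tau>"
  by (simp add: stores_tree_between_def frame_def)

lemma stores_tree_between_start:
  assumes "stores_tree E \<sigma>" "E' \<subseteq> E"
  shows "stores_tree_between E E' {} \<sigma>"
  unfolding stores_tree_between_def
proof (intro allI impI conjI)
  fix v assume v: "v < n"
  with assms(1) show "\<sigma> ''in_tree'' v \<noteq> 0 \<longleftrightarrow> (s, v) \<in> E\<^sup>* \<and> (n, v) \<notin> {}" "\<sigma> ''parent'' v < n"
    by (simp_all add: stores_tree_def)
  assume "v \<noteq> s \<and> (s, v) \<in> E'\<^sup>*"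
  with assms v have "idom_among s E {..<n} (\<sigma> ''parent'' v) v"
    using rtrancl_mono[OF assms(2)] by (auto simp: stores_tree_def)
  from idom_among_delete_edges[OF this assms(2)]
  show "idom_among s E' {w \<in> {..<n}. \<not> avoids s E w v \<or> (w, v) \<in> {}} (\<sigma> ''parent'' v) v" by simp
qed

lemma stores_tree_between_end:
  assumes "stores_tree_between E E' (alive E - alive E') \<sigma>" "E' \<subseteq> E" "E \<subseteq> set as"
  shows "stores_tree E' \<sigma>"
  unfolding stores_tree_def
proof (intro allI impI conjI)
  fix v assume v: "v < n"
  have E': "E' \<subseteq> set as" using assms(2,3) by blast
  have "(s, v) \<in> E'\<^sup>* \<Longrightarrow> (s, v) \<in> E\<^sup>*" using rtrancl_mono[OF assms(2)] by blast
  with assms(1) v show "\<sigma> ''in_tree'' v \<noteq> 0 \<longleftrightarrow> (s, v) \<in> E'\<^sup>*"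
    by (auto simp: stores_tree_between_def alive_def avoids_n_iff[OF assms(3)] avoids_n_iff[OF E'])
  show "\<sigma> ''parent'' v < n" using assms(1) v by (simp add: stores_tree_between_def)
  assume "v \<noteq> s \<and> (s, v) \<in> E'\<^sup>*"
  with assms(1) v show "idom_among s E' {..<n} (\<sigma> ''parent'' v) v"
    by (auto simp: stores_tree_between_def idom_among_def alive_def)
qed

lemma stores_tree_between_insert:
  assumes inv: "stores_tree_between E E' Q \<sigma>"
    and wx: "w \<le> n" "w \<noteq> x" "\<not> avoids s E' w x"
    and in_tree: "\<tau> ''in_tree'' = (if w = n then (\<sigma> ''in_tree'')(x := 0) else \<sigma> ''in_tree'')"
    and parent: "\<tau> ''parent'' = (if w \<noteq> n \<and> \<not> avoids s E' (\<sigma> ''parent'' x) w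
      then (\<sigma> ''parent'')(x := w) else \<sigma> ''parent'')"
  shows "stores_tree_between E E' (insert (w, x) Q) \<tau>"
  unfolding stores_tree_between_def
proof (intro allI impI conjI)
  fix v assume v: "v < n"
  then show "\<tau> ''in_tree'' v \<noteq> 0 \<longleftrightarrow> (s, v) \<in> E\<^sup>* \<and> (n, v) \<notin> insert (w, x) Q" "\<tau> ''parent'' v < n"
    using inv wx(1) by (auto simp: in_tree parent stores_tree_between_def)
  assume reachable: "v \<noteq> s \<and> (s, v) \<in> E'\<^sup>*"
  define S where "S = {w \<in> {..<n}. \<not> avoids s E w v \<or> (w, v) \<in> Q}"
  have old: "idom_among s E' S (\<sigma> ''parent'' v) v"
    using inv v reachable by (simp add: stores_tree_between_def S_def)
  show "idom_among s E' {w' \<in> {..<n}. \<not> avoids s E w' v \<or> (w', v) \<in> insert (w, x) Q} (\<tau> ''parent'' v) v"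
  proof (cases "v = x \<and> w \<noteq> n")
    case True
    then have "{w' \<in> {..<n}. \<not> avoids s E w' v \<or> (w', v) \<in> insert (w, x) Q} = insert w S"
      using wx(1) by (auto simp: S_def)
    moreover have "\<tau> ''parent'' v = (if avoids s E' (\<sigma> ''parent'' v) w then \<sigma> ''parent'' v else w)"
      using True by (simp add: parent)
    ultimately show ?thesis using idom_among_insert[OF old, of w] reachable True wx(2,3) by simp
  next
    case False
    then have "{w' \<in> {..<n}. \<not> avoids s E w' v \<or> (w', v) \<in> insert (w, x) Q} = S"
      "\<tau> ''parent'' v = \<sigma> ''parent'' v" by (auto simp: S_def parent)
    with old show ?thesis by simp
  qed
qed

lemma wp_settle_step:
  assumes inv: "stores_tree_between E E' Q \<sigma>" and \<sigma>: "bounded_state W \<sigma>" "\<sigma> ''n'' 0 = n"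
    and count: "\<And>w y. (w, y) \<in> cells \<Longrightarrow> \<sigma> ''count'' (w * n + y) \<noteq> 0 \<longleftrightarrow> avoids s E' w y"
    and entry: "\<sigma> ''queue_copy'' (\<sigma> ''i'' 0) = w" "\<sigma> ''queue_vertex'' (\<sigma> ''i'' 0) = x"
      "(w, x) \<in> alive E - alive E'"
  shows "wp W settle_step (\<lambda>t \<tau>. t \<le> 40 \<and> stores_tree_between E E' (insert (w, x) Q) \<tau>) \<sigma>"
proof -
  define p where "p = \<sigma> ''parent'' x"
  have wx: "w \<le> n" "x < n" "w \<noteq> x" "\<not> avoids s E' w x" using entry(3) by (auto simp: alive_def)
  have p: "p < n" using inv wx(2) by (simp add: p_def stores_tree_between_def)
  have test: "\<sigma> ''count'' (p * n + w) = 0 \<longleftrightarrow> \<not> avoids s E' p w" if "w \<noteq> n"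
    using count[of p w] p wx(1) that by auto
  have "wp W settle_step (\<lambda>t \<tau>. t \<le> 40 \<and>
    \<tau> ''in_tree'' = (if w = n then (\<sigma> ''in_tree'')(x := 0) else \<sigma> ''in_tree'') \<and>
    \<tau> ''parent'' = (if w \<noteq> n \<and> \<not> avoids s E' p w then (\<sigma> ''parent'')(x := w) else \<sigma> ''parent'')) \<sigma>"
    using \<sigma> entry(1,2) wx(1,2) p test
    by (simp add: settle_step_def store_apply bounded_stateD p_def[symmetric])
  then show ?thesis
    by (rule wp_mono) (use stores_tree_between_insert[OF inv wx(1,3,4)] in \<open>simp add: p_def\<close>)
qed

lemma wp_settle:
  assumes E: "E' \<subseteq> E" "E \<subseteq> set as" and \<sigma>0: "bounded_state W \<sigma>0" "inputs \<sigma>0"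
    and count: "\<And>w y. (w, y) \<in> cells \<Longrightarrow> \<sigma>0 ''count'' (w * n + y) \<noteq> 0 \<longleftrightarrow> avoids s E' w y"
    and queue: "set (queue \<sigma>0) = alive E - alive E'" and tree: "stores_tree E \<sigma>0"
  shows "wp W settle (\<lambda>t \<tau>. t \<le> 52 * (\<sigma>0 ''queue_end'' 0 + 1) \<and> stores_tree E' \<tau>) \<sigma>0"
proof -
  define I where "I k = stores_tree_between E E' (set (take k (queue \<sigma>0)))" for k
  define N where "N = \<sigma>0 ''queue_end'' 0"
  have "wp W settle (\<lambda>t \<tau>. t \<le> (40 + expr_cost (Var ''queue_end'') + 10) * (N + 1) \<and> I N \<tau>) \<sigma>0"
    unfolding settle_def
  proof (rule wp_For_uniform[where I = I])
    show "I 0 \<sigma>0" using stores_tree_between_start[OF tree E(1)] by (simp add: I_def)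
    show "I k \<tau>" if "I k \<sigma>" "frame W {''i''} \<sigma> \<tau>" for k \<sigma> \<tau>
      using that unfolding I_def by (rule stores_tree_between_frame) simp
  next
    fix k \<sigma>
    assume k: "k < N" "I k \<sigma>" "\<sigma> ''i'' 0 = k"
      and frame: "frame W (insert ''i'' (writes settle_step)) \<sigma>0 \<sigma>"
    obtain w x where entry: "queue \<sigma>0 ! k = (w, x)" by fastforce
    have take: "set (take (Suc k) (queue \<sigma>0)) = insert (w, x) (set (take k (queue \<sigma>0)))"
      using k(1) entry by (simp add: N_def take_Suc_conv_app_nth)
    have "(w, x) \<in> set (queue \<sigma>0)" using k(1) entry unfolding N_def by (metis length_queue nth_mem)
    then show "wp W settle_step (\<lambda>t \<tau>. t \<le> 40 \<and> I (Suc k) \<tau>) \<sigma>"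
      unfolding I_def take
      using E frame_bounded[OF frame] frameD[OF frame] \<sigma>0(2) count k entry queue
      by (intro wp_settle_step) (auto simp: I_def N_def nth_queue inputs_def)
  qed (use \<sigma>0(1) in \<open>auto simp: N_def bounded_stateD\<close>)
  moreover have "I N = stores_tree_between E E' (alive E - alive E')"
    by (simp add: I_def N_def queue flip: length_queue)
  ultimately have "wp W settle
    (\<lambda>t \<tau>. t \<le> 52 * (N + 1) \<and> stores_tree_between E E' (alive E - alive E') \<tau>) \<sigma>0" by simp
  then show ?thesis
    using \<sigma>0(1) by (rule wp_mono_frame) (simp add: N_def stores_tree_between_end[OF _ E])
qed

end


section \<open>Deleting an edge\<close>

definition start_deletion :: com where
  "start_deletion =
     Seq (Assign ''forward'' (index (Var ''del_tail'') (Var ''del_head'')) (Const 0))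
         (Put ''y'' (Var ''del_head''))"

definition propagate_deletion :: com where
  "propagate_deletion = Seq (for_each_copy delete_in_copy) (worklist cascade_step)"

definition delete_forward_edge :: com where
  "delete_forward_edge = Seq start_deletion (Seq propagate_deletion settle)"

definition update :: com where
  "update =
     Seq (Put ''queue_end'' (Const 0))
       (If (Equal (Cell ''forward'' (index (Var ''del_tail'') (Var ''del_head''))) (Const 1))
         delete_forward_edge Skip)"

lemma writes_start_deletion [simp]: "writes start_deletion = {''forward'', ''y''}"
  by (auto simp: start_deletion_def)

lemma writes_propagate_deletion [simp]:
  "writes propagate_deletion = {''w'', ''x'', ''y'', ''j'', ''queue_next'', ''count'',
     ''queue_copy'', ''queue_vertex'', ''queue_end''}"
  by (auto simp: propagate_deletion_def)

context encoded_graph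
begin

definition maintained :: "nat rel \<Rightarrow> state \<Rightarrow> bool" where
  "maintained E \<sigma> \<longleftrightarrow> layout \<sigma> \<and> stores_tree E \<sigma> \<and>
     stores_set n (\<sigma> ''forward'') (E \<inter> forward) \<and>
     stores_counts (\<sigma> ''count'') (live_tokens (E \<inter> forward))"

lemma maintained_frame:
  "maintained E \<sigma> \<Longrightarrow> frame W X \<sigma> \<tau> \<Longrightarrow>
   X \<inter> (layout_vars \<union> {''in_tree'', ''parent'', ''forward'', ''count''}) = {} \<Longrightarrow> maintained E \<tau>"
  using layout_frame[of \<sigma> X \<tau>] stores_tree_frame[of E \<sigma> X \<tau>]
    frameD[of W X \<sigma> \<tau> "''forward''"] frameD[of W X \<sigma> \<tau> "''count''"]
  by (auto simp: maintained_def)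

lemma stores_live_counts_iff:
  assumes "stores_counts a (live_tokens (E \<inter> forward))" "E \<subseteq> set as" "(w, y) \<in> cells"
  shows "a (w * n + y) \<noteq> 0 \<longleftrightarrow> avoids s E w y"
proof -
  have "finite (live_tokens (E \<inter> forward))"
    using alive_subset_cells by (intro finite_tokens) (auto simp: live_tokens_def tokens_def)
  then have "a (w * n + y) \<noteq> 0 \<longleftrightarrow> (w, y) \<in> supported (live_tokens (E \<inter> forward))"
    using assms(1,3) by (intro stores_counts_neq_0_iff)
  also have "\<dots> \<longleftrightarrow> (w, y) \<in> alive E"
    using assms(2) by (simp add: supported_live_tokens alive_Int_forward)
  finally show ?thesis using assms(3) by (simp add: alive_def)
qed

text \<open>A pair pays once, when it dies: \<open>150\<close> for each unit of scanning, \<open>52\<close> for settling it in the tree.\<close>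

definition potential :: "nat rel \<Rightarrow> nat" where
  "potential E = 202 * work (alive E)"

lemma potential_eq_add_dead:
  assumes "E' \<subseteq> E"
  shows "potential E = potential E' + 202 * work (alive E - alive E')"
proof -
  have "alive E - (alive E - alive E') = alive E'" using alive_mono[OF assms] by auto
  then show ?thesis using work_split[of "alive E" "alive E - alive E'"] finite_alive
    by (simp add: potential_def)
qed

lemma wp_start_deletion:
  assumes "maintained E \<sigma>" "bounded_state W \<sigma>" "\<sigma> ''del_tail'' 0 = u" "\<sigma> ''del_head'' 0 = v"
    and "u < n" "v < n"
  shows "wp W start_deletion (\<lambda>t \<tau>. t \<le> 20 \<and> \<tau> ''y'' 0 = v \<and>
    stores_set n (\<tau> ''forward'') (E \<inter> forward - {(u, v)})) \<sigma>"
proof -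
  have "stores_set n ((\<sigma> ''forward'')(u * n + v := 0)) (E \<inter> forward - {(u, v)})"
    using assms(1,6) by (intro stores_set_remove) (simp add: maintained_def)
  moreover have "\<sigma> ''n'' 0 = n" using assms(1) by (simp add: maintained_def inputsD[OF layoutD])
  ultimately show ?thesis using assms by (simp add: start_deletion_def store_apply)
qed

lemma wp_propagate_deletion:
  assumes acyclic: "acyclic forward" and F: "F \<subseteq> forward" "(u, v) \<in> F"
    and \<sigma>: "bounded_state W \<sigma>" "layout \<sigma>" "\<sigma> ''queue_end'' 0 = 0" "\<sigma> ''del_tail'' 0 = u"
      "\<sigma> ''y'' 0 = v"
    and forward: "stores_set n (\<sigma> ''forward'') (F - {(u, v)})"
    and count: "stores_counts (\<sigma> ''count'') (live_tokens F)"
  shows "wp W propagate_deletion (\<lambda>t \<tau>. t \<le> 150 * work (set (queue \<tau>)) + 200 * (n + 1) + 10 \<and>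
    stores_counts (\<tau> ''count'') (live_tokens (F - {(u, v)})) \<and>
    distinct (queue \<tau>) \<and> set (queue \<tau>) = alive F - alive (F - {(u, v)})) \<sigma>"
    (is "wp W _ ?Q \<sigma>")
proof -
  have "wp W (for_each_copy delete_in_copy) (\<lambda>t. wp W (worklist cascade_step) (\<lambda>u. ?Q (t + u))) \<sigma>"
    using wp_delete_in_copies[OF \<sigma>(1) layoutD[OF \<sigma>(2)] \<sigma>(3) count \<sigma>(4,5) F(2,1)] \<sigma>(1)
  proof (rule wp_mono_frame)
    fix t \<sigma>' assume seeded: "t \<le> 200 * (n + 1) \<and>
        deletion_invariant (alive F) (tokens (F - {(u, v)}) (alive F)) \<sigma>'"
      and frame: "frame W (writes (for_each_copy delete_in_copy)) \<sigma> \<sigma>'"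
    note bounded = frame_bounded[OF frame]
    have "layout \<sigma>'" using \<sigma>(2) frame by (rule layout_frame) simp
    moreover have "stores_set n (\<sigma>' ''forward'') (F - {(u, v)})"
      using forward frameD[OF frame] by simp
    moreover have "F - {(u, v)} \<subseteq> forward" using F(1) by blast
    ultimately have "wp W (worklist cascade_step) (\<lambda>t \<tau>. t \<le> 150 * work (set (queue \<tau>)) + 10 \<and>
      stores_counts (\<tau> ''count'') (live_tokens (F - {(u, v)})) \<and>
      distinct (queue \<tau>) \<and> set (queue \<tau>) = alive F - alive (F - {(u, v)})) \<sigma>'"
      using wp_cascade[OF acyclic _ bounded] seeded by blast
    then show "wp W (worklist cascade_step) (\<lambda>u. ?Q (t + u)) \<sigma>'"
      using bounded by (rule wp_mono_frame) (use seeded in auto)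
  qed
  then show ?thesis by (simp only: propagate_deletion_def wp_Seq)
qed

lemma wp_settle_maintained:
  assumes E: "E' \<subseteq> E" "E \<subseteq> set as" and \<sigma>: "bounded_state W \<sigma>" "layout \<sigma>" "stores_tree E \<sigma>"
    and forward: "stores_set n (\<sigma> ''forward'') (E' \<inter> forward)"
    and count: "stores_counts (\<sigma> ''count'') (live_tokens (E' \<inter> forward))"
    and queue: "set (queue \<sigma>) = alive E - alive E'"
  shows "wp W settle (\<lambda>t \<tau>. t \<le> 52 * (\<sigma> ''queue_end'' 0 + 1) \<and> maintained E' \<tau>) \<sigma>"
proof -
  have "E' \<subseteq> set as" using E by blast
  note count_iff = stores_live_counts_iff[OF count this]
  from wp_settle[OF E \<sigma>(1) layoutD[OF \<sigma>(2)] count_iff queue \<sigma>(3)] \<sigma>(1) show ?thesis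
  proof (rule wp_mono_frame)
    fix t \<tau>
    assume "t \<le> 52 * (\<sigma> ''queue_end'' 0 + 1) \<and> stores_tree E' \<tau>"
      and frame: "frame W (writes settle) \<sigma> \<tau>"
    moreover have "layout \<tau>" using \<sigma>(2) frame by (rule layout_frame) simp
    ultimately show "t \<le> 52 * (\<sigma> ''queue_end'' 0 + 1) \<and> maintained E' \<tau>"
      using forward count frameD[OF frame] by (simp add: maintained_def)
  qed
qed

lemma wp_delete_forward_edge:
  assumes acyclic: "acyclic forward" and E: "E \<subseteq> set as" "(u, v) \<in> E \<inter> forward"
    and \<sigma>: "maintained E \<sigma>" "bounded_state W \<sigma>" "\<sigma> ''queue_end'' 0 = 0"
      "\<sigma> ''del_tail'' 0 = u" "\<sigma> ''del_head'' 0 = v"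
  shows "wp W delete_forward_edge (\<lambda>t \<tau>. t + potential (E - {(u, v)}) \<le>
    potential E + 200 * (n + 1) + 90 \<and> maintained (E - {(u, v)}) \<tau>) \<sigma>"
proof -
  define E' where "E' = E - {(u, v)}"
  have E': "E' \<subseteq> E" "E' \<subseteq> set as" and F': "E \<inter> forward - {(u, v)} = E' \<inter> forward"
    using E by (auto simp: E'_def)
  have "u < n" "v < n" using E(2) forward_bounds by auto
  from wp_start_deletion[OF \<sigma>(1,2,4,5) this] \<sigma>(2) obtain t1 \<sigma>1
    where start: "exec W start_deletion \<sigma> t1 \<sigma>1" "t1 \<le> 20" "\<sigma>1 ''y'' 0 = v"
      "frame W {''forward'', ''y''} \<sigma> \<sigma>1"
      and forward: "stores_set n (\<sigma>1 ''forward'') (E' \<inter> forward)"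
    by (auto simp: F' elim!: wpE)
  have layout: "layout \<sigma>1" using \<sigma>(1) start(4) by (auto simp: maintained_def elim!: layout_frame)
  have "wp W propagate_deletion (\<lambda>t \<tau>. t \<le> 150 * work (set (queue \<tau>)) + 200 * (n + 1) + 10 \<and>
      stores_counts (\<tau> ''count'') (live_tokens (E' \<inter> forward)) \<and>
      distinct (queue \<tau>) \<and> set (queue \<tau>) = alive E - alive E') \<sigma>1"
    using wp_propagate_deletion[OF acyclic Int_lower2 E(2) frame_bounded[OF start(4)] layout]
      \<sigma> forward start(3) frameD[OF start(4)] alive_Int_forward[OF E(1)] alive_Int_forward[OF E'(2)]
    by (simp add: F' maintained_def)
  with frame_bounded[OF start(4)] obtain t2 \<sigma>2 where
    propagate: "exec W propagate_deletion \<sigma>1 t2 \<sigma>2"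
      "t2 \<le> 150 * work (set (queue \<sigma>2)) + 200 * (n + 1) + 10"
      "stores_counts (\<sigma>2 ''count'') (live_tokens (E' \<inter> forward))" "distinct (queue \<sigma>2)"
      "set (queue \<sigma>2) = alive E - alive E'" "frame W (writes propagate_deletion) \<sigma>1 \<sigma>2"
    by (auto elim!: wpE)
  have layout2: "layout \<sigma>2" using layout propagate(6) by (rule layout_frame) simp
  have "stores_tree E \<sigma>2"
    using \<sigma>(1) frame_trans[OF start(4) propagate(6) subset_refl]
    by (auto simp: maintained_def elim!: stores_tree_frame)
  from wp_settle_maintained[OF E'(1) E(1) frame_bounded[OF propagate(6)] layout2 this _ propagate(3,5)]
    frame_bounded[OF propagate(6)] forward frameD[OF propagate(6)]
  obtain t3 \<tau> where settle: "exec W settle \<sigma>2 t3 \<tau>" "t3 \<le> 52 * (\<sigma>2 ''queue_end'' 0 + 1)"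
      "maintained E' \<tau>"
    by (auto elim!: wpE)
  have "\<sigma>2 ''queue_end'' 0 \<le> work (set (queue \<sigma>2))"
    using distinct_card[OF propagate(4)] card_le_work[of "set (queue \<sigma>2)"] by simp
  then have "t1 + (t2 + t3) + potential E' \<le> potential E + 200 * (n + 1) + 90"
    using potential_eq_add_dead[OF E'(1)] start(2) propagate(2) settle(2)
    by (simp add: propagate(5))
  moreover have "exec W delete_forward_edge \<sigma> (t1 + (t2 + t3)) \<tau>"
    unfolding delete_forward_edge_def
    by (rule exec.Seq[OF start(1) exec.Seq[OF propagate(1) settle(1)]])
  ultimately show ?thesis using settle(3) by (auto simp: wp_def E'_def)
qed

lemma maintained_delete_back_edge:
  assumes "maintained E \<sigma>" "e \<notin> E \<inter> forward" "E \<subseteq> set as"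
  shows "maintained (E - {e}) \<sigma>" and "alive (E - {e}) = alive E"
proof -
  have F: "(E - {e}) \<inter> forward = E \<inter> forward" using assms(2) by blast
  have avoids: "avoids s (E - {e}) w v \<longleftrightarrow> avoids s E w v" for w v
    using avoids_Int_forward_edges[of E "set as" s w v]
      avoids_Int_forward_edges[of "E - {e}" "set as" s w v]
      assms(3) F by auto
  then show "alive (E - {e}) = alive E" by (simp add: alive_def)
  have "(s, v) \<in> (E - {e})\<^sup>* \<longleftrightarrow> (s, v) \<in> E\<^sup>*" for v
    using avoids[of n v] avoids_n_iff[of E v] avoids_n_iff[of "E - {e}" v] assms(3) by auto
  with avoids assms(1) F show "maintained (E - {e}) \<sigma>"
    by (simp add: maintained_def stores_tree_def idom_among_def)
qed

theorem wp_update: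
  assumes acyclic: "acyclic forward" and E: "E \<subseteq> set as" and uv: "u < n" "v < n"
    and \<sigma>: "maintained E \<sigma>" "bounded_state W \<sigma>"
  shows "wp W update (\<lambda>t \<tau>. t + potential (E - {(u, v)}) \<le>
    potential E + 310 * (n + 1) \<and> maintained (E - {(u, v)}) \<tau>) (request (u, v) \<sigma>)"
proof -
  define \<sigma>1 where "\<sigma>1 = store (request (u, v) \<sigma>) ''queue_end'' 0 0"
  have bounded: "bounded_state W \<sigma>1"
    using \<sigma>(2) uv by (simp add: \<sigma>1_def request_def bounded_state_store)
  then have "frame W {''del_tail'', ''del_head'', ''queue_end''} \<sigma> \<sigma>1"
    by (simp add: frame_def \<sigma>1_def request_def store_apply)
  with \<sigma>(1) have maintained: "maintained E \<sigma>1"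
    by (rule maintained_frame) simp
  have \<sigma>1: "\<sigma>1 ''n'' 0 = n" "\<sigma>1 ''del_tail'' 0 = u" "\<sigma>1 ''del_head'' 0 = v" "\<sigma>1 ''queue_end'' 0 = 0"
    using maintained by (simp_all add: maintained_def inputsD[OF layoutD])
      (simp_all add: \<sigma>1_def request_def store_apply)
  have forward: "\<sigma>1 ''forward'' (u * n + v) = of_bool ((u, v) \<in> E \<inter> forward)"
    using maintained uv stores_setD[of n "\<sigma>1 ''forward''" "E \<inter> forward" u v]
    by (simp add: maintained_def)
  show ?thesis
  proof (cases "(u, v) \<in> E \<inter> forward")
    case True
    from wp_mono_frame[OF wp_delete_forward_edge[OF acyclic E True maintained bounded \<sigma>1(4,2,3)] bounded]
    show ?thesis using True \<sigma>1 uv forward by (simp add: update_def \<sigma>1_def[symmetric])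
  next
    case False
    then have "\<sigma>1 ''forward'' (u * n + v) = 0" using forward by auto
    with maintained_delete_back_edge[OF maintained False E] show ?thesis
      using \<sigma>1 uv by (simp add: update_def potential_def \<sigma>1_def[symmetric])
  qed
qed

end


section \<open>Building the adjacency lists\<close>

definition adj_step :: com where
  "adj_step =
     Seq (Assign ''adj'' (Bin Plus (Bin Times (Cell ''tail'' (Var ''i'')) (Var ''m''))
                                   (Cell ''deg'' (Cell ''tail'' (Var ''i''))))
           (Cell ''head'' (Var ''i'')))
         (Assign ''deg'' (Cell ''tail'' (Var ''i''))
           (Bin Plus (Cell ''deg'' (Cell ''tail'' (Var ''i''))) (Const 1)))"

definition build_adjacency :: com where
  "build_adjacency = for_each_edge adj_step"

lemma writes_build_adjacency [simp]:
  "writes adj_step = {''adj'', ''deg''}"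
  "writes build_adjacency = {''i'', ''adj'', ''deg''}"
  by (auto simp: adj_step_def build_adjacency_def)

context encoded_graph
begin

lemma nth_edge_less: "i < m \<Longrightarrow> fst (as ! i) < n \<and> snd (as ! i) < n"
  using edges_less nth_mem[of i as] by (metis SigmaE fst_conv lessThan_iff snd_conv subsetD)

definition adj_list_upto :: "nat \<Rightarrow> nat \<Rightarrow> nat list" where
  "adj_list_upto k u = map snd (filter (\<lambda>e. fst e = u) (take k as))"

definition stores_adj_lists_upto :: "nat \<Rightarrow> state \<Rightarrow> bool" where
  "stores_adj_lists_upto k \<sigma> \<longleftrightarrow> (\<forall>u<n. \<sigma> ''deg'' u = length (adj_list_upto k u) \<and>
     (\<forall>j<length (adj_list_upto k u). \<sigma> ''adj'' (u * m + j) = adj_list_upto k u ! j))"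

lemma length_adj_list_upto_le: "length (adj_list_upto k u) \<le> k"
  using length_filter_le[of "\<lambda>e. fst e = u" "take k as"] by (simp add: adj_list_upto_def)

lemma adj_list_upto_Suc:
  "k < m \<Longrightarrow> adj_list_upto (Suc k) u =
     adj_list_upto k u @ (if fst (as ! k) = u then [snd (as ! k)] else [])"
  by (simp add: adj_list_upto_def take_Suc_conv_app_nth)

lemma wp_adj_step:
  assumes inv: "stores_adj_lists_upto k \<sigma>" and inputs: "inputs \<sigma>" and k: "k < m" "\<sigma> ''i'' 0 = k"
  shows "wp W adj_step (\<lambda>t \<tau>. t \<le> 30 \<and> stores_adj_lists_upto (Suc k) \<tau>) \<sigma>"
proof -
  obtain u v where edge: "as ! k = (u, v)" by fastforce
  define l where "l = length (adj_list_upto k u)"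
  have uv: "u < n" "v < n" using nth_edge_less[OF k(1)] by (simp_all add: edge)
  have l: "l < m" using length_adj_list_upto_le[of k u] k(1) by (simp add: l_def)
  have \<sigma>: "\<sigma> ''tail'' k = u" "\<sigma> ''head'' k = v" "\<sigma> ''m'' 0 = m" "\<sigma> ''deg'' u = l"
    using inputs inv k(1) uv by (simp_all add: inputs_def edge stores_adj_lists_upto_def l_def)
  have "Suc l < W" "l < W" "k < W" using l k(1) length_fits by linarith+
  then have "wp W adj_step (\<lambda>t \<tau>. t \<le> 30 \<and> \<tau> ''deg'' = (\<sigma> ''deg'')(u := Suc l) \<and>
      \<tau> ''adj'' = (\<sigma> ''adj'')(u * m + l := v)) \<sigma>"
    using k \<sigma> uv l by (simp add: adj_step_def store_apply)
  moreover have "stores_adj_lists_upto (Suc k) \<tau>"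
    if "\<tau> ''deg'' = (\<sigma> ''deg'')(u := Suc l)" "\<tau> ''adj'' = (\<sigma> ''adj'')(u * m + l := v)" for \<tau>
    unfolding stores_adj_lists_upto_def
  proof (intro allI impI conjI)
    fix u' assume u': "u' < n"
    show "\<tau> ''deg'' u' = length (adj_list_upto (Suc k) u')"
      using inv u' that(1)
      by (simp add: stores_adj_lists_upto_def adj_list_upto_Suc[OF k(1)] edge l_def)
    fix j assume j: "j < length (adj_list_upto (Suc k) u')"
    then have "j < m" using length_adj_list_upto_le[of "Suc k" u'] k(1) by linarith
    then show "\<tau> ''adj'' (u' * m + j) = adj_list_upto (Suc k) u' ! j"
      using j inv u' that(2) l row_major_eq_iff[of j m l u' u]
      by (auto simp: stores_adj_lists_upto_def adj_list_upto_Suc[OF k(1)] edge l_def nth_append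
          split: if_splits)
  qed
  ultimately show ?thesis by (elim wp_mono) simp
qed

lemma wp_build_adjacency:
  assumes \<sigma>0: "bounded_state W \<sigma>0" "inputs \<sigma>0" "\<sigma>0 ''deg'' = (\<lambda>_. 0)"
  shows "wp W build_adjacency (\<lambda>t \<tau>. t \<le> 42 * (m + 1) \<and> layout \<tau>) \<sigma>0"
proof -
  have "wp W build_adjacency (\<lambda>t \<tau>. t \<le> (30 + 12) * (m + 1) \<and> stores_adj_lists_upto m \<tau>) \<sigma>0"
    unfolding build_adjacency_def
  proof (rule wp_for_each_edge[where I = stores_adj_lists_upto])
    fix k \<sigma>
    assume k: "k < m" "stores_adj_lists_upto k \<sigma>" "\<sigma> ''i'' 0 = k"
      and frame: "frame W (insert ''i'' (writes adj_step)) \<sigma>0 \<sigma>"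
    have "inputs \<sigma>" using \<sigma>0(2) frame by (rule inputs_frame) simp
    with k show "wp W adj_step (\<lambda>t \<tau>. t \<le> 30 \<and> stores_adj_lists_upto (Suc k) \<tau>) \<sigma>"
      by (intro wp_adj_step)
  qed (use \<sigma>0 in \<open>auto simp: stores_adj_lists_upto_def adj_list_upto_def frame_def\<close>)
  then show ?thesis
    using \<sigma>0(1)
  proof (rule wp_mono_frame)
    fix t \<tau> assume "t \<le> (30 + 12) * (m + 1) \<and> stores_adj_lists_upto m \<tau>"
      and "frame W (writes build_adjacency) \<sigma>0 \<tau>"
    moreover from this(2) have "inputs \<tau>" using \<sigma>0(2) by (auto elim!: inputs_frame)
    ultimately show "t \<le> 42 * (m + 1) \<and> layout \<tau>"
      by (simp add: layout_def stores_adj_lists_upto_def adj_list_upto_def adj_list_def)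
  qed
qed

end


section \<open>Searching all copies\<close>

definition search_step :: com where
  "search_step =
     If (Conj (Neg (Equal (Var ''y'') (Var ''w'')))
              (Equal (Cell ''reached'' (index (Var ''w'') (Var ''y''))) (Const 0)))
       (Seq (Assign ''reached'' (index (Var ''w'') (Var ''y'')) (Const 1)) push)
       Skip"

definition search :: com where
  "search = Seq (Put ''y'' (Var ''s'')) (Seq (for_each_copy search_step) (worklist search_step))"

lemma writes_search_step [simp]:
  "writes search_step = {''reached''} \<union> queue_vars"
  by (auto simp: search_step_def)

lemma writes_search [simp]:
  "writes search = {''w'', ''x'', ''y'', ''j'', ''queue_next'', ''reached''} \<union> queue_vars"
  by (auto simp: search_def)

context encoded_graph
begin

definition search_invariant :: "(nat \<times> nat) set \<Rightarrow> state \<Rightarrow> bool" where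
  "search_invariant S \<sigma> \<longleftrightarrow> distinct (queue \<sigma>) \<and> S \<subseteq> set (queue \<sigma>) \<and> set (queue \<sigma>) \<subseteq> alive (set as) \<and>
     stores_set n (\<sigma> ''reached'') (set (queue \<sigma>))"

lemma search_invariant_frame:
  "search_invariant S \<sigma> \<Longrightarrow> frame W X \<sigma> \<tau> \<Longrightarrow>
   X \<inter> ({''reached''} \<union> queue_vars) = {} \<Longrightarrow> search_invariant S \<tau>"
  using queue_frame[of W X \<sigma> \<tau>] frameD[of W X \<sigma> \<tau> "''reached''"]
  by (auto simp: search_invariant_def)

lemma wp_search_step:
  assumes inv: "search_invariant S \<sigma>" and \<sigma>: "bounded_state W \<sigma>" "\<sigma> ''n'' 0 = n"
    and wy: "\<sigma> ''w'' 0 = w" "\<sigma> ''y'' 0 = y" "(w, y) \<in> cells" "y \<noteq> w \<Longrightarrow> (w, y) \<in> alive (set as)"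
  shows "wp W search_step (\<lambda>t \<tau>. t \<le> 60 \<and> prefix (queue \<sigma>) (queue \<tau>) \<and>
    search_invariant (S \<union> (if y = w then {} else {(w, y)})) \<tau>) \<sigma>"
proof -
  define new where "new \<longleftrightarrow> y \<noteq> w \<and> (w, y) \<notin> set (queue \<sigma>)"
  define \<sigma>1 where "\<sigma>1 = store \<sigma> ''reached'' (w * n + y) 1"
  define \<tau> where "\<tau> = (if new then pushed \<sigma>1 else \<sigma>)"
  have reached: "\<sigma> ''reached'' (w * n + y) = of_bool ((w, y) \<in> set (queue \<sigma>))"
    using inv wy(3) by (auto simp: search_invariant_def stores_setD)
  have "\<sigma> ''queue_end'' 0 + 1 < W"
    using inv alive_subset_cells by (intro queue_end_fits) (auto simp: search_invariant_def)
  then have "wp W search_step (\<lambda>t \<tau>'. t \<le> 60 \<and> \<tau>' = \<tau>) \<sigma>"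
    using \<sigma> wy(1-3) reached
    by (simp add: search_step_def \<tau>_def new_def \<sigma>1_def wp_push store_apply bounded_stateD)
  moreover have queue: "queue \<tau> = queue \<sigma> @ (if new then [(w, y)] else [])"
    using wy by (simp add: \<tau>_def \<sigma>1_def store_apply)
  have "stores_set n (\<tau> ''reached'') (set (queue \<tau>))"
  proof (cases new)
    case True
    then have "\<tau> ''reached'' = (\<sigma> ''reached'')(w * n + y := 1)"
      by (auto simp: \<tau>_def \<sigma>1_def store_apply)
    moreover have "set (queue \<tau>) = insert (w, y) (set (queue \<sigma>))" using True by (simp add: queue)
    ultimately show ?thesis
      using inv wy(3) stores_set_insert[of n "\<sigma> ''reached''" "set (queue \<sigma>)" y w]
      by (simp add: search_invariant_def)
  qed (use inv in \<open>simp add: search_invariant_def \<tau>_def\<close>)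
  then have "search_invariant (S \<union> (if y = w then {} else {(w, y)})) \<tau>"
    using inv wy(4) by (auto simp: search_invariant_def queue new_def)
  ultimately show ?thesis by (elim wp_mono) (simp add: queue)
qed

lemma wp_search_starts:
  assumes \<sigma>0: "bounded_state W \<sigma>0" "inputs \<sigma>0" "\<sigma>0 ''y'' 0 = s" and init: "search_invariant {} \<sigma>0"
  shows "wp W (for_each_copy search_step)
    (\<lambda>t \<tau>. t \<le> 148 * (n + 1) \<and> search_invariant (supported {}) \<tau>) \<sigma>0"
proof -
  define I where "I k = search_invariant {(w, s) |w. w < k \<and> w \<noteq> s}" for k
  have "wp W (for_each_copy search_step) (\<lambda>t \<tau>. t \<le> 2 * (60 + 14) * (n + 1) \<and> I (Suc n) \<tau>) \<sigma>0"
  proof (rule wp_for_each_copy[where I = I])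
    show "I k \<tau>" if "I k \<sigma>" "frame W {''w''} \<sigma> \<tau>" for k \<sigma> \<tau>
      using that unfolding I_def by (rule search_invariant_frame) simp
    fix k \<sigma>
    assume k: "k \<le> n" "I k \<sigma>" "\<sigma> ''w'' 0 = k"
      and frame: "frame W (insert ''w'' (writes search_step)) \<sigma>0 \<sigma>"
    have "\<sigma> ''n'' 0 = n" "\<sigma> ''y'' 0 = s"
      using \<sigma>0(2,3) frameD[OF frame] by (simp_all add: inputs_def)
    moreover have "(k, s) \<in> cells" "s \<noteq> k \<Longrightarrow> (k, s) \<in> alive (set as)"
      using k(1) start_less by (auto simp: alive_def intro: avoids_start)
    ultimately have "wp W search_step (\<lambda>t \<tau>. t \<le> 60 \<and> prefix (queue \<sigma>) (queue \<tau>) \<and>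
        search_invariant ({(w, s) |w. w < k \<and> w \<noteq> s} \<union> (if s = k then {} else {(k, s)})) \<tau>) \<sigma>"
      using k frame_bounded[OF frame] by (intro wp_search_step) (auto simp: I_def)
    moreover have "{(w, s) |w. w < k \<and> w \<noteq> s} \<union> (if s = k then {} else {(k, s)}) =
        {(w, s) |w. w < Suc k \<and> w \<noteq> s}" by (auto simp: less_Suc_eq)
    ultimately show "wp W search_step (\<lambda>t \<tau>. t \<le> 60 \<and> I (Suc k) \<tau>) \<sigma>"
      unfolding I_def by (elim wp_mono) simp
  qed (use \<sigma>0 init in \<open>auto simp: I_def\<close>)
  moreover have "{(w, s) |w. w < Suc n \<and> w \<noteq> s} = supported {}"
    using start_less by (auto simp: supported_def)
  ultimately show ?thesis by (simp add: I_def)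
qed

lemma alive_subset_of_closed:
  assumes "supported (tokens (set as) Q) \<subseteq> Q"
  shows "alive (set as) \<subseteq> Q"
proof -
  have "(w, v) \<in> Q" if "avoids s (set as) w v" "w \<le> n" for w v
    using that(1)
  proof (induction rule: avoids.induct)
    case avoids_start
    then show ?case using assms that(2) start_less by (auto simp: supported_def)
  next
    case (avoids_step x y)
    then have "(w, y) \<in> supported (tokens (set as) Q)"
      using that(2) edges_less by (auto simp: supported_def tokens_def)
    then show ?case using assms by blast
  qed
  then show ?thesis by (auto simp: alive_def)
qed

lemma wp_search_worklist:
  assumes \<sigma>0: "bounded_state W \<sigma>0" "layout \<sigma>0" and init: "search_invariant (supported {}) \<sigma>0"
  shows "wp W (worklist search_step) (\<lambda>t \<tau>. t \<le> 120 * work (alive (set as)) + 10 \<and>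
    set (queue \<tau>) = alive (set as) \<and> distinct (queue \<tau>) \<and>
    stores_set n (\<tau> ''reached'') (alive (set as))) \<sigma>0"
proof -
  interpret worklist_invariant n s W as search_step 60 "\<lambda>D. search_invariant (supported D)" \<sigma>0
  proof unfold_locales
    show "distinct (queue \<sigma>) \<and> set (queue \<sigma>) \<subseteq> cells" if "search_invariant (supported D) \<sigma>" for D \<sigma>
      using that alive_subset_cells by (auto simp: search_invariant_def)
    show "search_invariant (supported D) \<tau>" if "search_invariant (supported D) \<sigma>"
      "frame W worklist_vars \<sigma> \<tau>" for D \<sigma> \<tau>
      using that by (rule search_invariant_frame) simp
  next
    fix D \<sigma> w x y
    assume inv: "search_invariant (supported D) \<sigma>"
      and frame: "frame W (writes (worklist search_step)) \<sigma>0 \<sigma>"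
      and \<sigma>: "layout \<sigma>" "\<sigma> ''w'' 0 = w" "\<sigma> ''y'' 0 = y"
      and entry: "(w, x) \<in> set (queue \<sigma>)" "(x, y) \<in> set as"
    have "(w, x) \<in> alive (set as)" using inv entry(1) by (auto simp: search_invariant_def)
    then have "(w, y) \<in> cells" "y \<noteq> w \<Longrightarrow> (w, y) \<in> alive (set as)"
      using entry(2) edges_less by (auto simp: alive_def intro: avoids_step)
    then have "wp W search_step (\<lambda>t \<tau>. t \<le> 60 \<and> prefix (queue \<sigma>) (queue \<tau>) \<and>
        search_invariant (supported D \<union> (if y = w then {} else {(w, y)})) \<tau>) \<sigma>"
      using inv frame_bounded[OF frame] \<sigma> by (intro wp_search_step) (auto simp: inputsD[OF layoutD])
    moreover have "supported (insert (w, x, y) D) = supported D \<union> (if y = w then {} else {(w, y)})"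
      using \<open>(w, y) \<in> cells\<close> by (auto simp: supported_def)
    ultimately show "wp W search_step (\<lambda>t \<tau>. t \<le> 60 \<and> prefix (queue \<sigma>) (queue \<tau>) \<and>
        search_invariant (supported (insert (w, x, y) D)) \<tau>) \<sigma>" by simp
  qed (use \<sigma>0 init in auto)
  show ?thesis
    using wp_worklist \<sigma>0(1)
  proof (rule wp_mono_frame)
    fix t \<tau> assume post: "t \<le> (60 + 60) * work (set (queue \<tau>)) + 10 \<and>
      search_invariant (supported (tokens (set as) (set (queue \<tau>)))) \<tau>"
    then have "set (queue \<tau>) = alive (set as)"
      using alive_subset_of_closed[of "set (queue \<tau>)"] by (auto simp: search_invariant_def)
    with post show "t \<le> 120 * work (alive (set as)) + 10 \<and> set (queue \<tau>) = alive (set as) \<and>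
      distinct (queue \<tau>) \<and> stores_set n (\<tau> ''reached'') (alive (set as))"
      by (simp add: search_invariant_def)
  qed
qed

lemma wp_search:
  assumes \<sigma>: "bounded_state W \<sigma>" "layout \<sigma>" "\<sigma> ''queue_end'' 0 = 0" "\<sigma> ''reached'' = (\<lambda>_. 0)"
  shows "wp W search (\<lambda>t \<tau>. t \<le> 120 * work (alive (set as)) + 162 * (n + 1) \<and>
    set (queue \<tau>) = alive (set as) \<and> distinct (queue \<tau>) \<and>
    stores_set n (\<tau> ''reached'') (alive (set as))) \<sigma>" (is "wp W _ ?Q \<sigma>")
proof -
  define \<sigma>1 where "\<sigma>1 = store \<sigma> ''y'' 0 s"
  have frame: "frame W {''y''} \<sigma> \<sigma>1" using \<sigma>(1) start_less by (simp add: \<sigma>1_def frame_store)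
  have layout: "layout \<sigma>1" using \<sigma>(2) frame by (rule layout_frame) simp
  have "queue \<sigma>1 = []" using \<sigma>(3) by (simp add: \<sigma>1_def queue_def store_apply)
  then have "search_invariant {} \<sigma>1"
    using \<sigma>(4) by (simp add: search_invariant_def stores_set_empty \<sigma>1_def store_apply)
  then have "wp W (for_each_copy search_step)
      (\<lambda>t \<tau>. t \<le> 148 * (n + 1) \<and> search_invariant (supported {}) \<tau>) \<sigma>1"
    using frame_bounded[OF frame] layoutD[OF layout]
    by (intro wp_search_starts) (simp_all add: \<sigma>1_def store_apply)
  then have
    "wp W (for_each_copy search_step) (\<lambda>t. wp W (worklist search_step) (\<lambda>u. ?Q (4 + (t + u)))) \<sigma>1"
    using frame_bounded[OF frame]
  proof (rule wp_mono_frame)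
    fix t \<sigma>2 assume t: "t \<le> 148 * (n + 1) \<and> search_invariant (supported {}) \<sigma>2"
      and frame2: "frame W (writes (for_each_copy search_step)) \<sigma>1 \<sigma>2"
    have "layout \<sigma>2" using layout frame2 by (rule layout_frame) simp
    from wp_search_worklist[OF frame_bounded[OF frame2] this] t frame_bounded[OF frame2]
    show "wp W (worklist search_step) (\<lambda>u. ?Q (4 + (t + u))) \<sigma>2" by (auto elim!: wp_mono_frame)
  qed
  from wp_mono_frame[OF this frame_bounded[OF frame]] show ?thesis
    using \<sigma>(2) start_less by (simp add: search_def inputsD[OF layoutD] \<sigma>1_def[symmetric])
qed

end


section \<open>Forward edges and counters\<close>

definition forward_step :: com where
  "forward_step =
     Assign ''forward'' (index (Cell ''tail'' (Var ''i'')) (Cell ''head'' (Var ''i'')))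
       (Cell ''reached'' (index (Cell ''head'' (Var ''i'')) (Cell ''tail'' (Var ''i''))))"

definition mark_forward :: com where
  "mark_forward = for_each_edge forward_step"

definition count_start :: com where
  "count_start =
     If (Equal (Var ''w'') (Var ''s'')) Skip (Assign ''count'' (index (Var ''w'') (Var ''s'')) (Const 1))"

definition count_step :: com where
  "count_step =
     If (Conj (Equal (Cell ''forward'' (index (Var ''x'') (Var ''y''))) (Const 1))
              (Neg (Equal (Var ''y'') (Var ''w''))))
       (Assign ''count'' (index (Var ''w'') (Var ''y''))
         (Bin Plus (Cell ''count'' (index (Var ''w'') (Var ''y''))) (Const 1)))
       Skip"

text \<open>The queue of the search lists the alive pairs, so a second pass meets every edge of every copy once.\<close>

definition count_predecessors :: com where
  "count_predecessors = Seq (for_each_copy count_start) (worklist count_step)"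

lemma writes_counting [simp]:
  "writes forward_step = {''forward''}"
  "writes mark_forward = {''i'', ''forward''}"
  "writes count_start = {''count''}"
  "writes count_step = {''count''}"
  "writes count_predecessors = {''w'', ''x'', ''y'', ''j'', ''queue_next'', ''count''}"
  by (auto simp: forward_step_def mark_forward_def count_start_def count_step_def count_predecessors_def)

context encoded_graph
begin

lemma wp_mark_forward:
  assumes \<sigma>0: "bounded_state W \<sigma>0" "inputs \<sigma>0" "\<sigma>0 ''forward'' = (\<lambda>_. 0)"
    and reached: "stores_set n (\<sigma>0 ''reached'') (alive (set as))"
  shows "wp W mark_forward (\<lambda>t \<tau>. t \<le> 42 * (m + 1) \<and>
    stores_set n (\<tau> ''forward'') forward) \<sigma>0"
proof -
  define I where "I k \<sigma> \<longleftrightarrow> stores_set n (\<sigma> ''forward'') (set (take k as) \<inter> forward)"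
    for k and \<sigma> :: state
  have "wp W mark_forward (\<lambda>t \<tau>. t \<le> (30 + 12) * (m + 1) \<and> I m \<tau>) \<sigma>0"
    unfolding mark_forward_def
  proof (rule wp_for_each_edge[where I = I])
    fix k \<sigma>
    assume k: "k < m" "I k \<sigma>" "\<sigma> ''i'' 0 = k"
      and frame: "frame W (insert ''i'' (writes forward_step)) \<sigma>0 \<sigma>"
    obtain u v where edge: "as ! k = (u, v)" by fastforce
    have uv: "u < n" "v < n" "(u, v) \<in> set as"
      using nth_edge_less[OF k(1)] nth_mem[OF k(1)] by (simp_all add: edge)
    have \<sigma>: "\<sigma> ''tail'' k = u" "\<sigma> ''head'' k = v" "\<sigma> ''n'' 0 = n"
      using \<sigma>0(2) frameD[OF frame] k(1) by (simp_all add: inputs_def edge)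
    have "\<sigma> ''reached'' (v * n + u) = of_bool ((v, u) \<in> alive (set as))"
      using frameD[OF frame, of "''reached''"] stores_setD[OF reached] uv by simp
    also have "(v, u) \<in> alive (set as) \<longleftrightarrow> (u, v) \<in> forward"
      using uv by (auto simp: alive_def forward_edges_def)
    finally have cell: "\<sigma> ''reached'' (v * n + u) = of_bool ((u, v) \<in> forward)" .
    have "k < W" using k(1) length_fits by linarith
    then have "wp W forward_step (\<lambda>t \<tau>. t \<le> 30 \<and>
        \<tau> ''forward'' = (\<sigma> ''forward'')(u * n + v := of_bool ((u, v) \<in> forward))) \<sigma>"
      using \<sigma> uv k(3) cell by (simp add: forward_step_def store_apply)
    moreover have "set (take (Suc k) as) = insert (u, v) (set (take k as))"
      using k(1) by (simp add: take_Suc_conv_app_nth edge)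
    then have
      "stores_set n ((\<sigma> ''forward'')(u * n + v := of_bool ((u, v) \<in> forward)))
        (set (take (Suc k) as) \<inter> forward)"
      using stores_set_insert[OF k(2)[unfolded I_def] uv(2), of u]
        stores_set_remove[OF k(2)[unfolded I_def] uv(2), of u]
      by (cases "(u, v) \<in> forward") (simp_all add: insert_Diff_if Int_insert_left)
    ultimately show "wp W forward_step (\<lambda>t \<tau>. t \<le> 30 \<and> I (Suc k) \<tau>) \<sigma>"
      by (elim wp_mono) (simp add: I_def)
  qed (use \<sigma>0 in \<open>auto simp: I_def stores_set_empty frame_def\<close>)
  moreover have "set as \<inter> forward = forward" using forward_edges_subset by fast
  ultimately show ?thesis by (simp add: I_def)
qed

lemma token_count_insert:
  assumes "finite P" "(w, x, y) \<notin> P" "y \<noteq> s" "y \<noteq> w"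
  shows "token_count (insert (w, x, y) P) = (token_count P)((w, y) := token_count P (w, y) + 1)"
proof -
  have "token_count P =
    (token_count (insert (w, x, y) P))((w, y) := token_count (insert (w, x, y) P) (w, y) - 1)"
    using token_count_Diff[of "insert (w, x, y) P" w x y] assms by simp
  moreover have "token_count (insert (w, x, y) P) (w, y) \<noteq> 0"
    using assms finite_token_tails[of "insert (w, x, y) P" w y]
    by (auto simp: token_count_def card_eq_0_iff)
  ultimately show ?thesis
    by (metis Suc_diff_1 Suc_eq_plus1 fun_upd_same fun_upd_triv fun_upd_upd neq0_conv)
qed

lemma token_count_insert_self: "token_count (insert (w, x, w) P) = token_count P"
  by (auto simp: token_count_def fun_eq_iff intro!: arg_cong[of _ _ card])

lemma wp_count_starts:
  assumes \<sigma>0: "bounded_state W \<sigma>0" "inputs \<sigma>0" "\<sigma>0 ''count'' = (\<lambda>_. 0)"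
  shows "wp W (for_each_copy count_start)
    (\<lambda>t \<tau>. t \<le> 88 * (n + 1) \<and> stores_counts (\<tau> ''count'') {}) \<sigma>0"
proof -
  define f where "f k = (\<lambda>(w, y). if w < k \<and> w \<noteq> s \<and> y = s then 1 else 0 :: nat)" for k
  define I where "I k \<sigma> \<longleftrightarrow> stores_matrix n (\<sigma> ''count'') (f k)" for k and \<sigma> :: state
  have "wp W (for_each_copy count_start) (\<lambda>t \<tau>. t \<le> 2 * (30 + 14) * (n + 1) \<and> I (Suc n) \<tau>) \<sigma>0"
  proof (rule wp_for_each_copy[where I = I])
    fix k \<sigma>
    assume k: "k \<le> n" "I k \<sigma>" "\<sigma> ''w'' 0 = k"
      and frame: "frame W (insert ''w'' (writes count_start)) \<sigma>0 \<sigma>"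
    have "\<sigma> ''n'' 0 = n" "\<sigma> ''s'' 0 = s" using \<sigma>0(2) frameD[OF frame] by (simp_all add: inputs_def)
    then have "wp W count_start (\<lambda>t \<tau>. t \<le> 30 \<and>
        \<tau> ''count'' = (if k = s then \<sigma> ''count'' else (\<sigma> ''count'')(k * n + s := 1))) \<sigma>"
      using k start_less by (simp add: count_start_def store_apply)
    moreover have "f (Suc k) = (if k = s then f k else (f k)((k, s) := 1))"
      by (auto simp: f_def fun_eq_iff less_Suc_eq)
    ultimately show "wp W count_start (\<lambda>t \<tau>. t \<le> 30 \<and> I (Suc k) \<tau>) \<sigma>"
      using k(2) start_less by (elim wp_mono) (auto simp: I_def intro: stores_matrix_upd)
  qed (use \<sigma>0 in \<open>auto simp: I_def f_def stores_matrix_def frame_def\<close>)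
  moreover have "I (Suc n) \<tau> \<longleftrightarrow> stores_counts (\<tau> ''count'') {}" for \<tau>
    unfolding I_def stores_counts_def
    by (rule stores_matrix_cong) (auto simp: f_def token_count_def)
  ultimately show ?thesis by simp
qed

lemma wp_count_step:
  assumes count: "stores_counts (\<sigma> ''count'') (D \<inter> tokens forward cells)"
    and forward: "stores_set n (\<sigma> ''forward'') forward"
    and \<sigma>: "bounded_state W \<sigma>" "\<sigma> ''n'' 0 = n" "\<sigma> ''w'' 0 = w" "\<sigma> ''x'' 0 = x" "\<sigma> ''y'' 0 = y"
    and token: "(w, x) \<in> cells" "y < n" "(w, x, y) \<notin> D"
  shows "wp W count_step (\<lambda>t \<tau>. t \<le> 50 \<and>
    stores_counts (\<tau> ''count'') (insert (w, x, y) D \<inter> tokens forward cells)) \<sigma>"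
proof -
  define P where "P = D \<inter> tokens forward cells"
  have P: "finite P" "(w, x, y) \<notin> P" using finite_tokens[of P] token(3) by (auto simp: P_def)
  have test: "\<sigma> ''forward'' (x * n + y) = of_bool ((x, y) \<in> forward)"
    using stores_setD[OF forward] token by simp
  show ?thesis
  proof (cases "(x, y) \<in> forward \<and> y \<noteq> w")
    case True
    then have "y \<noteq> s" using forward_bounds by blast
    have insert: "insert (w, x, y) D \<inter> tokens forward cells = insert (w, x, y) P"
      using True token by (auto simp: P_def tokens_def)
    have cell: "\<sigma> ''count'' (w * n + y) = token_count P (w, y)"
      using stores_countsD[OF count] token by (simp add: P_def)
    have "card {x. (w, x, y) \<in> P} \<le> card {..<n}"
      using forward_bounds by (intro card_mono) (auto simp: P_def tokens_def)
    then have "token_count P (w, y) \<le> n" using True \<open>y \<noteq> s\<close> by (simp add: token_count_def)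
    then have "Suc (token_count P (w, y)) < W" using Suc_n_fits by linarith
    then have "wp W count_step (\<lambda>t \<tau>. t \<le> 50 \<and>
        \<tau> ''count'' = (\<sigma> ''count'')(w * n + y := token_count P (w, y) + 1)) \<sigma>"
      using True \<sigma> token test cell by (simp add: count_step_def store_apply)
    moreover have "stores_counts ((\<sigma> ''count'')(w * n + y := token_count P (w, y) + 1))
        (insert (w, x, y) P)"
      using count token True token_count_insert[OF P \<open>y \<noteq> s\<close>]
      by (simp add: P_def[symmetric] stores_counts_def stores_matrix_upd)
    ultimately show ?thesis by (elim wp_mono) (simp add: insert)
  next
    case False
    have "insert (w, x, y) D \<inter> tokens forward cells = (if (x, y) \<in> forward then insert (w, x, y) P else P)"
      using token(1) by (auto simp: P_def tokens_def)
    then have "token_count (insert (w, x, y) D \<inter> tokens forward cells) = token_count P"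
      using False token_count_insert_self[of w x P] by auto
    then have "stores_counts (\<sigma> ''count'') (insert (w, x, y) D \<inter> tokens forward cells)"
      using count by (simp add: stores_counts_def P_def)
    then show ?thesis using False \<sigma> token test by (auto simp: count_step_def)
  qed
qed

lemma wp_count_worklist:
  assumes \<sigma>0: "bounded_state W \<sigma>0" "layout \<sigma>0" "stores_counts (\<sigma>0 ''count'') {}"
    and visited: "distinct (queue \<sigma>0)" "set (queue \<sigma>0) = alive (set as)"
    and forward: "stores_set n (\<sigma>0 ''forward'') forward"
  shows "wp W (worklist count_step) (\<lambda>t \<tau>. t \<le> 110 * work (alive (set as)) + 10 \<and>
    stores_counts (\<tau> ''count'') (live_tokens forward)) \<sigma>0"
proof -
  define I where "I D \<sigma> \<longleftrightarrow> queue \<sigma> = queue \<sigma>0 \<and>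
    stores_counts (\<sigma> ''count'') (D \<inter> tokens forward cells)" for D and \<sigma> :: state
  interpret worklist_invariant n s W as count_step 50 I \<sigma>0
  proof unfold_locales
    show "distinct (queue \<sigma>) \<and> set (queue \<sigma>) \<subseteq> cells" if "I D \<sigma>" for D \<sigma>
      using that visited alive_subset_cells by (simp add: I_def)
    show "I D \<tau>" if "I D \<sigma>" "frame W worklist_vars \<sigma> \<tau>" for D \<sigma> \<tau>
      using that(1) queue_frame[OF that(2)] frameD[OF that(2)] by (simp add: I_def)
  next
    fix D \<sigma> w x y
    assume I: "I D \<sigma>" and frame: "frame W (writes (worklist count_step)) \<sigma>0 \<sigma>"
      and \<sigma>: "layout \<sigma>" "\<sigma> ''w'' 0 = w" "\<sigma> ''x'' 0 = x" "\<sigma> ''y'' 0 = y"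
      and token: "(w, x) \<in> set (queue \<sigma>)" "(x, y) \<in> set as" "(w, x, y) \<notin> D"
    note bounded = frame_bounded[OF frame]
    have "(w, x) \<in> cells" using I token(1) visited(2) alive_subset_cells by (auto simp: I_def)
    moreover have "y < n" using token(2) edges_less by auto
    moreover have "stores_set n (\<sigma> ''forward'') forward"
      using forward frameD[OF frame] by simp
    ultimately have "wp W count_step (\<lambda>t \<tau>. t \<le> 50 \<and>
        stores_counts (\<tau> ''count'') (insert (w, x, y) D \<inter> tokens forward cells)) \<sigma>"
      using I \<sigma> token(3) bounded by (intro wp_count_step) (auto simp: I_def inputsD[OF layoutD])
    then show
      "wp W count_step (\<lambda>t \<tau>. t \<le> 50 \<and> prefix (queue \<sigma>) (queue \<tau>) \<and> I (insert (w, x, y) D) \<tau>) \<sigma>"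
      using bounded by (rule wp_mono_frame) (use I queue_frame in \<open>auto simp: I_def\<close>)
  qed (use \<sigma>0 in \<open>auto simp: I_def \<close>)
  have "tokens (set as) (alive (set as)) \<inter> tokens forward cells = live_tokens forward"
    using alive_subset_cells forward_edges_subset[of s "set as"] alive_Int_forward[of "set as"]
    by (auto simp: live_tokens_def tokens_def Int_absorb1)
  with visited(2) wp_worklist show ?thesis by (elim wp_mono) (auto simp: I_def)
qed

lemma wp_count_predecessors:
  assumes \<sigma>: "bounded_state W \<sigma>" "layout \<sigma>" "\<sigma> ''count'' = (\<lambda>_. 0)"
    and visited: "distinct (queue \<sigma>)" "set (queue \<sigma>) = alive (set as)"
    and forward: "stores_set n (\<sigma> ''forward'') forward"
  shows "wp W count_predecessors (\<lambda>t \<tau>. t \<le> 110 * work (alive (set as)) + 98 * (n + 1) \<and>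
    stores_counts (\<tau> ''count'') (live_tokens forward)) \<sigma>" (is "wp W _ ?Q \<sigma>")
proof -
  have "wp W (for_each_copy count_start) (\<lambda>t. wp W (worklist count_step) (\<lambda>u. ?Q (t + u))) \<sigma>"
    using wp_count_starts[OF \<sigma>(1) layoutD[OF \<sigma>(2)] \<sigma>(3)] \<sigma>(1)
  proof (rule wp_mono_frame)
    fix t \<sigma>1 assume t: "t \<le> 88 * (n + 1) \<and> stores_counts (\<sigma>1 ''count'') {}"
      and frame: "frame W (writes (for_each_copy count_start)) \<sigma> \<sigma>1"
    have "layout \<sigma>1" using \<sigma>(2) frame by (rule layout_frame) simp
    moreover have "queue \<sigma>1 = queue \<sigma>" using frame by (rule queue_frame) simp
    ultimately have "wp W (worklist count_step) (\<lambda>t \<tau>. t \<le> 110 * work (alive (set as)) + 10 \<and>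
        stores_counts (\<tau> ''count'') (live_tokens forward)) \<sigma>1"
      using t frame_bounded[OF frame] visited forward frameD[OF frame]
      by (intro wp_count_worklist) simp_all
    then show "wp W (worklist count_step) (\<lambda>u. ?Q (t + u)) \<sigma>1" by (rule wp_mono) (use t in auto)
  qed
  then show ?thesis by (simp only: count_predecessors_def wp_Seq)
qed

end


section \<open>The initial tree\<close>

definition tree_step :: com where
  "tree_step =
     If (Conj (Neg (Equal (Var ''w'') (Var ''v'')))
        (Conj (Equal (Cell ''reached'' (index (Var ''w'') (Var ''v''))) (Const 0))
              (Equal (Cell ''reached'' (index (Cell ''parent'' (Var ''v'')) (Var ''w''))) (Const 0))))
       (Assign ''parent'' (Var ''v'') (Var ''w''))
       Skip"

definition find_parent :: com where
  "find_parent = Seq (Assign ''parent'' (Var ''v'') (Var ''s'')) (For ''w'' (Var ''n'') tree_step)"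

definition add_to_tree :: com where
  "add_to_tree =
     Seq (Assign ''in_tree'' (Var ''v'') (Cell ''reached'' (index (Var ''n'') (Var ''v''))))
         (If (Equal (Cell ''in_tree'' (Var ''v'')) (Const 1)) find_parent Skip)"

definition build_tree :: com where
  "build_tree = For ''v'' (Var ''n'') add_to_tree"

lemma writes_build_tree [simp]:
  "writes tree_step = {''parent''}"
  "writes find_parent = {''parent'', ''w''}"
  "writes add_to_tree = {''in_tree'', ''parent'', ''w''}"
  "writes build_tree = {''v'', ''in_tree'', ''parent'', ''w''}"
  by (auto simp: tree_step_def find_parent_def add_to_tree_def build_tree_def)

context encoded_graph
begin

lemma wp_tree_step:
  assumes reached: "stores_set n (\<sigma> ''reached'') (alive (set as))"
    and \<sigma>: "\<sigma> ''n'' 0 = n" "\<sigma> ''v'' 0 = v" "\<sigma> ''w'' 0 = w" "\<sigma> ''parent'' v < n"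
    and vw: "v < n" "w < n" "(s, v) \<in> (set as)\<^sup>*"
    and idom: "v \<noteq> s \<Longrightarrow> idom_among s (set as) {..<w} (\<sigma> ''parent'' v) v"
  shows "wp W tree_step (\<lambda>t \<tau>. t \<le> 50 \<and> (\<exists>p<n. \<tau> ''parent'' = (\<sigma> ''parent'')(v := p) \<and>
    (v \<noteq> s \<longrightarrow> idom_among s (set as) {..<Suc w} p v))) \<sigma>"
proof -
  define p where "p = \<sigma> ''parent'' v"
  define dominator where "dominator \<longleftrightarrow> w \<noteq> v \<and> \<not> avoids s (set as) w v"
  define q where "q = (if dominator \<and> \<not> avoids s (set as) p w then w else p)"
  have test: "\<sigma> ''reached'' (w * n + v) = of_bool (avoids s (set as) w v)"
      "\<sigma> ''reached'' (p * n + w) = of_bool (avoids s (set as) p w)"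
    using stores_setD[OF reached] \<sigma>(4) vw by (simp_all add: alive_def p_def)
  have "wp W tree_step (\<lambda>t \<tau>. t \<le> 50 \<and> \<tau> ''parent'' = (\<sigma> ''parent'')(v := q)) \<sigma>"
    using \<sigma> vw test by (simp add: tree_step_def store_apply p_def[symmetric] q_def dominator_def)
      (simp add: p_def)
  moreover have "q < n" using \<sigma>(4) vw(2) by (simp add: q_def p_def)
  moreover have "idom_among s (set as) {..<Suc w} q v" if "v \<noteq> s"
  proof (cases dominator)
    case True
    then show ?thesis
      using idom_among_insert[OF idom[OF that] vw(3), of w]
      by (auto simp: q_def p_def dominator_def lessThan_Suc)
  next
    case False
    then show ?thesis
      using idom_among_insert_irrelevant[OF idom[OF that], of w]
      by (auto simp: q_def p_def dominator_def lessThan_Suc)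
  qed
  ultimately show ?thesis by (elim wp_mono) blast
qed

lemma wp_find_parent:
  assumes \<sigma>0: "bounded_state W \<sigma>0" "inputs \<sigma>0" "\<sigma>0 ''v'' 0 = v"
    and v: "v < n" "(s, v) \<in> (set as)\<^sup>*"
    and reached: "stores_set n (\<sigma>0 ''reached'') (alive (set as))"
  shows "wp W find_parent (\<lambda>t \<tau>. t \<le> 70 * (n + 1) \<and> (\<exists>p<n. \<tau> ''parent'' = (\<sigma>0 ''parent'')(v := p) \<and>
    (v \<noteq> s \<longrightarrow> idom_among s (set as) {..<n} p v))) \<sigma>0"
proof -
  define \<sigma>1 where "\<sigma>1 = store \<sigma>0 ''parent'' v s"
  have frame: "frame W {''parent''} \<sigma>0 \<sigma>1" using \<sigma>0(1) start_less by (simp add: \<sigma>1_def frame_store)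
  define I where "I k \<tau> \<longleftrightarrow> (\<exists>p<n. \<tau> ''parent'' = (\<sigma>0 ''parent'')(v := p) \<and>
    (v \<noteq> s \<longrightarrow> idom_among s (set as) {..<k} p v))" for k and \<tau> :: state
  have "wp W (For ''w'' (Var ''n'') tree_step)
    (\<lambda>t \<tau>. t \<le> (50 + expr_cost (Var ''n'') + 10) * (n + 1) \<and> I n \<tau>) \<sigma>1"
  proof (rule wp_For_uniform[where I = I])
    show "bounded_state W \<sigma>1" using frame by (rule frame_bounded)
    show "I 0 \<sigma>1" using start_less idom_among_start[of v s]
      by (auto simp: I_def \<sigma>1_def store_apply intro!: exI[of _ s])
    fix k \<sigma>
    assume k: "k < n" "I k \<sigma>" "\<sigma> ''w'' 0 = k"
      and loop: "frame W (insert ''w'' (writes tree_step)) \<sigma>1 \<sigma>"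
    have frame': "frame W {''parent'', ''w''} \<sigma>0 \<sigma>" using frame loop by (rule frame_trans) simp
    have \<sigma>: "\<sigma> ''n'' 0 = n" "\<sigma> ''v'' 0 = v" "\<sigma> ''reached'' = \<sigma>0 ''reached''"
      using \<sigma>0(2,3) frameD[OF frame'] by (simp_all add: inputs_def)
    obtain p where p: "p < n" "\<sigma> ''parent'' = (\<sigma>0 ''parent'')(v := p)"
        "v \<noteq> s \<longrightarrow> idom_among s (set as) {..<k} p v"
      using k(2) by (auto simp: I_def)
    then have "wp W tree_step (\<lambda>t \<tau>. t \<le> 50 \<and> (\<exists>p<n. \<tau> ''parent'' = (\<sigma> ''parent'')(v := p) \<and>
        (v \<noteq> s \<longrightarrow> idom_among s (set as) {..<Suc k} p v))) \<sigma>"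
      using \<sigma> v reached k(1,3) by (intro wp_tree_step) simp_all
    then show "wp W tree_step (\<lambda>t \<tau>. t \<le> 50 \<and> I (Suc k) \<tau>) \<sigma>"
      by (rule wp_mono) (simp add: I_def p(2))
  qed (use \<sigma>0 in \<open>auto simp: I_def \<sigma>1_def inputs_def store_apply frame_def\<close>)
  then have "wp W (For ''w'' (Var ''n'') tree_step) (\<lambda>t \<tau>. 5 + t \<le> 70 * (n + 1) \<and> I n \<tau>) \<sigma>1"
    by (rule wp_mono) auto
  then show ?thesis
    using \<sigma>0 v(1) start_less by (simp add: find_parent_def \<sigma>1_def[symmetric] I_def inputs_def)
qed

lemma wp_add_to_tree:
  assumes \<sigma>: "bounded_state W \<sigma>" "inputs \<sigma>" "\<sigma> ''v'' 0 = v" "v < n"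
    and reached: "stores_set n (\<sigma> ''reached'') (alive (set as))"
  shows "wp W add_to_tree (\<lambda>t \<tau>. t \<le> 30 + (if (s, v) \<in> (set as)\<^sup>* then 70 * (n + 1) else 0) \<and>
    \<tau> ''in_tree'' = (\<sigma> ''in_tree'')(v := of_bool ((s, v) \<in> (set as)\<^sup>*)) \<and>
    (if (s, v) \<in> (set as)\<^sup>* then \<exists>p<n. \<tau> ''parent'' = (\<sigma> ''parent'')(v := p) \<and>
       (v \<noteq> s \<longrightarrow> idom_among s (set as) {..<n} p v)
     else \<tau> ''parent'' = \<sigma> ''parent'')) \<sigma>" (is "wp W _ ?Q \<sigma>")
proof -
  define \<sigma>1 where "\<sigma>1 = store \<sigma> ''in_tree'' v (of_bool ((s, v) \<in> (set as)\<^sup>*))"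
  have frame: "frame W {''in_tree''} \<sigma> \<sigma>1" using \<sigma>(1) by (simp add: \<sigma>1_def frame_store)
  have cell: "\<sigma> ''reached'' (n * n + v) = of_bool ((s, v) \<in> (set as)\<^sup>*)"
    using stores_setD[OF reached _ \<sigma>(4), of n] \<sigma>(4) by (simp add: alive_def avoids_n_iff)
  have \<sigma>1: "\<sigma>1 ''v'' 0 = v" "\<sigma>1 ''in_tree'' v = of_bool ((s, v) \<in> (set as)\<^sup>*)"
    using \<sigma>(3) by (simp_all add: \<sigma>1_def store_apply)
  show ?thesis
  proof (cases "(s, v) \<in> (set as)\<^sup>*")
    case True
    have inputs: "inputs \<sigma>1" using \<sigma>(2) frame by (rule inputs_frame) simp
    have reached1: "stores_set n (\<sigma>1 ''reached'') (alive (set as))"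
      using reached frameD[OF frame] by simp
    from wp_mono_frame[OF wp_find_parent[OF frame_bounded[OF frame] inputs \<sigma>1(1) \<sigma>(4) True reached1]
        frame_bounded[OF frame]]
    have "wp W find_parent (\<lambda>t. ?Q (18 + t)) \<sigma>1"
      using True by (simp add: frame_def) (simp add: \<sigma>1_def store_apply)
    moreover have "store \<sigma> ''in_tree'' v (Suc 0) = \<sigma>1" using True by (simp add: \<sigma>1_def)
    ultimately show ?thesis using True \<sigma> \<sigma>1 cell by (simp add: add_to_tree_def inputs_def)
  next
    case False
    then show ?thesis using \<sigma> cell by (simp add: add_to_tree_def inputs_def store_apply)
  qed
qed

definition stores_tree_upto :: "nat \<Rightarrow> state \<Rightarrow> bool" where
  "stores_tree_upto k \<sigma> \<longleftrightarrow> (\<forall>v<n. \<sigma> ''parent'' v < n) \<and>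
     (\<forall>v<k. (\<sigma> ''in_tree'' v \<noteq> 0 \<longleftrightarrow> (s, v) \<in> (set as)\<^sup>*) \<and>
       (v \<noteq> s \<and> (s, v) \<in> (set as)\<^sup>* \<longrightarrow> idom_among s (set as) {..<n} (\<sigma> ''parent'' v) v))"

lemma sum_reachable_le:
  "(\<Sum>v<n. if (s, v) \<in> (set as)\<^sup>* then c else 0) \<le> (m + 1) * c" for c :: nat
proof -
  have "card {v \<in> {..<n}. (s, v) \<in> (set as)\<^sup>*} \<le> card {v. (s, v) \<in> (set as)\<^sup>*}"
    by (rule card_mono) (auto intro: finite_rtrancl_Image)
  also have "\<dots> \<le> m + 1" using card_rtrancl_Image_le[of "set as" s] card_length[of as] by simp
  finally have "card {v \<in> {..<n}. (s, v) \<in> (set as)\<^sup>*} * c \<le> (m + 1) * c" by (rule mult_le_mono1)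
  then show ?thesis by (simp add: sum.If_cases Int_def)
qed

lemma wp_build_tree:
  assumes \<sigma>0: "bounded_state W \<sigma>0" "inputs \<sigma>0" "\<sigma>0 ''parent'' = (\<lambda>_. 0)"
    and reached: "stores_set n (\<sigma>0 ''reached'') (alive (set as))"
  shows "wp W build_tree (\<lambda>t \<tau>. t \<le> 120 * ((n + 1) * (m + 1)) \<and> stores_tree (set as) \<tau>) \<sigma>0"
proof -
  define B where "B v = 30 + (if (s, v) \<in> (set as)\<^sup>* then 70 * (n + 1) else 0)" for v
  have "wp W build_tree (\<lambda>t \<tau>. t \<le> (\<Sum>v<n. B v + (expr_cost (Var ''n'') + 10)) + (expr_cost (Var ''n'') + 10) \<and>
      stores_tree_upto n \<tau>) \<sigma>0"
    unfolding build_tree_def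
  proof (rule wp_For[where I = stores_tree_upto])
    fix k \<sigma>
    assume k: "k < n" "stores_tree_upto k \<sigma>" "\<sigma> ''v'' 0 = k"
      and frame: "frame W (insert ''v'' (writes add_to_tree)) \<sigma>0 \<sigma>"
    have inputs: "inputs \<sigma>" using \<sigma>0(2) frame by (rule inputs_frame) simp
    have "stores_set n (\<sigma> ''reached'') (alive (set as))"
      using reached frameD[OF frame] by simp
    from wp_add_to_tree[OF frame_bounded[OF frame] inputs k(3,1) this]
    show "wp W add_to_tree (\<lambda>t \<tau>. t \<le> B k \<and> stores_tree_upto (Suc k) \<tau>) \<sigma>"
      by (rule wp_mono) (use k(2) in \<open>auto simp: B_def stores_tree_upto_def less_Suc_eq split: if_splits\<close>)
  qed (use \<sigma>0 start_less in \<open>auto simp: stores_tree_upto_def inputs_def frame_def\<close>)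
  then show ?thesis
  proof (rule wp_mono)
    fix t \<tau>
    assume post:
      "t \<le> (\<Sum>v<n. B v + (expr_cost (Var ''n'') + 10)) + (expr_cost (Var ''n'') + 10) \<and> stores_tree_upto n \<tau>"
    have "(\<Sum>v<n. B v + 12) + 12 \<le> 42 * n + (m + 1) * (70 * (n + 1)) + 12"
      using sum_reachable_le[of "70 * (n + 1)"] by (simp add: B_def sum.distrib)
    also have "\<dots> \<le> 120 * ((n + 1) * (m + 1))" by (simp add: algebra_simps)
    finally show "t \<le> 120 * ((n + 1) * (m + 1)) \<and> stores_tree (set as) \<tau>"
      using post by (simp add: stores_tree_upto_def stores_tree_def)
  qed
qed

end


section \<open>Initialisation\<close>

definition explore :: com where
  "explore = Seq build_adjacency search"

definition set_up_counters :: com where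
  "set_up_counters = Seq mark_forward count_predecessors"

definition initialise :: com where
  "initialise = Seq explore (Seq set_up_counters build_tree)"

lemma writes_initialise [simp]:
  "writes explore =
     {''i'', ''adj'', ''deg'', ''w'', ''x'', ''y'', ''j'', ''queue_next'', ''reached''} \<union> queue_vars"
  "writes set_up_counters = {''i'', ''forward'', ''w'', ''x'', ''y'', ''j'', ''queue_next'', ''count''}"
  by (auto simp: explore_def set_up_counters_def)

context encoded_graph
begin

lemma sum_length_adj_list_le: "(\<Sum>x<n. length (adj_list x)) \<le> m"
proof -
  have "length (adj_list x) = card {y. (x, y) \<in> set as}" for x
    using distinct_card[OF distinct_adj_list[of x]] by (simp add: set_adj_list)
  moreover have "finite {y. (x, y) \<in> set as}" for x
    by (rule finite_subset[of _ "snd ` set as"]) force+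
  ultimately have "(\<Sum>x<n. length (adj_list x)) = card (SIGMA x:{..<n}. {y. (x, y) \<in> set as})"
    by simp
  also have "\<dots> \<le> card (set as)" by (rule card_mono) auto
  also have "\<dots> \<le> m" by (rule card_length)
  finally show ?thesis .
qed

lemma work_alive_le:
  assumes "E \<subseteq> set as"
  shows "work (alive E) \<le> 2 * ((n + 1) * (m + 1))"
proof -
  have row: "(\<Sum>x | x < n \<and> avoids s E w x. 1 + length (adj_list x)) \<le> 2 * (m + 1)" for w
  proof -
    have "finite E" using assms by (rule finite_subset) simp
    then have "card {x. x < n \<and> avoids s E w x} \<le> card {x. (s, x) \<in> E\<^sup>*}"
      by (intro card_mono finite_rtrancl_Image) (auto dest: avoids_imp_rtrancl)
    also have "\<dots> \<le> card E + 1" using \<open>finite E\<close> by (rule card_rtrancl_Image_le)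
    also have "card E \<le> m" using card_mono[OF _ assms] card_length[of as] by simp
    finally have "card {x. x < n \<and> avoids s E w x} \<le> m + 1" by simp
    moreover have "(\<Sum>x | x < n \<and> avoids s E w x. length (adj_list x)) \<le> (\<Sum>x<n. length (adj_list x))"
      by (rule sum_mono2) auto
    ultimately show ?thesis unfolding sum.distrib using sum_length_adj_list_le by simp
  qed
  have "work (alive E) = (\<Sum>p\<in>(SIGMA w:{..n}. {x. x < n \<and> avoids s E w x}). 1 + length (adj_list (snd p)))"
    unfolding work_def by (rule sum.cong) (auto simp: alive_def)
  also have "\<dots> = (\<Sum>w\<le>n. \<Sum>x | x < n \<and> avoids s E w x. 1 + length (adj_list x))"
    by (subst sum.Sigma) (auto intro!: sum.cong)
  also have "\<dots> \<le> (\<Sum>w\<le>n. 2 * (m + 1))" by (rule sum_mono) (rule row)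
  finally show ?thesis by (simp add: algebra_simps)
qed

lemma bounded_input_state: "bounded_state W (input_state n s as)"
  using nth_edge_less start_less by (simp add: bounded_state_def input_state_def less_imp_le)

lemma inputs_input_state: "inputs (input_state n s as)"
  by (simp add: inputs_def input_state_def)

lemma wp_explore:
  assumes \<sigma>: "bounded_state W \<sigma>" "inputs \<sigma>"
    and zero: "\<sigma> ''deg'' = (\<lambda>_. 0)" "\<sigma> ''reached'' = (\<lambda>_. 0)" "\<sigma> ''queue_end'' 0 = 0"
  shows "wp W explore (\<lambda>t \<tau>. t \<le> 450 * ((n + 1) * (m + 1)) \<and> layout \<tau> \<and> set (queue \<tau>) = alive (set as) \<and>
    distinct (queue \<tau>) \<and> stores_set n (\<tau> ''reached'') (alive (set as))) \<sigma>" (is "wp W _ ?Q \<sigma>")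
proof -
  have "wp W build_adjacency (\<lambda>t. wp W search (\<lambda>u. ?Q (t + u))) \<sigma>"
    using wp_build_adjacency[OF \<sigma> zero(1)] \<sigma>(1)
  proof (rule wp_mono_frame)
    fix t \<sigma>' assume t: "t \<le> 42 * (m + 1) \<and> layout \<sigma>'"
      and frame: "frame W (writes build_adjacency) \<sigma> \<sigma>'"
    note bounded = frame_bounded[OF frame]
    have "\<sigma>' ''queue_end'' 0 = 0" "\<sigma>' ''reached'' = (\<lambda>_. 0)" using zero frameD[OF frame] by simp_all
    from wp_search[OF bounded conjunct2[OF t] this] bounded show "wp W search (\<lambda>u. ?Q (t + u)) \<sigma>'"
    proof (rule wp_mono_frame)
      fix u \<tau> assume u: "u \<le> 120 * work (alive (set as)) + 162 * (n + 1) \<and> set (queue \<tau>) = alive (set as) \<and>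
          distinct (queue \<tau>) \<and> stores_set n (\<tau> ''reached'') (alive (set as))"
        and frame': "frame W (writes search) \<sigma>' \<tau>"
      have "layout \<tau>" using t frame' by (auto elim!: layout_frame)
      moreover have "t + u \<le> 450 * ((n + 1) * (m + 1))"
        using t u work_alive_le[of "set as"] by (simp add: algebra_simps)
      ultimately show "?Q (t + u) \<tau>" using u by blast
    qed
  qed
  then show ?thesis by (simp only: explore_def wp_Seq)
qed

lemma wp_set_up_counters:
  assumes \<sigma>: "bounded_state W \<sigma>" "layout \<sigma>"
    and zero: "\<sigma> ''forward'' = (\<lambda>_. 0)" "\<sigma> ''count'' = (\<lambda>_. 0)"
    and visited: "distinct (queue \<sigma>)" "set (queue \<sigma>) = alive (set as)"
    and reached: "stores_set n (\<sigma> ''reached'') (alive (set as))"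
  shows "wp W set_up_counters (\<lambda>t \<tau>. t \<le> 370 * ((n + 1) * (m + 1)) \<and>
    stores_set n (\<tau> ''forward'') forward \<and> stores_counts (\<tau> ''count'') (live_tokens forward)) \<sigma>"
    (is "wp W _ ?Q \<sigma>")
proof -
  have "wp W mark_forward (\<lambda>t. wp W count_predecessors (\<lambda>u. ?Q (t + u))) \<sigma>"
    using wp_mark_forward[OF \<sigma>(1) layoutD[OF \<sigma>(2)] zero(1) reached] \<sigma>(1)
  proof (rule wp_mono_frame)
    fix t \<sigma>' assume t: "t \<le> 42 * (m + 1) \<and> stores_set n (\<sigma>' ''forward'') forward"
      and frame: "frame W (writes mark_forward) \<sigma> \<sigma>'"
    note bounded = frame_bounded[OF frame]
    have "layout \<sigma>'" using \<sigma>(2) frame by (rule layout_frame) simp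
    moreover have "queue \<sigma>' = queue \<sigma>" using frame by (rule queue_frame) simp
    ultimately have "wp W count_predecessors (\<lambda>u \<tau>. u \<le> 110 * work (alive (set as)) + 98 * (n + 1) \<and>
        stores_counts (\<tau> ''count'') (live_tokens forward)) \<sigma>'"
      using bounded t visited zero(2) frameD[OF frame] by (intro wp_count_predecessors) simp_all
    then show "wp W count_predecessors (\<lambda>u. ?Q (t + u)) \<sigma>'"
    proof (rule wp_mono_frame[OF _ bounded])
      fix u \<tau> assume u: "u \<le> 110 * work (alive (set as)) + 98 * (n + 1) \<and>
          stores_counts (\<tau> ''count'') (live_tokens forward)"
        and "frame W (writes count_predecessors) \<sigma>' \<tau>"
      then have "stores_set n (\<tau> ''forward'') forward" using t frameD[of W _ \<sigma>' \<tau>] by simp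
      moreover have "t + u \<le> 370 * ((n + 1) * (m + 1))"
        using t u work_alive_le[of "set as"] by (simp add: algebra_simps)
      ultimately show "?Q (t + u) \<tau>" using u by blast
    qed
  qed
  then show ?thesis by (simp only: set_up_counters_def wp_Seq)
qed

theorem wp_initialise:
  "wp W initialise (\<lambda>t \<tau>. t \<le> 1000 * ((n + 1) * (m + 1)) \<and> maintained (set as) \<tau>) (input_state n s as)"
proof -
  define \<sigma>0 where "\<sigma>0 = input_state n s as"
  have zero: "\<sigma>0 ''deg'' = (\<lambda>_. 0)" "\<sigma>0 ''reached'' = (\<lambda>_. 0)" "\<sigma>0 ''queue_end'' 0 = 0"
      "\<sigma>0 ''forward'' = (\<lambda>_. 0)" "\<sigma>0 ''count'' = (\<lambda>_. 0)" "\<sigma>0 ''parent'' = (\<lambda>_. 0)"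
    by (simp_all add: \<sigma>0_def input_state_def)
  have bounded: "bounded_state W \<sigma>0" and inputs: "inputs \<sigma>0"
    by (simp_all add: \<sigma>0_def bounded_input_state inputs_input_state)
  from wp_explore[OF bounded inputs zero(1-3)] bounded obtain t1 \<sigma>1 where
    explore: "exec W explore \<sigma>0 t1 \<sigma>1" "t1 \<le> 450 * ((n + 1) * (m + 1))" "layout \<sigma>1"
      "set (queue \<sigma>1) = alive (set as)" "distinct (queue \<sigma>1)"
      "stores_set n (\<sigma>1 ''reached'') (alive (set as))" "frame W (writes explore) \<sigma>0 \<sigma>1"
    by (auto elim!: wpE)
  note frame1 = frameD[OF explore(7)]
  have "\<sigma>1 ''forward'' = (\<lambda>_. 0)" "\<sigma>1 ''count'' = (\<lambda>_. 0)" using zero frame1 by simp_all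
  from wp_set_up_counters[OF frame_bounded[OF explore(7)] explore(3) this explore(5,4,6)]
    frame_bounded[OF explore(7)] obtain t2 \<sigma>2 where
    counters: "exec W set_up_counters \<sigma>1 t2 \<sigma>2" "t2 \<le> 370 * ((n + 1) * (m + 1))"
      "stores_set n (\<sigma>2 ''forward'') forward" "stores_counts (\<sigma>2 ''count'') (live_tokens forward)"
      "frame W (writes set_up_counters) \<sigma>1 \<sigma>2"
    by (auto elim!: wpE)
  note frame2 = frameD[OF counters(5)]
  have layout: "layout \<sigma>2" using explore(3) counters(5) by (rule layout_frame) simp
  have "\<sigma>2 ''parent'' = (\<lambda>_. 0)" "stores_set n (\<sigma>2 ''reached'') (alive (set as))"
    using zero explore(6) frame1 frame2 by simp_all
  from wp_build_tree[OF frame_bounded[OF counters(5)] layoutD[OF layout] this]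
    frame_bounded[OF counters(5)] obtain t3 \<tau> where
    tree: "exec W build_tree \<sigma>2 t3 \<tau>" "t3 \<le> 120 * ((n + 1) * (m + 1))" "stores_tree (set as) \<tau>"
      "frame W (writes build_tree) \<sigma>2 \<tau>"
    by (auto elim!: wpE)
  have "layout \<tau>" using layout tree(4) by (rule layout_frame) simp
  moreover have "set as \<inter> forward = forward" using forward_edges_subset by fast
  ultimately have "maintained (set as) \<tau>"
    using tree(3) counters(3,4) frameD[OF tree(4)] by (simp add: maintained_def)
  moreover have "exec W initialise \<sigma>0 (t1 + (t2 + t3)) \<tau>"
    unfolding initialise_def by (rule exec.Seq[OF explore(1) exec.Seq[OF counters(1) tree(1)]])
  moreover have "t1 + (t2 + t3) \<le> 1000 * ((n + 1) * (m + 1))"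
    using explore(2) counters(2) tree(2) by linarith
  ultimately show ?thesis by (auto simp: wp_def \<sigma>0_def)
qed

end


section \<open>Serving a sequence of deletions\<close>

lemma (in flow_graph) flow_graph_delete_edge: "flow_graph (delete_edge G e) s"
  using start_in_verts pair_finite_verts pair_finite_arcs in_arcsD1 in_arcsD2
  by unfold_locales (auto simp: delete_edge_def)

context encoded_graph
begin

lemma stored_tree_eq_dominator_tree:
  assumes G: "flow_graph G s" "pverts G = {..<n}" and tree: "stores_tree (parcs G) \<sigma>"
  shows "stored_tree n s \<sigma> = dominator_tree G s"
proof -
  interpret flow_graph G s by (rule G(1))
  have less: "v < n" if "(s, v) \<in> (parcs G)\<^sup>*" for v
    using that reachable_in_verts(2)[of s v] G(2) by (simp add: reachable_start_iff)
  then have in_tree: "v < n \<and> \<sigma> ''in_tree'' v \<noteq> 0 \<longleftrightarrow> (s, v) \<in> (parcs G)\<^sup>*" for v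
    using tree by (auto simp: stores_tree_def)
  have "{v. v < n \<and> \<sigma> ''in_tree'' v \<noteq> 0} = {v. (s, v) \<in> (parcs G)\<^sup>*}"
    "{(\<sigma> ''parent'' v, v) |v. v < n \<and> \<sigma> ''in_tree'' v \<noteq> 0 \<and> v \<noteq> s} =
      {(\<sigma> ''parent'' v, v) |v. (s, v) \<in> (parcs G)\<^sup>* \<and> v \<noteq> s}"
    using in_tree by blast+
  moreover have "dominator_tree G s = \<lparr>pverts = {v. (s, v) \<in> (parcs G)\<^sup>*},
      parcs = {(\<sigma> ''parent'' v, v) |v. (s, v) \<in> (parcs G)\<^sup>* \<and> v \<noteq> s}\<rparr>"
    using tree less G(2) by (intro dominator_tree_eqI) (simp add: stores_tree_def)
  ultimately show ?thesis by (simp only: stored_tree_def)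
qed

lemma maintains_update:
  assumes "acyclic forward" "flow_graph G s" "pverts G = {..<n}" "parcs G \<subseteq> set as"
    and "maintained (parcs G) \<sigma>" "bounded_state W \<sigma>" "set es \<subseteq> {..<n} \<times> {..<n}"
  shows "\<exists>t. maintains W update n G s \<sigma> es t \<and>
    t \<le> potential (parcs G) + length es * (310 * (n + 1))"
  using assms
proof (induction es arbitrary: G \<sigma>)
  case Nil
  then show ?case using stored_tree_eq_dominator_tree[of G \<sigma>] by (simp add: maintained_def)
next
  case (Cons e es)
  obtain u v where e: "e = (u, v)" by (cases e)
  then have uv: "u < n" "v < n" using Cons.prems(7) by auto
  define G' where "G' = delete_edge G e"
  have flow': "flow_graph G' s"
    unfolding G'_def using Cons.prems(2) by (rule flow_graph.flow_graph_delete_edge)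
  have G': "pverts G' = {..<n}" "parcs G' \<subseteq> set as" "parcs G' = parcs G - {(u, v)}"
    using Cons.prems(3,4) by (auto simp: G'_def delete_edge_def e)
  have "bounded_state W (request e \<sigma>)"
    using Cons.prems(6) uv by (simp add: e request_def bounded_state_store)
  with wp_update[OF Cons.prems(1,4) uv Cons.prems(5,6)] obtain t1 \<tau> where
    t1: "exec W update (request e \<sigma>) t1 \<tau>" "maintained (parcs G') \<tau>" "bounded_state W \<tau>"
      "t1 + potential (parcs G') \<le> potential (parcs G) + 310 * (n + 1)"
    by (auto simp: G'(3) e frame_bounded elim!: wpE)
  from Cons.IH[OF Cons.prems(1) flow' G'(1,2) t1(2,3)] Cons.prems(7) obtain t2 where
    t2: "maintains W update n G' s \<tau> es t2"
      "t2 \<le> potential (parcs G') + length es * (310 * (n + 1))"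
    by auto
  have "stored_tree n s \<sigma> = dominator_tree G s"
    using Cons.prems by (intro stored_tree_eq_dominator_tree) (simp_all add: maintained_def)
  with t1(1) t2(1) have "maintains W update n G s \<sigma> (e # es) (t1 + t2)" by (auto simp: G'_def)
  moreover have "t1 + t2 \<le> potential (parcs G) + length (e # es) * (310 * (n + 1))"
    using t1(4) t2(2) by simp
  ultimately show ?case by blast
qed

theorem initialise_and_maintain:
  assumes G: "flow_graph G s" "reducible G s" "pverts G = {..<n}" "parcs G = set as"
    and es: "distinct es" "set es \<subseteq> set as"
  shows "\<exists>t0 \<sigma> t. exec W initialise (input_state n s as) t0 \<sigma> \<and> maintains W update n G s \<sigma> es t \<and>
    t0 + t \<le> 2000 * ((n + 1) * (m + 1))"
proof -
  define X where "X = (n + 1) * (m + 1)"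
  obtain t0 \<sigma> where init: "exec W initialise (input_state n s as) t0 \<sigma>" "t0 \<le> 1000 * X"
      "maintained (set as) \<sigma>" "bounded_state W \<sigma>"
    using wp_initialise bounded_input_state by (auto simp: X_def frame_bounded elim!: wpE)
  have "acyclic forward" using flow_graph.acyclic_forward_edges[OF G(1,2)] G(4) by simp
  from maintains_update[OF this G(1,3), of \<sigma> es] init es(2) edges_less G(4) obtain t where
    t: "maintains W update n G s \<sigma> es t" "t \<le> potential (set as) + length es * (310 * (n + 1))"
    by auto
  have "length es = card (set es)" using distinct_card[OF es(1)] by simp
  also have "\<dots> \<le> card (set as)" by (rule card_mono) (simp_all add: es(2))
  also have "\<dots> \<le> m" by (rule card_length)
  finally have "length es * (310 * (n + 1)) \<le> (m + 1) * (310 * (n + 1))"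
    by (intro mult_le_mono1) simp
  also have "\<dots> = 310 * X" by (simp add: X_def algebra_simps)
  finally have "t0 + t \<le> 2000 * X"
    using t(2) init(2) work_alive_le[of "set as"] by (simp add: potential_def X_def)
  with init(1) t(1) show ?thesis unfolding X_def by blast
qed

end

lemma word_size_bound:
  fixes n m :: nat
  assumes "0 < n"
  shows "(n + 2) * (n + m + 2) < (n + m + 1) ^ 5"
proof -
  define Y where "Y = n + m + 1"
  have Y: "2 \<le> Y" "n + 2 \<le> 2 * Y" "n + m + 2 \<le> 2 * Y" using assms by (simp_all add: Y_def)
  have "(n + 2) * (n + m + 2) \<le> (2 * Y) * (2 * Y)" using Y(2,3) by (rule mult_le_mono)
  also have "\<dots> \<le> (Y * Y) * (Y * Y)" using Y(1) by (intro mult_le_mono) auto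
  also have "\<dots> = Y ^ 4" by (simp add: power4_eq_xxxx)
  also have "\<dots> < Y ^ 5" using Y(1) by (intro power_strict_increasing) auto
  finally show ?thesis by (simp add: Y_def)
qed

theorem theorem4:
  shows "\<exists>(init :: com) (upd :: com) (C :: nat) (c :: nat).
    \<forall>(G :: nat pair_pre_digraph) (s :: nat) (n :: nat) (m :: nat)
      (as :: (nat \<times> nat) list) (es :: (nat \<times> nat) list).
      flow_graph G s \<and> reducible G s \<and>
      pverts G = {..<n} \<and> card (parcs G) = m \<and>
      distinct as \<and> set as = parcs G \<and>
      distinct es \<and> set es \<subseteq> parcs G \<longrightarrow>
      (\<exists>t0 \<sigma> t. exec ((n + m + 1) ^ c) init (input_state n s as) t0 \<sigma> \<and>
        maintains ((n + m + 1) ^ c) upd n G s \<sigma> es t \<and>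
        (m \<ge> 1 \<longrightarrow> t0 + t \<le> C * (m * n)))"
proof (rule exI[of _ initialise], rule exI[of _ update], rule exI[of _ 8000], rule exI[of _ 5],
    intro allI impI, elim conjE)
  fix G :: "nat pair_pre_digraph" and s n m :: nat and as es :: "(nat \<times> nat) list"
  assume G: "flow_graph G s" "reducible G s" "pverts G = {..<n}" "card (parcs G) = m"
    and as: "distinct as" "set as = parcs G" and es: "distinct es" "set es \<subseteq> parcs G"
  interpret flow_graph G s by (rule G(1))
  have m: "length as = m" using distinct_card[OF as(1)] as(2) G(4) by simp
  have start: "s < n" using start_in_verts G(3) by simp
  interpret encoded_graph n s "(n + m + 1) ^ 5" as
    using start as in_arcsD1 in_arcsD2 word_size_bound[of n m] G(3) by unfold_locales (auto simp: m)
  obtain t0 \<sigma> t where t: "exec ((n + m + 1) ^ 5) initialise (input_state n s as) t0 \<sigma>"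
    "maintains ((n + m + 1) ^ 5) update n G s \<sigma> es t" "t0 + t \<le> 2000 * ((n + 1) * (m + 1))"
    using initialise_and_maintain[OF G(1-3) as(2)[symmetric] es(1)] es(2) as(2) by (auto simp: m)
  have "(n + 1) * (m + 1) \<le> (2 * n) * (2 * m)" if "m \<ge> 1"
    using start that by (intro mult_le_mono) auto
  with t show "\<exists>t0 \<sigma> t. exec ((n + m + 1) ^ 5) initialise (input_state n s as) t0 \<sigma> \<and>
      maintains ((n + m + 1) ^ 5) update n G s \<sigma> es t \<and> (m \<ge> 1 \<longrightarrow> t0 + t \<le> 8000 * (m * n))"
    by (intro exI[of _ t0] exI[of _ \<sigma>] exI[of _ t]) (auto simp: algebra_simps)
qed

end
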